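(* Let $d\ge2$, $H\le\Sigma_d$, and let $\pi:V_d'(H)\to V_d'(H)_{ab}=V_d'(H)/[V_d'(H),V_d'(H)]$ be the canonical projection. The composite $H\to V_d'(H)_{ab}$, $h\mapsto\pi(\Lambda_1(h))$, is a surjective homomorphism, and its kernel is $N=\langle[H,H],H^{d-1}\rangle$ if $d$ is even, and $N=\langle[H,H],(H\cap A_d)^{d-1}\rangle$ if $d$ is odd. In particular $V_d'(H)_{ab}\cong H/N$ (a finite group).
   Context: $A=\{a_1,\dots,a_d\}$ (identified with $\{1,\dots,d\}$), $A^\omega$ the infinite words with ultrametric $d(x,y)=e^{1-n}$ ($n$ the first index where $x,y$ differ); balls are the sets $wA^\omega$, $w$ a finite word. $\Sigma_d$ is the symmetric group on $A$ acting letterwise on $A^\omega$, $A_d$ its alternating subgroup. $V_d(H)$ is the group of homeomorphisms $g$ of $A^\omega$ such that every point lies in a ball $w_1A^\omega$ on which $g$ has the form $w_1y\mapsto w_2\sigma(y)$ for some finite word $w_2$ and $\sigma\in H$; $H$ is identified with the subgroup of $V_d(H)$ acting letterwise. Every $g\in V_d(H)$ admits a *table*: finite words $v_1<\dots<v_m$ and $u_1<\dots<u_m$ (lexicographic order) such that $\{v_iA^\omega\}$ and $\{u_iA^\omega\}$ are partitions of $A^\omega$, elements $h_1,\dots,h_m\in H$ and $\tau\in\Sigma_m$ with $g(v_iy)=u_{\tau(i)}h_i(y)$ for all $i$ and $y$; the table is *even/odd* according to the parity of $\tau$. If $d$ is odd and $H\le A_d$, the parity of a table of $g$ does not depend on the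 table, and $V_d'(H)$ is defined as the index-2 subgroup of elements with even tables; otherwise (if $d$ is even, or $H$ contains an odd permutation) $V_d'(H)=V_d(H)$. For $h\in H$, $\Lambda_1(h)\in V_d'(H)$ is the homeomorphism $a_1y\mapsto a_1h(y)$ on $a_1A^\omega$ and the identity off $a_1A^\omega$. For a group $G$, $G^k=\{g^k:g\in G\}$ and $\langle\cdot\rangle$ is the subgroup generated. *)

theory Defs
  imports Complex_Main "HOL-Algebra.Algebra"
begin

text \<open>Alphabet A = {1..d}. Infinite words are functions nat => nat with values in {1..d}
  (index 0 is the first letter). Finite words are lists over {1..d}.\<close>

definition infwords :: "nat \<Rightarrow> (nat \<Rightarrow> nat) set" where
  "infwords d = {x. \<forall>i. x i \<in> {1..d}}"

definition finword :: "nat \<Rightarrow> nat list \<Rightarrow> bool" where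
  "finword d w \<longleftrightarrow> set w \<subseteq> {1..d}"

definition conc :: "nat list \<Rightarrow> (nat \<Rightarrow> nat) \<Rightarrow> (nat \<Rightarrow> nat)" where
  "conc w y = (\<lambda>i. if i < length w then w ! i else y (i - length w))"

definition ball_w :: "nat \<Rightarrow> nat list \<Rightarrow> (nat \<Rightarrow> nat) set" where
  "ball_w d w = conc w ` infwords d"

text \<open>Ultrametric d(x,y) = e^(1-n), n the first (1-based) index where x, y differ.\<close>
definition wdist :: "(nat \<Rightarrow> nat) \<Rightarrow> (nat \<Rightarrow> nat) \<Rightarrow> real" where
  "wdist x y = (if x = y then 0 else exp (1 - real (Suc (LEAST i. x i \<noteq> y i))))"

definition wcont :: "nat \<Rightarrow> ((nat \<Rightarrow> nat) \<Rightarrow> (nat \<Rightarrow> nat)) \<Rightarrow> bool" where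
  "wcont d g \<longleftrightarrow> (\<forall>x\<in>infwords d. \<forall>e>0. \<exists>\<delta>>0. \<forall>y\<in>infwords d.
      wdist x y < \<delta> \<longrightarrow> wdist (g x) (g y) < e)"

text \<open>Homeomorphisms of A^omega, normalised to be the identity off A^omega
  (so that they form a group under composition).\<close>
definition whomeo :: "nat \<Rightarrow> ((nat \<Rightarrow> nat) \<Rightarrow> (nat \<Rightarrow> nat)) \<Rightarrow> bool" where
  "whomeo d g \<longleftrightarrow> bij_betw g (infwords d) (infwords d) \<and> wcont d g
      \<and> wcont d (inv_into (infwords d) g) \<and> (\<forall>x. x \<notin> infwords d \<longrightarrow> g x = x)"

text \<open>V_d(H); H is a set of permutations of {1..d}, acting letterwise via sigma o y.\<close>
definition Vd :: "nat \<Rightarrow> (nat \<Rightarrow> nat) set \<Rightarrow> ((nat \<Rightarrow> nat) \<Rightarrow> (nat \<Rightarrow> nat)) set" where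
  "Vd d H = {g. whomeo d g \<and>
     (\<forall>x\<in>infwords d. \<exists>w1 w2 \<sigma>. finword d w1 \<and> finword d w2 \<and> \<sigma> \<in> H \<and>
        x \<in> ball_w d w1 \<and> (\<forall>y\<in>infwords d. g (conc w1 y) = conc w2 (\<sigma> \<circ> y)))}"

definition lexlt :: "nat list \<Rightarrow> nat list \<Rightarrow> bool" where
  "lexlt u v \<longleftrightarrow> (u, v) \<in> lexord {(a, b). a < b}"

definition is_partition_words :: "nat \<Rightarrow> nat list list \<Rightarrow> bool" where
  "is_partition_words d ws \<longleftrightarrow> (\<forall>w\<in>set ws. finword d w)
     \<and> (\<forall>i<length ws. \<forall>j<length ws. i \<noteq> j \<longrightarrow> ball_w d (ws ! i) \<inter> ball_w d (ws ! j) = {})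
     \<and> (\<Union>w\<in>set ws. ball_w d w) = infwords d"

definition is_table :: "nat \<Rightarrow> (nat \<Rightarrow> nat) set \<Rightarrow> ((nat \<Rightarrow> nat) \<Rightarrow> (nat \<Rightarrow> nat))
     \<Rightarrow> nat list list \<Rightarrow> nat list list \<Rightarrow> (nat \<Rightarrow> nat) list \<Rightarrow> (nat \<Rightarrow> nat) \<Rightarrow> bool" where
  "is_table d H g vs us hs \<tau> \<longleftrightarrow>
     length us = length vs \<and> length hs = length vs \<and>
     sorted_wrt lexlt vs \<and> sorted_wrt lexlt us \<and>
     is_partition_words d vs \<and> is_partition_words d us \<and>
     set hs \<subseteq> H \<and> \<tau> permutes {0..<length vs} \<and>
     (\<forall>i<length vs. \<forall>y\<in>infwords d. g (conc (vs ! i) y) = conc (us ! \<tau> i) ((hs ! i) \<circ> y))"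

definition has_even_table :: "nat \<Rightarrow> (nat \<Rightarrow> nat) set \<Rightarrow> ((nat \<Rightarrow> nat) \<Rightarrow> (nat \<Rightarrow> nat)) \<Rightarrow> bool" where
  "has_even_table d H g \<longleftrightarrow> (\<exists>vs us hs \<tau>. is_table d H g vs us hs \<tau> \<and> evenperm \<tau>)"

definition Vd' :: "nat \<Rightarrow> (nat \<Rightarrow> nat) set \<Rightarrow> ((nat \<Rightarrow> nat) \<Rightarrow> (nat \<Rightarrow> nat)) set" where
  "Vd' d H = (if odd d \<and> H \<subseteq> carrier (alt_group d)
              then {g \<in> Vd d H. has_even_table d H g} else Vd d H)"

definition Vgroup' :: "nat \<Rightarrow> (nat \<Rightarrow> nat) set \<Rightarrow> ((nat \<Rightarrow> nat) \<Rightarrow> (nat \<Rightarrow> nat)) monoid" where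
  "Vgroup' d H = \<lparr>carrier = Vd' d H, monoid.mult = (\<circ>), one = id\<rparr>"

definition Lambda1 :: "nat \<Rightarrow> (nat \<Rightarrow> nat) \<Rightarrow> (nat \<Rightarrow> nat) \<Rightarrow> (nat \<Rightarrow> nat)" where
  "Lambda1 d h x = (if x \<in> infwords d \<and> x 0 = 1 then conc [1] (h \<circ> (\<lambda>i. x (Suc i))) else x)"

definition abelianization :: "('a, 'b) monoid_scheme \<Rightarrow> 'a set monoid" where
  "abelianization G = G Mod (derived G (carrier G))"

definition ab_proj :: "('a, 'b) monoid_scheme \<Rightarrow> 'a \<Rightarrow> 'a set" where
  "ab_proj G g = derived G (carrier G) #>\<^bsub>G\<^esub> g"

definition powers_set :: "('a, 'b) monoid_scheme \<Rightarrow> 'a set \<Rightarrow> nat \<Rightarrow> 'a set" where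
  "powers_set G S k = {g [^]\<^bsub>G\<^esub> k | g. g \<in> S}"

definition Nsub :: "nat \<Rightarrow> (nat \<Rightarrow> nat) set \<Rightarrow> (nat \<Rightarrow> nat) set" where
  "Nsub d H = (if even d
     then generate (sym_group d) (derived_set (sym_group d) H \<union> powers_set (sym_group d) H (d - 1))
     else generate (sym_group d) (derived_set (sym_group d) H
              \<union> powers_set (sym_group d) (H \<inter> carrier (alt_group d)) (d - 1)))"

end

theory Submission
  imports Defs "HOL-Library.List_Lexorder" "HOL-Library.Sublist"
begin

text \<open>
  Call a complete prefix code \<open>Q\<close> adapted to \<open>g\<close> if \<open>g\<close> has the form
  \<open>w y \<mapsto> u\<^sub>w h\<^sub>w(y)\<close> on the ball of every \<open>w \<in> Q\<close>. Given a homomorphism \<open>\<phi>\<close> from \<open>H\<close> to an abelian group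
  and an element \<open>\<epsilon>\<close> with \<open>\<epsilon>\<^sup>2 = 1\<close>, the product of \<open>\<epsilon>\<close> to the number of inversions of
  \<open>w \<mapsto> u\<^sub>w\<close> with all \<open>\<phi>(h\<^sub>w)\<close> does not change when a word of \<open>Q\<close> is replaced by its
  \<open>d\<close> children, as soon as \<open>\<phi>(h)\<close> to the power \<open>d - 1\<close> is \<open>\<epsilon>\<close> to the number of inversions of \<open>h\<close>
  (and \<open>d\<close> is odd or \<open>\<epsilon> = 1\<close>). It is then a homomorphism on \<open>V\<^sub>d(H)\<close>. With values in
  \<open>{1, -1}\<close> it is the parity of tables; with values in \<open>H/N\<close> it bounds the kernel.

  Conversely, cancelling carets shows that swaps of two disjoint balls and the maps
  \<open>w y \<mapsto> w h(y)\<close> generate \<open>V\<^sub>d(H)\<close>. Modulo the commutator subgroup of \<open>V\<^sub>d'(H)\<close>, three-cycles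
  of balls make all swaps equal to one involution \<open>\<sigma>\<close> and identify \<open>w y \<mapsto> w h(y)\<close> with
  \<open>\<Lambda>\<^sub>1(h)\<close>. Splitting a ball into its \<open>d\<close> children yields \<open>\<sigma> = 1\<close> for even \<open>d\<close>, and
  that \<open>\<Lambda>\<^sub>1(h)\<close> to the power \<open>d - 1\<close> is \<open>\<sigma>\<close> or \<open>1\<close> according to the parity of \<open>h\<close>.
\<close>

section \<open>Inversions\<close>

text \<open>Source and target code of an element are different sets, so there is no permutation
  whose sign could be taken. Inversions make sense for a map between two linear orders, and the
  lexicographic order suits expansion because incomparable words keep their order under extension.

  The generation half runs in the quotient of all of \<open>V\<close> by \<open>D\<close>, the
  commutator subgroup of \<open>V'\<close>, and not in the abelianization itself: if
  \<open>d\<close> is odd and \<open>H\<close> consists of even permutations, the swap of two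
  distinct balls is not in \<open>V'\<close>. This larger quotient is not known to be commutative;
  only classes of elements of \<open>V'\<close> commute. Conjugations are therefore made by even
  permutations of balls, and these need a third disjoint ball. For \<open>d = 2\<close> two disjoint
  balls may already fill the space. This is why swaps for even \<open>d\<close> are treated by
  splitting both balls, and why the reference swap \<open>s0\<close> lies below the letter 2 and
  leaves the ball of 1 free.\<close>

definition cross :: "('a::linorder \<Rightarrow> 'b::linorder) \<Rightarrow> 'a \<Rightarrow> 'a \<Rightarrow> nat" where
  "cross f x y = of_bool (x < y \<and> f y < f x) + of_bool (y < x \<and> f x < f y)"

definition invs :: "('a::linorder \<Rightarrow> 'b::linorder) \<Rightarrow> 'a set \<Rightarrow> nat" where
  "invs f S = (\<Sum>x\<in>S. \<Sum>y\<in>S. of_bool (x < y \<and> f y < f x))"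

lemma cross_commute: "cross f x y = cross f y x"
  by (simp add: cross_def)

lemma invs_empty [simp]: "invs f {} = 0"
  by (simp add: invs_def)

lemma invs_Un:
  assumes "finite A" "finite B" "A \<inter> B = {}"
  shows "invs f (A \<union> B) = invs f A + invs f B + (\<Sum>x\<in>A. \<Sum>y\<in>B. cross f x y)"
proof -
  define r where "r x y = (of_bool (x < y \<and> f y < f x) :: nat)" for x y
  have "invs f (A \<union> B) = invs f A + invs f B + ((\<Sum>x\<in>A. \<Sum>y\<in>B. r x y) + (\<Sum>x\<in>B. \<Sum>y\<in>A. r x y))"
    unfolding invs_def r_def[symmetric] using assms by (simp add: sum.union_disjoint sum.distrib)
  also have "(\<Sum>x\<in>B. \<Sum>y\<in>A. r x y) = (\<Sum>x\<in>A. \<Sum>y\<in>B. r y x)"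
    by (rule sum.swap)
  finally show ?thesis by (simp only: cross_def sum.distrib r_def)
qed

lemma invs_insert:
  assumes "finite S" "x \<notin> S"
  shows "invs f (insert x S) = invs f S + (\<Sum>y\<in>S. cross f x y)"
  using invs_Un[of "{x}" S f] assms by (simp add: invs_def)

lemma invs_id [simp]: "invs (\<lambda>x. x) S = 0"
  unfolding invs_def by (intro sum.neutral ballI) auto

lemma invs_cong: "(\<And>x. x \<in> S \<Longrightarrow> f x = g x) \<Longrightarrow> invs f S = invs g S"
  unfolding invs_def by (intro sum.cong refl) auto

lemma cross_comp_even:
  assumes "x \<noteq> y" "f x \<noteq> f y" "g (f x) \<noteq> g (f y)"
  shows "even (cross (g \<circ> f) x y + cross f x y + cross g (f x) (f y))"
  using assms by (auto simp: cross_def neq_iff)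

text \<open>Modulo 2 the count is additive because a pair is inverted by \<open>g \<circ> f\<close>
  exactly when one of the two maps inverts it, \<open>f\<close> at the pair itself or
  \<open>g\<close> at its image, but not both.\<close>

lemma invs_comp_even:
  assumes "finite S" "inj_on f S" "inj_on g (f ` S)"
  shows "even (invs (g \<circ> f) S + invs f S + invs g (f ` S))"
  using assms
proof (induction S)
  case (insert x S)
  have fx: "f x \<notin> f ` S" using insert by auto
  have IH: "even (invs (g \<circ> f) S + invs f S + invs g (f ` S))"
    using insert by (intro insert.IH) (auto intro: inj_on_subset)
  have "(\<Sum>y\<in>f ` S. cross g (f x) y) = (\<Sum>y\<in>S. cross g (f x) (f y))"
    using insert by (subst sum.reindex) auto
  then have eq: "invs (g \<circ> f) (insert x S) + invs f (insert x S) + invs g (f ` insert x S)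
     = (invs (g \<circ> f) S + invs f S + invs g (f ` S))
       + (\<Sum>y\<in>S. cross (g \<circ> f) x y + cross f x y + cross g (f x) (f y))"
    using insert fx by (simp add: invs_insert sum.distrib)
  have "even (\<Sum>y\<in>S. cross (g \<circ> f) x y + cross f x y + cross g (f x) (f y))"
  proof (rule dvd_sum)
    fix y assume "y \<in> S"
    then have "x \<noteq> y" "f x \<noteq> f y" "g (f x) \<noteq> g (f y)"
      using insert.hyps(2) insert.prems by (auto simp: inj_on_def)
    then show "even (cross (g \<circ> f) x y + cross f x y + cross g (f x) (f y))"
      by (rule cross_comp_even)
  qed
  then show ?case unfolding eq by (rule dvd_add[OF IH])
qed simp

text \<open>Besides \<open>{a, b}\<close>, the inverted pairs are \<open>{a, y}\<close> and
  \<open>{b, y}\<close> for \<open>y\<close> strictly between \<open>a\<close> and \<open>b\<close>;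
  these come two by two.\<close>

lemma invs_transpose_odd:
  fixes a b :: "'a::linorder"
  assumes "finite S" "a \<in> S" "b \<in> S" "a \<noteq> b"
  shows "odd (invs (transpose a b) S)"
proof -
  have *: "odd (invs (transpose a b) S)" if "a \<in> S" "b \<in> S" "a < b" for a b :: 'a
  proof -
    define R where "R = S - {a, b}"
    have S: "S = insert a (insert b R)" and fin: "finite R" and ab: "a \<notin> R" "b \<notin> R"
      using that assms by (auto simp: R_def)
    have 0: "invs (transpose a b) R = 0"
      unfolding invs_def using ab by (intro sum.neutral ballI) (auto simp: transpose_def)
    have 1: "cross (transpose a b) a b = 1"
      using that by (simp add: cross_def)
    have 2: "cross (transpose a b) a y = cross (transpose a b) b y" if "y \<in> R" for y
      using that ab \<open>a < b\<close> by (auto simp: cross_def transpose_def)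
    have "invs (transpose a b) S = 1 + 2 * (\<Sum>y\<in>R. cross (transpose a b) b y)"
      unfolding S using ab fin that by (simp add: invs_insert 0 1 2)
    then show ?thesis by simp
  qed
  from assms(4) consider "a < b" | "b < a" by fastforce
  then show ?thesis
    using *[of a b] *[of b a] assms by cases (auto simp: transpose_commute)
qed

text \<open>Ties the sign of a permutation, which rests on transpositions, to the count that also
  applies when source and target code differ.\<close>

lemma evenperm_iff_invs:
  fixes p :: "'a::linorder \<Rightarrow> 'a"
  assumes "finite S" "p permutes S"
  shows "evenperm p \<longleftrightarrow> even (invs p S)"
  using assms
proof (induction rule: permutes_rev_induct)
  case id
  then show ?case by (simp add: id_def del: permutes_id)
next
  case (swap a b p)
  have "transpose a b ` S = S"
    using swap permutes_image permutes_swap_id by metis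
  moreover have "inj_on p (transpose a b ` S)" "inj_on (transpose a b) S"
    using swap by (meson permutes_inj_on permutes_swap_id)+
  ultimately have "even (invs (p \<circ> transpose a b) S + invs (transpose a b) S + invs p S)"
    using invs_comp_even[of S "transpose a b" p] assms by simp
  moreover have "odd (invs (transpose a b) S)"
    using swap assms by (intro invs_transpose_odd) auto
  moreover have "evenperm (p \<circ> transpose a b) \<longleftrightarrow> \<not> evenperm p"
    using swap assms
    by (subst evenperm_comp) (auto simp: permutation_swap_id evenperm_swap intro: permutes_imp_permutation)
  ultimately show ?case using swap.IH unfolding even_add by blast
qed

section \<open>Words\<close>

definition pre :: "nat \<Rightarrow> (nat \<Rightarrow> nat) \<Rightarrow> nat list" where
  "pre n x = map x [0..<n]"

definition sdrop :: "nat \<Rightarrow> (nat \<Rightarrow> nat) \<Rightarrow> (nat \<Rightarrow> nat)" where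
  "sdrop n x = (\<lambda>i. x (i + n))"

lemma length_pre [simp]: "length (pre n x) = n"
  by (simp add: pre_def)

lemma pre_0 [simp]: "pre 0 x = []"
  by (simp add: pre_def)

lemma conc_Nil [simp]: "conc [] y = y"
  by (simp add: conc_def)

lemma conc_append: "conc (u @ v) y = conc u (conc v y)"
  by (auto simp: conc_def fun_eq_iff nth_append)

lemma conc_inj [simp]: "conc w y = conc w z \<longleftrightarrow> y = z"
proof
  assume "conc w y = conc w z"
  then have "conc w y (i + length w) = conc w z (i + length w)" for i by simp
  then show "y = z" by (auto simp: conc_def fun_eq_iff)
qed simp

lemma sdrop_conc [simp]: "sdrop (length w) (conc w y) = y"
  by (simp add: sdrop_def conc_def)

lemma pre_conc [simp]: "pre (length w) (conc w y) = w"
  by (auto simp: pre_def conc_def intro: nth_equalityI)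

lemma conc_pre_sdrop [simp]: "conc (pre n x) (sdrop n x) = x"
  by (auto simp: pre_def conc_def sdrop_def fun_eq_iff)

lemma comp_conc: "h \<circ> conc w y = conc (map h w) (h \<circ> y)"
  by (auto simp: conc_def fun_eq_iff)

lemma pre_Suc: "pre (Suc n) x = pre n x @ [x n]"
  by (simp add: pre_def)

lemma take_pre: "m \<le> n \<Longrightarrow> take m (pre n x) = pre m x"
  by (simp add: pre_def take_map)

lemma prefix_pre: "m \<le> n \<Longrightarrow> prefix (pre m x) (pre n x)"
  by (metis take_pre take_is_prefix)

lemma conc_mem [simp]: "finword d w \<Longrightarrow> conc w y \<in> infwords d \<longleftrightarrow> y \<in> infwords d"
proof
  assume "finword d w" "conc w y \<in> infwords d"
  then have "conc w y (i + length w) \<in> {1..d}" for i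
    unfolding infwords_def by blast
  then show "y \<in> infwords d" by (auto simp: infwords_def conc_def)
next
  assume "finword d w" "y \<in> infwords d"
  then show "conc w y \<in> infwords d"
    unfolding infwords_def finword_def conc_def using nth_mem by fastforce
qed

lemma finword_append [simp]: "finword d (u @ v) \<longleftrightarrow> finword d u \<and> finword d v"
  by (auto simp: finword_def)

lemma finword_Nil [simp]: "finword d []"
  by (simp add: finword_def)

lemma finword_sing [simp]: "finword d [a] \<longleftrightarrow> a \<in> {1..d}"
  by (simp add: finword_def)

lemma finword_pre [simp]: "x \<in> infwords d \<Longrightarrow> finword d (pre n x)"
  by (auto simp: finword_def pre_def infwords_def)

lemma sdrop_mem [simp]: "x \<in> infwords d \<Longrightarrow> sdrop n x \<in> infwords d"
  by (auto simp: sdrop_def infwords_def)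

lemma const1_mem: "1 \<le> d \<Longrightarrow> (\<lambda>_. 1) \<in> infwords d"
  by (auto simp: infwords_def)

lemma mem_ball_w:
  "finword d w \<Longrightarrow> x \<in> ball_w d w \<longleftrightarrow> x \<in> infwords d \<and> pre (length w) x = w"
  unfolding ball_w_def by (metis conc_mem conc_pre_sdrop image_iff pre_conc sdrop_mem)

lemma pre_eq_prefix:
  assumes "pre (length u) x = u" "pre (length v) x = v"
  shows "prefix u v \<or> prefix v u"
  by (metis assms le_cases prefix_pre)

lemma ball_w_disjoint_iff:
  assumes "1 \<le> d" "finword d u" "finword d v"
  shows "ball_w d u \<inter> ball_w d v = {} \<longleftrightarrow> u \<parallel> v"
proof
  assume *: "ball_w d u \<inter> ball_w d v = {}"
  have np: False if uv: "prefix u v" "finword d u" "finword d v" "ball_w d u \<inter> ball_w d v = {}" for u v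
  proof -
    obtain z where z: "v = u @ z" using uv by (auto simp: prefix_def)
    let ?x = "conc v (\<lambda>_. 1)"
    have "?x \<in> ball_w d v" unfolding ball_w_def using const1_mem[OF assms(1)] by auto
    moreover have "?x \<in> ball_w d u"
      unfolding ball_w_def z conc_append using const1_mem[OF assms(1)] uv z by auto
    ultimately show False using uv by auto
  qed
  show "u \<parallel> v" using np[of u v] np[of v u] assms * by (auto simp: Int_commute)
next
  assume "u \<parallel> v"
  then show "ball_w d u \<inter> ball_w d v = {}"
    using pre_eq_prefix[of u _ v] assms by (fastforce simp: mem_ball_w)
qed

lemma lexlt_iff_less: "lexlt u v \<longleftrightarrow> u < v"
  by (simp add: lexlt_def list_less_def)

lemma append_less_append_iff: "(w @ u < w @ v) = (u < (v :: nat list))"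
  unfolding list_less_def by (simp add: lexord_same_pref_iff)

text \<open>The first letter at which two incomparable words differ decides their order, whatever
  follows. So all children of a word lie on the same side of any other word of a code as the word
  itself.\<close>

lemma parallel_less_append:
  assumes "u \<parallel> (v :: nat list)"
  shows "u @ p < v @ q \<longleftrightarrow> u < v"
proof -
  obtain as b bs c cs where "b \<noteq> c" "u = as @ b # bs" "v = as @ c # cs"
    using parallel_decomp[OF assms] by blast
  then show ?thesis
    by (simp add: append_less_append_iff)
qed

section \<open>Complete prefix codes\<close>

definition antichain :: "nat \<Rightarrow> nat list set \<Rightarrow> bool" where
  "antichain d U \<longleftrightarrow> finite U \<and> (\<forall>u\<in>U. finword d u) \<and> (\<forall>u\<in>U. \<forall>v\<in>U. u \<noteq> v \<longrightarrow> u \<parallel> v)"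

definition code :: "nat \<Rightarrow> nat list set \<Rightarrow> bool" where
  "code d Q \<longleftrightarrow> antichain d Q \<and> (\<forall>x\<in>infwords d. \<exists>w\<in>Q. pre (length w) x = w)"

definition kids :: "nat \<Rightarrow> nat list \<Rightarrow> nat list set" where
  "kids d w = (\<lambda>a. w @ [a]) ` {1..d}"

definition words :: "nat \<Rightarrow> nat \<Rightarrow> nat list set" where
  "words d n = {w. finword d w \<and> length w = n}"

lemma finite_words [simp]: "finite (words d n)"
  using finite_lists_length_eq[of "{1..d}" n] by (simp add: words_def finword_def)

lemma antichainD:
  assumes "antichain d U"
  shows "finite U" "\<And>u. u \<in> U \<Longrightarrow> finword d u" "\<And>u v. u \<in> U \<Longrightarrow> v \<in> U \<Longrightarrow> u \<noteq> v \<Longrightarrow> u \<parallel> v"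
  using assms by (auto simp: antichain_def)

lemma antichain_eq:
  assumes "antichain d U" "u \<in> U" "v \<in> U" "pre (length u) x = u" "pre (length v) x = v"
  shows "u = v"
  using assms pre_eq_prefix[of u x v] antichainD(3)[OF assms(1-3)] by auto

lemma parallel_commute: "u \<parallel> v \<longleftrightarrow> v \<parallel> u"
  by (auto simp: parallel_def)

lemma not_parallel_append [simp]: "\<not> w \<parallel> w @ z" "\<not> w @ z \<parallel> w" "\<not> w \<parallel> w" "\<not> [] \<parallel> w" "\<not> w \<parallel> []"
  by (auto simp: parallel_def)

lemma antichain_subset: "antichain d U \<Longrightarrow> W \<subseteq> U \<Longrightarrow> antichain d W"
  unfolding antichain_def by (meson finite_subset subsetD)

lemma codeD:
  assumes "code d Q"
  shows "antichain d Q" "finite Q" "\<And>u. u \<in> Q \<Longrightarrow> finword d u"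
    "\<And>x. x \<in> infwords d \<Longrightarrow> \<exists>w\<in>Q. pre (length w) x = w"
  using assms by (auto simp: code_def antichain_def)

lemma parallel_same_length: "length u = length v \<Longrightarrow> u \<noteq> v \<Longrightarrow> u \<parallel> v"
  by (auto simp: parallel_def prefix_def)

lemma code_words: "code d (words d n)"
proof -
  have "antichain d (words d n)"
    by (auto simp: antichain_def words_def intro: parallel_same_length finite_words[unfolded words_def])
  moreover have "\<exists>w\<in>words d n. pre (length w) x = w" if "x \<in> infwords d" for x
    using that by (intro bexI[of _ "pre n x"]) (auto simp: words_def)
  ultimately show ?thesis by (simp add: code_def)
qed

text \<open>The missing part of the space is filled with the words of the maximal length occurring
  in \<open>U\<close> that extend no word of \<open>U\<close>. Maps defined on an antichain can thus
  be examined on a complete code.\<close>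

lemma antichain_extend:
  assumes "antichain d U"
  obtains Q where "code d Q" "U \<subseteq> Q"
proof -
  \<comment> \<open>If \<open>U\<close> is empty, \<open>n\<close> is an unspecified number, and
    \<open>words d n\<close> is a code for every \<open>n\<close>.\<close>
  define n where "n = Max (length ` U)"
  have n: "length u \<le> n" if "u \<in> U" for u
    using antichainD(1)[OF assms] that by (simp add: n_def)
  define Q where "Q = U \<union> {w \<in> words d n. \<forall>u\<in>U. \<not> prefix u w}"
  have "u \<parallel> w" if "u \<in> U" "w \<in> words d n" "\<forall>u\<in>U. \<not> prefix u w" for u w
  proof -
    have "\<not> prefix w u"
    proof
      assume p: "prefix w u"
      then have "length w = length u"
        using that n[of u] prefix_length_le[OF p] by (simp add: words_def)
      then have "w = u" using p by (metis prefix_def append_self_conv length_append length_0_conv add_cancel_right_right)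
      then show False using that by blast
    qed
    then show ?thesis using that by auto
  qed
  note par = this
  have "antichain d Q"
    unfolding antichain_def
  proof (intro conjI ballI impI)
    show "finite Q" using antichainD(1)[OF assms] by (simp add: Q_def)
    show "finword d u" if "u \<in> Q" for u
      using that antichainD(2)[OF assms] by (auto simp: Q_def words_def)
    show "u \<parallel> v" if "u \<in> Q" "v \<in> Q" "u \<noteq> v" for u v
      using that antichainD(3)[OF assms] par[of u v] par[of v u] parallel_commute[of v u]
        parallel_same_length[of u v] by (auto simp: Q_def words_def)
  qed
  moreover have "\<exists>w\<in>Q. pre (length w) x = w" if x: "x \<in> infwords d" for x
  proof (cases "\<exists>u\<in>U. prefix u (pre n x)")
    case True
    then obtain u where u: "u \<in> U" "prefix u (pre n x)" by blast
    then have "pre (length u) x = u"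
      using take_pre[of "length u" n x] n by (auto simp: prefix_def)
    then show ?thesis using u by (auto simp: Q_def)
  next
    case False
    then show ?thesis using x by (intro bexI[of _ "pre n x"]) (auto simp: Q_def words_def)
  qed
  ultimately have "code d Q" by (simp add: code_def)
  then show thesis using that by (auto simp: Q_def)
qed

lemma kids_inter:
  assumes "antichain d Q" "w \<in> Q"
  shows "kids d w \<inter> Q = {}"
proof -
  have "w @ [a] \<notin> Q" for a
    using antichainD(3)[OF assms(1) assms(2), of "w @ [a]"] by auto
  then show ?thesis by (auto simp: kids_def)
qed

lemma finite_kids [simp]: "finite (kids d w)"
  by (simp add: kids_def)

lemma card_kids [simp]: "card (kids d w) = d"
  unfolding kids_def by (subst card_image) (auto simp: inj_on_def)

lemma parallel_snoc: "u \<parallel> w \<Longrightarrow> u \<parallel> w @ [a]"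
  by (auto simp: parallel_def dest: append_prefixD)

lemma parallel_snoc_same: "a \<noteq> b \<Longrightarrow> w @ [a] \<parallel> w @ [b]"
  by (rule parallel_same_length) auto

lemma parallel_snoc': "w \<parallel> u \<Longrightarrow> w @ [a] \<parallel> u"
  using parallel_snoc[of u w a] by (simp add: parallel_commute)

lemma code_expand:
  assumes "code d Q" "w \<in> Q"
  shows "code d (Q - {w} \<union> kids d w)"
proof -
  note Q = codeD[OF assms(1)] and A = antichainD[OF codeD(1)[OF assms(1)]]
  have "antichain d (Q - {w} \<union> kids d w)"
    unfolding antichain_def using A assms(2)
    by (auto simp: kids_def intro: parallel_snoc parallel_snoc' parallel_snoc_same)
  moreover have "\<exists>v\<in>Q - {w} \<union> kids d w. pre (length v) x = v" if x: "x \<in> infwords d" for x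
  proof -
    obtain v where v: "v \<in> Q" "pre (length v) x = v" using Q(4) x by blast
    show ?thesis
    proof (cases "v = w")
      case True
      have "pre (Suc (length w)) x \<in> kids d w"
        using v True x by (auto simp: pre_Suc kids_def infwords_def)
      then show ?thesis by (intro bexI[of _ "pre (Suc (length w)) x"]) auto
    qed (use v in auto)
  qed
  ultimately show ?thesis by (simp add: code_def)
qed

text \<open>A word of \<open>Q\<close> outside \<open>kids d w\<close> that is comparable with
  \<open>w\<close> would be comparable with one of the children of \<open>w\<close>, against the
  antichain property.\<close>

lemma code_contract:
  assumes d: "1 \<le> d" and "code d Q" "kids d w \<subseteq> Q"
  shows "code d (insert w (Q - kids d w))" "w \<notin> Q"
proof -
  note Q = codeD[OF assms(2)] and A = antichainD[OF codeD(1)[OF assms(2)]]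
  have w1: "w @ [1] \<in> Q" using assms d by (auto simp: kids_def)
  then have fw: "finword d w" using A(2) finword_append by blast
  show wQ: "w \<notin> Q"
    using A(3)[OF w1, of w] by auto
  have par: "w \<parallel> v" if vQ: "v \<in> Q" "v \<notin> kids d w" for v
  proof -
    have "\<not> prefix v w"
    proof
      assume "prefix v w"
      then have "prefix v (w @ [1])" "v \<noteq> w @ [1]" by (auto simp: prefix_def)
      then show False using A(3)[OF that(1) w1] by (auto simp: parallel_def)
    qed
    moreover have "\<not> prefix w v"
    proof
      assume "prefix w v"
      then obtain z where z: "v = w @ z" by (auto simp: prefix_def)
      then obtain a z' where z': "z = a # z'" using wQ vQ by (cases z) auto
      have "a \<in> {1..d}" using A(2)[OF that(1)] z z' by (auto simp: finword_def)
      then have "w @ [a] \<in> Q" "v \<noteq> w @ [a]" using assms that by (auto simp: kids_def)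
      then show False using A(3)[of "w @ [a]" v] that z z' by (auto simp: parallel_def)
    qed
    ultimately show ?thesis by auto
  qed
  have "antichain d (insert w (Q - kids d w))"
    unfolding antichain_def using A fw par parallel_commute by simp blast
  moreover have "\<exists>v\<in>insert w (Q - kids d w). pre (length v) x = v" if x: "x \<in> infwords d" for x
  proof -
    obtain v where v: "v \<in> Q" "pre (length v) x = v" using Q(4) x by blast
    show ?thesis
    proof (cases "v \<in> kids d w")
      case True
      then have "pre (length w) x = w" using v by (auto simp: kids_def pre_Suc)
      then show ?thesis by auto
    qed (use v in auto)
  qed
  ultimately show "code d (insert w (Q - kids d w))" by (simp add: code_def)
qed

lemma code_mem_Nil:
  assumes "code d Q" "[] \<in> Q"
  shows "Q = {[]}"
  using antichainD(3)[OF codeD(1)[OF assms(1)] assms(2)] assms(2) by auto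

text \<open>The siblings of a longest word \<open>v = w @ [a]\<close> all belong to
  \<open>Q\<close>: the word of \<open>Q\<close> that covers a point of the ball of
  \<open>w @ [b]\<close> is no longer than \<open>v\<close>, and if it were shorter it would be a
  prefix of \<open>w\<close>, hence of \<open>v\<close>.\<close>

lemma code_caret:
  assumes d: "1 \<le> d" and Q: "code d Q" "Q \<noteq> {[]}"
  obtains w where "kids d w \<subseteq> Q"
proof -
  note C = codeD[OF Q(1)] and A = antichainD[OF codeD(1)[OF Q(1)]]
  have ne: "Q \<noteq> {}" using C(4)[OF const1_mem[OF d]] by auto
  have "Max (length ` Q) \<in> length ` Q" using C(2) ne by (intro Max_in) auto
  then obtain v where v0: "v \<in> Q" "length v = Max (length ` Q)" by force
  then have v: "v \<in> Q" "\<And>u. u \<in> Q \<Longrightarrow> length u \<le> length v"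
    using C(2) by auto
  have "v \<noteq> []" using code_mem_Nil[OF Q(1)] Q(2) v by auto
  then obtain w a where va: "v = w @ [a]" by (metis rev_exhaust)
  have "w @ [b] \<in> Q" if b: "b \<in> {1..d}" for b
  proof -
    have fb: "finword d (w @ [b])" using C(3)[OF v(1)] va b by auto
    obtain u where u: "u \<in> Q" "pre (length u) (conc (w @ [b]) (\<lambda>_. 1)) = u"
      using C(4)[of "conc (w @ [b]) (\<lambda>_. 1)"] fb conc_mem const1_mem[OF d] by blast
    have "pre (length (w @ [b])) (conc (w @ [b]) (\<lambda>_. 1)) = w @ [b]" by (rule pre_conc)
    then have "prefix u (w @ [b])"
      using prefix_pre[of "length u" "length (w @ [b])"] u v(2)[OF u(1)] va by (metis length_append_singleton)
    then have "u = w @ [b] \<or> prefix u w" by auto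
    moreover have "\<not> prefix u w"
    proof
      assume "prefix u w"
      then have "prefix u v" "u \<noteq> v" using va by (auto dest: prefix_length_le)
      then show False using A(3)[OF u(1) v(1)] by (auto simp: parallel_def)
    qed
    ultimately show ?thesis using u by auto
  qed
  then have "kids d w \<subseteq> Q" by (auto simp: kids_def)
  then show thesis by (rule that)
qed

text \<open>Expanding words shorter than \<open>N\<close> terminates at \<open>words d N\<close>, so
  \<open>P\<close> is carried from there back to \<open>Q\<close>. Any two codes thus have a common
  refinement that is reached by single expansions.\<close>

lemma code_expand_induct [consumes 3, case_names words expand]:
  assumes "code d Q" "\<And>w. w \<in> Q \<Longrightarrow> length w \<le> N" and d: "1 \<le> d"
    and base: "P (words d N)"
    and step: "\<And>Q w. code d Q \<Longrightarrow> w \<in> Q \<Longrightarrow> length w < N \<Longrightarrow> P (Q - {w} \<union> kids d w) \<Longrightarrow> P Q"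
  shows "P Q"
  using assms(1,2)
\<comment> \<open>Each word has weight \<open>(d + 1) ^ (N - length w)\<close>. The \<open>d\<close>
  children of \<open>w\<close> together weigh \<open>d * (d + 1) ^ (N - length w - 1)\<close>, less
  than \<open>w\<close> itself, so each expansion lowers the sum.\<close>
proof (induction "\<Sum>w\<in>Q. Suc d ^ (N - length w)" arbitrary: Q rule: less_induct)
  case less
  note C = codeD[OF less.prems(1)]
  show ?case
  proof (cases "\<exists>w\<in>Q. length w < N")
    case True
    then obtain w where w: "w \<in> Q" "length w < N" by blast
    let ?Q = "Q - {w} \<union> kids d w"
    have "P ?Q"
    proof (rule less.hyps)
      obtain k where k: "N - length w = Suc k" using w by (metis Suc_diff_Suc)
      have "kids d w \<inter> (Q - {w}) = {}" using kids_inter[OF C(1) w(1)] by auto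
      then have "(\<Sum>v\<in>?Q. Suc d ^ (N - length v))
          = (\<Sum>v\<in>Q - {w}. Suc d ^ (N - length v)) + (\<Sum>v\<in>kids d w. Suc d ^ (N - length v))"
        using C(2) by (subst sum.union_disjoint) auto
      also have "(\<Sum>v\<in>kids d w. Suc d ^ (N - length v)) = (\<Sum>v\<in>kids d w. Suc d ^ k)"
        using k by (intro sum.cong refl) (auto simp: kids_def)
      also have "\<dots> = d * Suc d ^ k" by simp
      also have "\<dots> < Suc d ^ (N - length w)" by (simp add: k)
      also have "(\<Sum>v\<in>Q - {w}. Suc d ^ (N - length v)) + Suc d ^ (N - length w) = (\<Sum>v\<in>Q. Suc d ^ (N - length v))"
        using C(2) w by (subst sum.remove[of Q w]) auto
      finally show "(\<Sum>v\<in>?Q. Suc d ^ (N - length v)) < (\<Sum>v\<in>Q. Suc d ^ (N - length v))" by simp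
      show "code d ?Q" by (rule code_expand) (use less.prems w in auto)
      show "length v \<le> N" if "v \<in> ?Q" for v
        using that less.prems w by (auto simp: kids_def)
    qed
    then show ?thesis using step less.prems w by blast
  next
    case False
    then have len: "length w = N" if "w \<in> Q" for w using less.prems that by (metis le_neq_implies_less)
    have "w \<in> Q" if w: "w \<in> words d N" for w
    proof -
      have fw: "finword d w" "length w = N" using w by (auto simp: words_def)
      then obtain u where u: "u \<in> Q" "pre (length u) (conc w (\<lambda>_. 1)) = u"
        using C(4)[of "conc w (\<lambda>_. 1)"] conc_mem const1_mem[OF d] by blast
      then have "u = w" using len[OF u(1)] fw pre_conc[of w] by metis
      then show ?thesis using u by simp
    qed
    moreover have "w \<in> words d N" if "w \<in> Q" for w
      using len[OF that] C(3)[OF that] by (simp add: words_def)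
    ultimately have "Q = words d N" by blast
    then show ?thesis using base by simp
  qed
qed

section \<open>The group of piecewise letterwise homeomorphisms\<close>

locale rn_group =
  fixes d :: nat and H :: "(nat \<Rightarrow> nat) set"
  assumes d2: "2 \<le> d" and subH: "subgroup H (sym_group d)"
begin

lemma d1: "1 \<le> d"
  using d2 by simp

lemma H_permutes: "h \<in> H \<Longrightarrow> h permutes {1..d}"
  using subgroup.mem_carrier[OF subH] by (simp add: sym_group_carrier)

lemma H_id [simp]: "id \<in> H"
  using subgroup.one_closed[OF subH] by (simp add: sym_group_one)

lemma H_comp [simp]: "h \<in> H \<Longrightarrow> k \<in> H \<Longrightarrow> h \<circ> k \<in> H"
  using subgroup.m_closed[OF subH] by (simp add: sym_group_mult)

lemma H_inv [simp]: "h \<in> H \<Longrightarrow> inv' h \<in> H"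
  using subgroup.m_inv_closed[OF subH] subgroup.mem_carrier[OF subH] sym_group_inv_equality by metis

lemma H_inv_comp: "h \<in> H \<Longrightarrow> inv' h \<circ> h = id" "h \<in> H \<Longrightarrow> h \<circ> inv' h = id"
  using permutes_inv_o[OF H_permutes] by auto

lemma H_letter: "h \<in> H \<Longrightarrow> h a \<in> {1..d} \<longleftrightarrow> a \<in> {1..d}"
  using permutes_in_image[OF H_permutes] by blast

lemma H_comp_mem [simp]: "h \<in> H \<Longrightarrow> h \<circ> y \<in> infwords d \<longleftrightarrow> y \<in> infwords d"
  unfolding infwords_def mem_Collect_eq comp_apply using H_letter by blast

lemma H_finword [simp]: "h \<in> H \<Longrightarrow> finword d (map h w) \<longleftrightarrow> finword d w"
  unfolding finword_def set_map image_subset_iff using H_letter by blast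

lemma H_inv_cancel [simp]: "h \<in> H \<Longrightarrow> h \<circ> (inv' h \<circ> y) = y" "h \<in> H \<Longrightarrow> inv' h \<circ> (h \<circ> y) = y"
  by (auto simp: comp_assoc[symmetric] H_inv_comp)

lemma finite_H: "finite H"
  using finite_subset[OF _ finite_permutations[of "{1..d}"]] H_permutes by blast

section \<open>Maps that change a prefix and permute the remaining letters\<close>

definition aff :: "((nat \<Rightarrow> nat) \<Rightarrow> (nat \<Rightarrow> nat)) \<Rightarrow> nat list \<Rightarrow> nat list \<Rightarrow> (nat \<Rightarrow> nat) \<Rightarrow> bool" where
  "aff g w u h \<longleftrightarrow> finword d u \<and> h \<in> H \<and> (\<forall>y\<in>infwords d. g (conc w y) = conc u (h \<circ> y))"

lemma affD:
  assumes "aff g w u h"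
  shows "finword d u" "h \<in> H" "\<And>y. y \<in> infwords d \<Longrightarrow> g (conc w y) = conc u (h \<circ> y)"
  using assms by (auto simp: aff_def)

lemma aff_append: "aff g w u h \<Longrightarrow> finword d z \<Longrightarrow> aff g (w @ z) (u @ map h z) h"
  by (auto simp: aff_def conc_append comp_conc)

lemma aff_comp: "aff g w u h \<Longrightarrow> aff g' u u' h' \<Longrightarrow> aff (g' \<circ> g) w u' (h' \<circ> h)"
  by (auto simp: aff_def comp_assoc)

lemma aff_id [simp]: "finword d w \<Longrightarrow> aff id w w id"
  by (simp add: aff_def)

lemma conc_ball_eq:
  assumes "finword d u" "finword d v" "\<And>y. y \<in> infwords d \<Longrightarrow> \<exists>z\<in>infwords d. conc u y = conc v z"
  shows "prefix v u"
proof -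
  \<comment> \<open>These give two points of the ball of \<open>u\<close> that differ in the first
    letter after \<open>u\<close>, available since \<open>2 \<le> d\<close>. If \<open>v\<close>
    were longer than \<open>u\<close>, it would prescribe that letter.\<close>
  have y: "(\<lambda>_. 1) \<in> infwords d" "(\<lambda>_. 2) \<in> infwords d" using d2 by (auto simp: infwords_def)
  obtain z1 z2 where z: "conc u (\<lambda>_. 1) = conc v z1" "conc u (\<lambda>_. 2) = conc v z2"
    using assms(3) y by metis
  have "length v \<le> length u"
  proof (rule ccontr)
    assume *: "\<not> length v \<le> length u"
    have "conc v z1 (length u) = conc v z2 (length u)" using * by (simp add: conc_def)
    moreover have "conc v z1 (length u) = 1" "conc v z2 (length u) = 2"
      unfolding z[symmetric] by (simp_all add: conc_def)
    ultimately show False by simp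
  qed
  then have "prefix (pre (length v) (conc v z1)) (pre (length u) (conc u (\<lambda>_. 1)))"
    using prefix_pre z by metis
  then show ?thesis by simp
qed

text \<open>The image ball determines \<open>u\<close>, by \<open>conc_ball_eq\<close> in both
  directions; constant sequences then read off \<open>h\<close> on the alphabet, outside of which
  permutations are the identity. Hence targets and germs are well defined.\<close>

lemma aff_unique:
  assumes "aff g w u h" "aff g w u' h'"
  shows "u = u'" "h = h'"
proof -
  note a = affD[OF assms(1)] and b = affD[OF assms(2)]
  have eq: "conc u (h \<circ> y) = conc u' (h' \<circ> y)" if "y \<in> infwords d" for y
    using a(3) b(3) that by metis
  have "\<exists>z\<in>infwords d. conc u y = conc u' z" if "y \<in> infwords d" for y
    using eq[of "inv' h \<circ> y"] that a(2) b(2) by (intro bexI[of _ "h' \<circ> (inv' h \<circ> y)"]) auto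
  moreover have "\<exists>z\<in>infwords d. conc u' y = conc u z" if "y \<in> infwords d" for y
    using eq[of "inv' h' \<circ> y"] that a(2) b(2) by (intro bexI[of _ "h \<circ> (inv' h' \<circ> y)"]) auto
  ultimately show u: "u = u'"
    using conc_ball_eq[of u u'] conc_ball_eq[of u' u] a(1) b(1) prefix_order.antisym by blast
  show "h = h'"
  proof
    fix i
    show "h i = h' i"
    proof (cases "i \<in> {1..d}")
      case True
      then have "h \<circ> (\<lambda>_ :: nat. i) = h' \<circ> (\<lambda>_ :: nat. i)" using eq[of "\<lambda>_. i"] u by (auto simp: infwords_def)
      then show ?thesis by (simp add: fun_eq_iff)
    next
      case False
      then show ?thesis
        using permutes_not_in[OF H_permutes[OF a(2)]] permutes_not_in[OF H_permutes[OF b(2)]] by simp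
    qed
  qed
qed

abbreviation V :: "((nat \<Rightarrow> nat) \<Rightarrow> (nat \<Rightarrow> nat)) set" where
  "V \<equiv> Vd d H"

definition local_aff :: "((nat \<Rightarrow> nat) \<Rightarrow> (nat \<Rightarrow> nat)) \<Rightarrow> bool" where
  "local_aff g \<longleftrightarrow> (\<forall>x\<in>infwords d. \<exists>n u h. aff g (pre n x) u h)"

lemma local_aff_iff:
  "local_aff g \<longleftrightarrow> (\<forall>x\<in>infwords d. \<exists>w1 w2 \<sigma>. finword d w1 \<and> finword d w2 \<and> \<sigma> \<in> H \<and>
        x \<in> ball_w d w1 \<and> (\<forall>y\<in>infwords d. g (conc w1 y) = conc w2 (\<sigma> \<circ> y)))"
  (is "_ \<longleftrightarrow> ?R")
proof
  assume "local_aff g"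
  then show ?R unfolding local_aff_def aff_def
    by (metis conc_pre_sdrop finword_pre length_pre mem_ball_w)
next
  assume R: ?R
  show "local_aff g"
    unfolding local_aff_def
  proof
    fix x assume x: "x \<in> infwords d"
    then obtain w1 w2 \<sigma> where "finword d w1" "finword d w2" "\<sigma> \<in> H"
      "x \<in> ball_w d w1" "\<forall>y\<in>infwords d. g (conc w1 y) = conc w2 (\<sigma> \<circ> y)" using R by blast
    then have "aff g (pre (length w1) x) w2 \<sigma>" by (auto simp: aff_def mem_ball_w)
    then show "\<exists>n u h. aff g (pre n x) u h" by blast
  qed
qed

lemma aff_pre_mono:
  assumes "aff g (pre n x) u h" "n \<le> m" "x \<in> infwords d"
  obtains u' where "aff g (pre m x) u' h" "length u' = length u + (m - n)"
proof -
  obtain z where z: "pre m x = pre n x @ z" using prefix_pre[OF assms(2), of x] by (auto simp: prefix_def)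
  then have "length z = m - n" using length_pre[of m x] by simp
  moreover have "finword d z" using finword_pre[OF assms(3), of m] z by simp
  ultimately show thesis using aff_append[OF assms(1), of z] z by (intro that[of "u @ map h z"]) auto
qed

lemma wdist_less_pre:
  assumes "wdist x y < exp (- real n)"
  shows "pre n x = pre n y"
proof (cases "x = y")
  case False
  then have "\<exists>i. x i \<noteq> y i" by auto
  have "real n < real (LEAST i. x i \<noteq> y i)" using assms False by (simp add: wdist_def)
  then have "x i = y i" if "i < n" for i using that not_less_Least[of i "\<lambda>i. x i \<noteq> y i"] by force
  then show ?thesis by (simp add: pre_def)
qed simp

lemma wdist_pre_less:
  assumes "pre (Suc n) x = pre (Suc n) y"
  shows "wdist x y < exp (- real n)"
proof (cases "x = y")
  case False
  then have ex: "\<exists>i. x i \<noteq> y i" by auto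
  have "x i = y i" if "i < Suc n" for i
    using assms that by (metis length_pre nth_map_upt pre_def add_0 diff_zero)
  then have "Suc n \<le> (LEAST i. x i \<noteq> y i)"
    using LeastI_ex[OF ex] by (meson not_less)
  then show ?thesis using False by (simp add: wdist_def)
qed (simp add: wdist_def)

lemma local_aff_wcont:
  assumes "local_aff g"
  shows "wcont d g"
  unfolding wcont_def
proof (intro ballI allI impI)
  fix x and e :: real
  assume x: "x \<in> infwords d" and e: "0 < e"
  obtain k where k: "exp (- real k) < e"
  proof -
    obtain k where "- ln e < real k" using reals_Archimedean2 by blast
    then have "exp (- real k) < exp (ln e)" by simp
    then show thesis using e that by simp
  qed
  obtain n0 u h where a0: "aff g (pre n0 x) u h" using assms x by (auto simp: local_aff_def)
  \<comment> \<open>With \<open>Suc k\<close> letters beyond \<open>n0\<close>, the image prefix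
    \<open>v\<close> has at least \<open>Suc k\<close> letters even if \<open>u\<close> is
    empty.\<close>
  define n where "n = n0 + Suc k"
  obtain v where v: "aff g (pre n x) v h" "length v = length u + Suc k"
    using aff_pre_mono[OF a0, of n] x by (auto simp: n_def)
  show "\<exists>\<delta>>0. \<forall>y\<in>infwords d. wdist x y < \<delta> \<longrightarrow> wdist (g x) (g y) < e"
  proof (intro exI[of _ "exp (- real n)"] conjI ballI impI)
    fix y assume y: "y \<in> infwords d" "wdist x y < exp (- real n)"
    then have p: "pre n x = pre n y" by (intro wdist_less_pre)
    have "g (conc (pre n x) (sdrop n x)) = conc v (h \<circ> sdrop n x)"
      "g (conc (pre n x) (sdrop n y)) = conc v (h \<circ> sdrop n y)"
      by (intro affD(3)[OF v(1)] sdrop_mem x y(1))+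
    then have "g x = conc v (h \<circ> sdrop n x)" "g y = conc v (h \<circ> sdrop n y)"
      using conc_pre_sdrop p by metis+
    then have "pre (Suc k) (g x) = pre (Suc k) (g y)"
      using take_pre[of "Suc k" "length v"] v(2) by (metis le_add2 pre_conc)
    then show "wdist (g x) (g y) < e" using wdist_pre_less[of k] k by (metis less_trans)
  qed simp
qed

lemma local_aff_inv:
  assumes g: "bij_betw g (infwords d) (infwords d)" "local_aff g"
    and f: "\<And>x. x \<in> infwords d \<Longrightarrow> f (g x) = x"
  shows "local_aff f"
  unfolding local_aff_def
proof
  fix y assume "y \<in> infwords d"
  then obtain x where x: "x \<in> infwords d" "y = g x" using g(1) by (auto simp: bij_betw_def)
  obtain n u h where a: "aff g (pre n x) u h" using g(2) x by (auto simp: local_aff_def)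
  have "g x = conc u (h \<circ> sdrop n x)" using affD(3)[OF a, of "sdrop n x"] x by simp
  then have u: "pre (length u) y = u" using x by simp
  have "aff f u (pre n x) (inv' h)"
    unfolding aff_def
  proof (intro conjI ballI)
    fix z assume z: "z \<in> infwords d"
    let ?z = "inv' h \<circ> z"
    have "g (conc (pre n x) ?z) = conc u z" using affD(3)[OF a, of ?z] affD(2)[OF a] z by simp
    moreover have "conc (pre n x) ?z \<in> infwords d" using x z affD(2)[OF a] by simp
    ultimately show "f (conc u z) = conc (pre n x) ?z" using f by metis
  qed (use x affD(2)[OF a] in auto)
  then show "\<exists>n u h. aff f (pre n y) u h" using u by metis
qed

lemma V_iff_whomeo: "g \<in> V \<longleftrightarrow> whomeo d g \<and> local_aff g"
  by (simp only: Vd_def mem_Collect_eq local_aff_iff)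

text \<open>A local form makes a map continuous and passes to the inverse, so membership becomes a
  statement without topology.\<close>

lemma V_iff:
  "g \<in> V \<longleftrightarrow> bij_betw g (infwords d) (infwords d) \<and> local_aff g \<and> (\<forall>x. x \<notin> infwords d \<longrightarrow> g x = x)"
proof
  assume "g \<in> V"
  then show "bij_betw g (infwords d) (infwords d) \<and> local_aff g \<and> (\<forall>x. x \<notin> infwords d \<longrightarrow> g x = x)"
    unfolding V_iff_whomeo whomeo_def by iprover
next
  assume g: "bij_betw g (infwords d) (infwords d) \<and> local_aff g \<and> (\<forall>x. x \<notin> infwords d \<longrightarrow> g x = x)"
  then have b: "bij_betw g (infwords d) (infwords d)" and l: "local_aff g" by iprover+
  have "local_aff (inv_into (infwords d) g)"
    using b l by (rule local_aff_inv) (rule bij_betw_inv_into_left[OF b])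
  then have "wcont d (inv_into (infwords d) g)" "wcont d g" using l local_aff_wcont by iprover+
  then show "g \<in> V"
    unfolding V_iff_whomeo whomeo_def using g by iprover
qed

lemma VD:
  assumes "g \<in> V"
  shows "bij_betw g (infwords d) (infwords d)" "local_aff g" "\<And>x. x \<notin> infwords d \<Longrightarrow> g x = x"
    "\<And>x. x \<in> infwords d \<Longrightarrow> g x \<in> infwords d"
  using assms unfolding V_iff bij_betw_def by blast+

lemma V_bij: "g \<in> V \<Longrightarrow> bij g"
proof -
  assume g: "g \<in> V"
  have "bij_betw g (- infwords d) (- infwords d)"
    using VD(3)[OF g] by (intro bij_betw_cong[THEN iffD2, OF _ bij_betw_id]) auto
  from bij_betw_combine[OF VD(1)[OF g] this] show "bij g" by auto
qed

lemma V_id [simp]: "id \<in> V"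
  unfolding V_iff by (auto simp: local_aff_def intro!: exI aff_id)

lemma V_comp [simp]:
  assumes g: "g \<in> V" and f: "f \<in> V"
  shows "f \<circ> g \<in> V"
  unfolding V_iff
proof (intro conjI allI impI)
  show "bij_betw (f \<circ> g) (infwords d) (infwords d)"
    using VD(1)[OF g] VD(1)[OF f] by (rule bij_betw_trans)
  show "local_aff (f \<circ> g)"
    unfolding local_aff_def
  proof
    fix x assume x: "x \<in> infwords d"
    obtain n u h where a: "aff g (pre n x) u h" using VD(2)[OF g] x by (auto simp: local_aff_def)
    obtain m v k where b: "aff f (pre m (g x)) v k"
      using VD(2)[OF f] VD(4)[OF g x] by (auto simp: local_aff_def)
    obtain u' where a': "aff g (pre (n + m) x) u' h" "length u' = length u + m"
      using aff_pre_mono[OF a, of "n + m"] x by auto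
    have "g x = conc u' (h \<circ> sdrop (n + m) x)" using affD(3)[OF a'(1), of "sdrop (n + m) x"] x by simp
    then have "pre (length u') (g x) = u'" by simp
    moreover obtain v' where "aff f (pre (length u') (g x)) v' k"
      using aff_pre_mono[OF b, of "length u'"] VD(4)[OF g x] a'(2) by auto
    ultimately show "\<exists>n u h. aff (f \<circ> g) (pre n x) u h" using aff_comp[OF a'(1)] by metis
  qed
  show "(f \<circ> g) x = x" if "x \<notin> infwords d" for x
    using VD(3)[OF g that] VD(3)[OF f that] by simp
qed

lemma V_inv [simp]:
  assumes g: "g \<in> V"
  shows "inv' g \<in> V"
  unfolding V_iff
proof (intro conjI allI impI)
  have inj: "inj g" using V_bij[OF g] by (rule bij_is_inj)
  show "bij_betw (inv' g) (infwords d) (infwords d)"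
    unfolding bij_betw_def
  proof
    show "inj_on (inv' g) (infwords d)"
      using bij_is_inj[OF bij_imp_bij_inv[OF V_bij[OF g]]] by (rule inj_on_subset) simp
    show "inv' g ` infwords d = infwords d"
      using VD(1)[OF g] image_inv_f_f[OF inj, of "infwords d"] by (simp add: bij_betw_def)
  qed
  show "local_aff (inv' g)"
    using VD(1,2)[OF g] by (rule local_aff_inv) (simp add: inj)
  show "inv' g x = x" if "x \<notin> infwords d" for x
    using VD(3)[OF g that] inj by (metis inv_f_f)
qed

definition VG :: "((nat \<Rightarrow> nat) \<Rightarrow> (nat \<Rightarrow> nat)) monoid" where
  "VG = \<lparr>carrier = V, monoid.mult = (\<circ>), one = id\<rparr>"

lemma VG_simps [simp]: "carrier VG = V" "x \<otimes>\<^bsub>VG\<^esub> y = x \<circ> y" "\<one>\<^bsub>VG\<^esub> = id"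
  by (simp_all add: VG_def)

lemma VG_group: "group VG"
proof (rule groupI)
  fix g assume "g \<in> carrier VG"
  then show "\<exists>f\<in>carrier VG. f \<otimes>\<^bsub>VG\<^esub> g = \<one>\<^bsub>VG\<^esub>"
    using bij_is_inj[OF V_bij] by (intro bexI[of _ "inv' g"]) auto
qed (auto simp: comp_assoc simp del: comp_apply)

lemma VG_inv [simp]: "g \<in> V \<Longrightarrow> inv\<^bsub>VG\<^esub> g = inv' g"
  using bij_is_inj[OF V_bij, of g] by (intro group.inv_equality[OF VG_group]) auto

subsection \<open>Adapted codes\<close>

definition adapted :: "((nat \<Rightarrow> nat) \<Rightarrow> (nat \<Rightarrow> nat)) \<Rightarrow> nat list set \<Rightarrow> bool" where
  "adapted g Q \<longleftrightarrow> (\<forall>w\<in>Q. \<exists>u h. aff g w u h)"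

text \<open>Arbitrary unless \<open>g\<close> has the form of \<open>aff\<close> on the ball of
  \<open>w\<close>; in that case \<open>aff_unique\<close> makes it the prefix of the image
  ball.\<close>

definition tgt :: "((nat \<Rightarrow> nat) \<Rightarrow> (nat \<Rightarrow> nat)) \<Rightarrow> nat list \<Rightarrow> nat list" where
  "tgt g w = (SOME u. \<exists>h. aff g w u h)"

definition germ :: "((nat \<Rightarrow> nat) \<Rightarrow> (nat \<Rightarrow> nat)) \<Rightarrow> nat list \<Rightarrow> (nat \<Rightarrow> nat)" where
  "germ g w = (SOME h. aff g w (tgt g w) h)"

lemma aff_tgt_germ:
  assumes "aff g w u h"
  shows "aff g w (tgt g w) (germ g w)"
  unfolding germ_def using assms by (metis (mono_tags, lifting) someI_ex tgt_def)

lemma tgt_eq: "aff g w u h \<Longrightarrow> tgt g w = u"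
  and germ_eq: "aff g w u h \<Longrightarrow> germ g w = h"
  using aff_unique aff_tgt_germ by blast+

lemma adaptedD: "adapted g Q \<Longrightarrow> w \<in> Q \<Longrightarrow> aff g w (tgt g w) (germ g w)"
  using aff_tgt_germ by (auto simp: adapted_def)

text \<open>Compactness of the space, in the form of Koenig's lemma. The conclusion covers every
  larger length as well, so that images of words, whose lengths vary, can be treated later.\<close>

lemma exists_uniform:
  assumes "local_aff g"
  obtains n where "\<And>m. n \<le> m \<Longrightarrow> adapted g (words d m)"
proof -
  \<comment> \<open>A word is good if all sufficiently long extensions of it carry a form. A word
    with good children is good, so a bad empty word starts an infinite branch of bad words. Its
    limit \<open>x\<close> has a prefix on which \<open>g\<close> has a form, and such a prefix is
    good.\<close>
  define good where "good w \<longleftrightarrow> (\<exists>n. \<forall>z. finword d z \<longrightarrow> n \<le> length z \<longrightarrow> (\<exists>u h. aff g (w @ z) u h))" for w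
  have step: "good w" if kid: "\<And>a. a \<in> {1..d} \<Longrightarrow> good (w @ [a])" for w
  proof -
    obtain n where n: "\<And>a z. a \<in> {1..d} \<Longrightarrow> finword d z \<Longrightarrow> n a \<le> length z \<Longrightarrow> (\<exists>u h. aff g ((w @ [a]) @ z) u h)"
      using kid unfolding good_def by metis
    have "\<exists>u h. aff g (w @ z) u h" if z: "finword d z" "Suc (Max (n ` {1..d})) \<le> length z" for z
    proof -
      obtain a z' where z': "z = a # z'" using z by (cases z) auto
      then have "a \<in> {1..d}" "finword d z'" using z by (auto simp: finword_def)
      moreover have "n a \<le> Max (n ` {1..d})" using \<open>a \<in> {1..d}\<close> by (intro Max_ge) auto
      ultimately show ?thesis using n[of a z'] z z' by auto
    qed
    then show ?thesis unfolding good_def by blast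
  qed
  have "good []"
  proof (rule ccontr)
    assume bad: "\<not> good []"
    have "\<exists>f. f 0 = [] \<and> (\<forall>n. (finword d (f n) \<and> \<not> good (f n) \<and> length (f n) = n)
             \<and> (\<exists>a. f (Suc n) = f n @ [a]))"
    proof -
      have "\<exists>f. \<forall>n. (finword d (f n) \<and> \<not> good (f n) \<and> length (f n) = n) \<and> (\<exists>a. f (Suc n) = f n @ [a])"
      proof (rule dependent_nat_choice)
        show "\<exists>x. finword d x \<and> \<not> good x \<and> length x = 0" using bad by auto
        show "\<exists>y. (finword d y \<and> \<not> good y \<and> length y = Suc n) \<and> (\<exists>a. y = x @ [a])"
          if x: "finword d x \<and> \<not> good x \<and> length x = n" for x n
        proof -
          obtain a where "a \<in> {1..d}" "\<not> good (x @ [a])" using step x by blast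
          then show ?thesis using x by (intro exI[of _ "x @ [a]"]) auto
        qed
      qed
      then show ?thesis by (metis length_0_conv)
    qed
    then obtain f where f: "\<And>n. finword d (f n)" "\<And>n. \<not> good (f n)" "\<And>n. length (f n) = n"
      "\<And>n. \<exists>a. f (Suc n) = f n @ [a]" by blast
    define x where "x i = last (f (Suc i))" for i
    have pre: "pre n x = f n" for n
    proof (induction n)
      case 0
      then show ?case using f(3)[of 0] by simp
    next
      case (Suc n)
      then show ?case using f(4)[of n] by (auto simp: pre_Suc x_def)
    qed
    have "x \<in> infwords d"
      unfolding infwords_def x_def using f(1) f(3) by (auto simp: finword_def)
         (metis f(1,3) Zero_not_Suc atLeastAtMost_iff finword_def last_in_set list.size(3) subsetD)+
    then obtain n u h where "aff g (f n) u h" using assms pre by (auto simp: local_aff_def)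
    then have "good (f n)" unfolding good_def using aff_append by blast
    then show False using f by blast
  qed
  then obtain n where n: "\<And>z. finword d z \<Longrightarrow> n \<le> length z \<Longrightarrow> (\<exists>u h. aff g z u h)"
    unfolding good_def by auto
  then show thesis by (intro that[of n]) (auto simp: adapted_def words_def)
qed

text \<open>Injectivity of \<open>g\<close> makes the image balls disjoint, surjectivity makes them
  cover the space.\<close>

lemma adapted_code_image:
  assumes g: "g \<in> V" and Q: "code d Q" and a: "adapted g Q"
  shows "code d (tgt g ` Q)" "inj_on (tgt g) Q"
proof -
  note C = codeD[OF Q] and A = antichainD[OF codeD(1)[OF Q]] and af = adaptedD[OF a]
  have par: "tgt g v \<parallel> tgt g w" if vw: "v \<in> Q" "w \<in> Q" "v \<noteq> w" for v w
  proof -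
    have "ball_w d (tgt g v) \<inter> ball_w d (tgt g w) = {}"
    proof (rule ccontr)
      assume "ball_w d (tgt g v) \<inter> ball_w d (tgt g w) \<noteq> {}"
      then obtain y z where yz: "y \<in> infwords d" "z \<in> infwords d" "conc (tgt g v) y = conc (tgt g w) z"
        unfolding ball_w_def by auto
      have h: "germ g v \<in> H" "germ g w \<in> H" using affD(2)[OF af] vw by auto
      let ?y = "inv' (germ g v) \<circ> y" and ?z = "inv' (germ g w) \<circ> z"
      have "g (conc v ?y) = conc (tgt g v) y" "g (conc w ?z) = conc (tgt g w) z"
        using affD(3)[OF af[OF vw(1)], of ?y] affD(3)[OF af[OF vw(2)], of ?z] yz h by auto
      then have "conc v ?y = conc w ?z"
        using yz(3) bij_is_inj[OF V_bij[OF g]] by (metis injD)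
      then have "pre (length w) (conc v ?y) = w" by simp
      then show False using antichain_eq[OF C(1) vw(1,2), of "conc v ?y"] vw(3) by simp
    qed
    then show ?thesis using ball_w_disjoint_iff[OF d1] affD(1)[OF af] vw by blast
  qed
  show "inj_on (tgt g) Q"
    by (rule inj_onI) (use par in fastforce)
  have "antichain d (tgt g ` Q)"
    unfolding antichain_def using par C(2) affD(1)[OF af] by auto
  moreover have "\<exists>u\<in>tgt g ` Q. pre (length u) y = u" if y: "y \<in> infwords d" for y
  proof -
    obtain x where x: "x \<in> infwords d" "y = g x" using VD(1)[OF g] y unfolding bij_betw_def by blast
    obtain w where w: "w \<in> Q" "pre (length w) x = w" using C(4)[OF x(1)] by blast
    have "g x = conc (tgt g w) (germ g w \<circ> sdrop (length w) x)"
      using affD(3)[OF af[OF w(1)], of "sdrop (length w) x"] x w by (metis conc_pre_sdrop sdrop_mem)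
    then show ?thesis using w x by (intro bexI[of _ "tgt g w"]) auto
  qed
  ultimately show "code d (tgt g ` Q)" by (simp add: code_def)
qed

end

section \<open>Invariants of tables\<close>

lemma invs_reindex:
  assumes "inj_on e S"
    and "\<And>x y. x \<in> S \<Longrightarrow> y \<in> S \<Longrightarrow> e x < e y \<longleftrightarrow> x < y"
    and "\<And>x y. x \<in> S \<Longrightarrow> y \<in> S \<Longrightarrow> f (e x) < f (e y) \<longleftrightarrow> h x < h y"
  shows "invs f (e ` S) = invs h S"
proof -
  have "invs f (e ` S) = (\<Sum>x\<in>S. \<Sum>y\<in>S. of_bool (e x < e y \<and> f (e y) < f (e x)))"
    unfolding invs_def by (simp only: sum.reindex[OF assms(1)] comp_def)
  also have "\<dots> = invs h S"
    unfolding invs_def by (intro sum.cong refl) (simp add: assms)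
  finally show ?thesis .
qed

lemma snoc_less_snoc: "(w @ [a] < w @ [b]) = (a < (b :: nat))"
  by (simp add: append_less_append_iff)

context rn_group
begin

lemma aff_kid: "aff g w u h \<Longrightarrow> a \<in> {1..d} \<Longrightarrow> aff g (w @ [a]) (u @ [h a]) h"
  using aff_append[of g w u h "[a]"] by simp

lemma adapted_expand:
  assumes "adapted g Q" "w \<in> Q"
  shows "adapted g (Q - {w} \<union> kids d w)"
  unfolding adapted_def kids_def using aff_kid[OF adaptedD[OF assms]] adaptedD[OF assms(1)] by blast

text \<open>Here \<open>k\<close> counts the inversions among the other words and \<open>l\<close>
  those between \<open>w\<close> and another word. Every child of \<open>w\<close> compares with
  another word as \<open>w\<close> does, in the source and in the target, which gives
  \<open>d * l\<close>; among themselves the children are permuted by the germ.\<close>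

lemma invs_expand:
  assumes g: "g \<in> V" and Q: "code d Q" "adapted g Q" and w: "w \<in> Q"
  obtains k l where "invs (tgt g) Q = k + l"
    "invs (tgt g) (Q - {w} \<union> kids d w) = k + invs (germ g w) {1..d} + d * l"
proof -
  define u h where "u = tgt g w" and "h = germ g w"
  have af: "aff g w u h" using adaptedD[OF Q(2) w] by (simp add: u_def h_def)
  have kid: "tgt g (w @ [a]) = u @ [h a]" if "a \<in> {1..d}" for a
    using aff_kid[OF af that] by (rule tgt_eq)
  let ?R = "Q - {w}"
  have fin: "finite ?R" using codeD(2)[OF Q(1)] by simp
  have cr: "cross (tgt g) x (w @ [a]) = cross (tgt g) x w" if "x \<in> ?R" "a \<in> {1..d}" for x a
  proof -
    have 1: "x \<parallel> w" "w \<parallel> x" using antichainD(3)[OF codeD(1)[OF Q(1)]] w that by auto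
    have "tgt g x \<noteq> tgt g w"
      using inj_onD[OF adapted_code_image(2)[OF g Q]] w that by blast
    then have 2: "tgt g x \<parallel> u" "u \<parallel> tgt g x"
      using antichainD(3)[OF codeD(1)[OF adapted_code_image(1)[OF g Q]]] w that
      unfolding u_def by auto
    show ?thesis
      unfolding cross_def kid[OF that(2)]
      using parallel_less_append[OF 1(1), of "[]"] parallel_less_append[OF 1(2), of _ "[]"]
        parallel_less_append[OF 2(1), of "[]"] parallel_less_append[OF 2(2), of _ "[]"]
      by (simp add: u_def)
  qed
  have hinv: "invs (tgt g) (kids d w) = invs h {1..d}"
    unfolding kids_def
    by (rule invs_reindex) (auto simp: inj_on_def snoc_less_snoc kid)
  show thesis
  proof (rule that)
    have "invs (tgt g) Q = invs (tgt g) (insert w ?R)" using w by (simp add: insert_absorb)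
    also have "\<dots> = invs (tgt g) ?R + (\<Sum>x\<in>?R. cross (tgt g) x w)"
      using fin by (subst invs_insert) (auto simp: cross_commute)
    finally show "invs (tgt g) Q = invs (tgt g) ?R + (\<Sum>x\<in>?R. cross (tgt g) x w)" .
    have "invs (tgt g) (?R \<union> kids d w) = invs (tgt g) ?R + invs (tgt g) (kids d w)
        + (\<Sum>x\<in>?R. \<Sum>y\<in>kids d w. cross (tgt g) x y)"
      using fin kids_inter[OF codeD(1)[OF Q(1)] w] by (intro invs_Un) auto
    also have "(\<Sum>x\<in>?R. \<Sum>y\<in>kids d w. cross (tgt g) x y) = (\<Sum>x\<in>?R. \<Sum>y\<in>kids d w. cross (tgt g) x w)"
      by (intro sum.cong refl) (use cr in \<open>auto simp: kids_def\<close>)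
    also have "\<dots> = d * (\<Sum>x\<in>?R. cross (tgt g) x w)"
      by (simp add: sum_distrib_left)
    finally show "invs (tgt g) (?R \<union> kids d w)
        = invs (tgt g) ?R + invs (germ g w) {1..d} + d * (\<Sum>x\<in>?R. cross (tgt g) x w)"
      by (simp only: hinv h_def)
  qed
qed

lemma exists_adapted:
  assumes "g \<in> V"
  obtains Q where "code d Q" "adapted g Q"
proof -
  obtain n where n: "\<And>m. n \<le> m \<Longrightarrow> adapted g (words d m)"
    using exists_uniform[OF VD(2)[OF assms]] by blast
  show thesis using that[OF code_words n[OF order_refl]] .
qed

lemma length_tgt_append:
  assumes "aff g w u h" "finword d z"
  shows "length (tgt g (w @ z)) = length u + length z"
  using tgt_eq[OF aff_append[OF assms]] by simp

lemma exists_adapted_comp: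
  assumes g: "g \<in> V" and f: "f \<in> V"
  obtains Q where "code d Q" "adapted g Q" "adapted f (tgt g ` Q)"
proof -
  obtain n where n: "\<And>m. n \<le> m \<Longrightarrow> adapted g (words d m)"
    using exists_uniform[OF VD(2)[OF g]] by blast
  obtain m where m: "\<And>k. m \<le> k \<Longrightarrow> adapted f (words d k)"
    using exists_uniform[OF VD(2)[OF f]] by blast
  have "adapted f (tgt g ` words d (n + m))"
    unfolding adapted_def
  proof
    fix u assume "u \<in> tgt g ` words d (n + m)"
    then obtain w where w: "finword d w" "length w = n + m" "u = tgt g w" by (auto simp: words_def)
    \<comment> \<open>The image of \<open>v @ z\<close> is the image of the prefix \<open>v\<close>
      of length \<open>n\<close> followed by \<open>m\<close> letters, so it is long enough for
      \<open>f\<close>.\<close>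
    define v z where "v = take n w" and "z = drop n w"
    have vz: "w = v @ z" "length v = n" "length z = m" using w by (auto simp: v_def z_def)
    then have "v \<in> words d n" "finword d z" using w by (auto simp: words_def)
    then obtain u' h where "aff g v u' h" using n[of n] by (auto simp: adapted_def)
    then have "m \<le> length u" "finword d u"
      using length_tgt_append[of g v u' h z] vz w \<open>finword d z\<close>
        affD(1)[OF aff_append[of g v u' h z]] tgt_eq[OF aff_append[of g v u' h z]] by auto
    then show "\<exists>v k. aff f u v k" using m[of "length u"] by (auto simp: adapted_def words_def)
  qed
  then show thesis using that[OF code_words n[of "n + m"]] by simp
qed

lemma tgt_germ_comp:
  assumes "adapted g Q" "adapted f (tgt g ` Q)" "w \<in> Q"
  shows "aff (f \<circ> g) w (tgt f (tgt g w)) (germ f (tgt g w) \<circ> germ g w)"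
  using aff_comp[OF adaptedD[OF assms(1,3)] adaptedD[OF assms(2) imageI[OF assms(3)]]] .

end

section \<open>Characters built from a homomorphism on H and an element of square one\<close>

locale rn_char = rn_group d H + comm_group B for d H and B (structure) +
  fixes phi and eps
  assumes phi_closed [simp]: "h \<in> H \<Longrightarrow> phi h \<in> carrier B"
    and phi_comp: "h \<in> H \<Longrightarrow> k \<in> H \<Longrightarrow> phi (h \<circ> k) = phi h \<otimes> phi k"
    and eps_closed [simp]: "eps \<in> carrier B"
    and eps_sq: "eps \<otimes> eps = \<one>"
    and phi_pow: "h \<in> H \<Longrightarrow> phi h [^] d = phi h \<otimes> eps [^] invs h {1..d}"
    and eps_even: "odd d \<or> eps = \<one>"
begin

definition chi :: "((nat \<Rightarrow> nat) \<Rightarrow> (nat \<Rightarrow> nat)) \<Rightarrow> nat list set \<Rightarrow> 'a" where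
  "chi g Q = eps [^] invs (tgt g) Q \<otimes> (\<Otimes>w\<in>Q. phi (germ g w))"

definition Chi :: "((nat \<Rightarrow> nat) \<Rightarrow> (nat \<Rightarrow> nat)) \<Rightarrow> 'a" where
  "Chi g = chi g (SOME Q. code d Q \<and> adapted g Q)"

lemma eps_pow_even:
  assumes "even (n :: nat)"
  shows "eps [^] n = \<one>"
proof -
  obtain k where k: "n = 2 * k" using assms by (rule evenE)
  have "eps [^] (2 :: nat) = \<one>" by (simp add: numeral_2_eq_2 eps_sq)
  then show ?thesis using nat_pow_pow[of eps 2 k] k by simp
qed

lemma eps_pow_cong:
  assumes "even (m + n :: nat)"
  shows "eps [^] m = eps [^] n"
proof -
  have "eps [^] m = eps [^] m \<otimes> (eps [^] n \<otimes> eps [^] n)"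
    using eps_pow_even[of "n + n"] by (simp add: nat_pow_mult)
  also have "\<dots> = eps [^] (m + n) \<otimes> eps [^] n" by (simp add: nat_pow_mult[symmetric] m_assoc)
  also have "\<dots> = eps [^] n" using eps_pow_even[OF assms] by simp
  finally show ?thesis .
qed

lemma eps_pow_d: "eps [^] (m + d * l :: nat) = eps [^] (m + l :: nat)"
proof (cases "odd d")
  case True
  then show ?thesis by (intro eps_pow_cong) (simp add: even_mult_iff)
qed (use eps_even in simp)

lemma germ_closed: "adapted g Q \<Longrightarrow> w \<in> Q \<Longrightarrow> germ g w \<in> H"
  using affD(2)[OF adaptedD] by blast

text \<open>Expansion turns \<open>phi h\<close> into \<open>phi h [^] d\<close>, adds
  \<open>invs h {1..d}\<close> inversions and multiplies the crossing ones by \<open>d\<close>. The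
  factor \<open>eps [^] invs h {1..d}\<close> from \<open>phi_pow\<close> meets the same power
  coming from the new inversions, and their product is trivial.\<close>

lemma chi_expand:
  assumes g: "g \<in> V" and Q: "code d Q" "adapted g Q" and w: "w \<in> Q"
  shows "chi g (Q - {w} \<union> kids d w) = chi g Q"
proof -
  define h where "h = germ g w"
  have hH: "h \<in> H" using germ_closed[OF Q(2) w] by (simp add: h_def)
  obtain k l where kl: "invs (tgt g) Q = k + l"
    "invs (tgt g) (Q - {w} \<union> kids d w) = k + invs h {1..d} + d * l"
    using invs_expand[OF assms] unfolding h_def by blast
  define P where "P = (\<Otimes>v\<in>Q - {w}. phi (germ g v))"
  have fin: "finite (Q - {w})" using codeD(2)[OF Q(1)] by simp
  have P: "P \<in> carrier B" unfolding P_def using germ_closed[OF Q(2)] by (intro finprod_closed) auto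
  have kid: "germ g v = h" if "v \<in> kids d w" for v
    using that aff_kid[OF adaptedD[OF Q(2) w]] germ_eq unfolding kids_def h_def by blast
  have "(\<Otimes>v\<in>kids d w. phi (germ g v)) = (\<Otimes>v\<in>kids d w. phi h)"
    using hH by (intro finprod_cong') (auto simp: kid)
  also have "\<dots> = phi h [^] d" using hH by (simp add: finprod_const)
  finally have kids: "(\<Otimes>v\<in>kids d w. phi (germ g v)) = phi h \<otimes> eps [^] invs h {1..d}"
    using phi_pow[OF hH] by simp
  have "(\<Otimes>v\<in>Q - {w} \<union> kids d w. phi (germ g v)) = P \<otimes> (phi h \<otimes> eps [^] invs h {1..d})"
    unfolding kids[symmetric] P_def
    using fin kids_inter[OF codeD(1)[OF Q(1)] w] germ_closed[OF Q(2)] kid hH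
    by (intro finprod_Un_disjoint) auto
  then have "chi g (Q - {w} \<union> kids d w)
      = eps [^] (k + invs h {1..d} + d * l) \<otimes> (P \<otimes> (phi h \<otimes> eps [^] invs h {1..d}))"
    by (simp add: chi_def kl)
  also have "\<dots> = (eps [^] (k + invs h {1..d} + d * l) \<otimes> eps [^] invs h {1..d}) \<otimes> (P \<otimes> phi h)"
    using P hH by (simp add: m_ac)
  also have "eps [^] (k + invs h {1..d} + d * l) \<otimes> eps [^] invs h {1..d}
      = eps [^] (k + invs h {1..d} + invs h {1..d} + d * l)"
    by (simp add: nat_pow_mult ac_simps)
  also have "\<dots> = eps [^] (k + l)"
    unfolding eps_pow_d by (rule eps_pow_cong) auto
  also have "P \<otimes> phi h = (\<Otimes>v\<in>Q. phi (germ g v))"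
  proof -
    have "(\<Otimes>v\<in>insert w (Q - {w}). phi (germ g v)) = phi (germ g w) \<otimes> P"
      unfolding P_def using fin germ_closed[OF Q(2)] w by (intro finprod_insert) auto
    then show ?thesis using w P hH by (simp add: insert_absorb h_def m_comm)
  qed
  finally show ?thesis by (simp add: chi_def kl)
qed

lemma chi_words:
  assumes g: "g \<in> V" and Q: "code d Q" "\<And>w. w \<in> Q \<Longrightarrow> length w \<le> N" and a: "adapted g Q"
  shows "chi g Q = chi g (words d N)"
proof -
  have "adapted g Q \<longrightarrow> chi g Q = chi g (words d N)"
  proof (rule code_expand_induct[OF Q d1, where P = "\<lambda>Q. adapted g Q \<longrightarrow> chi g Q = chi g (words d N)"])
    fix R w
    assume "code d R" "w \<in> R"
      and IH: "adapted g (R - {w} \<union> kids d w) \<longrightarrow> chi g (R - {w} \<union> kids d w) = chi g (words d N)"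
    then show "adapted g R \<longrightarrow> chi g R = chi g (words d N)"
      using chi_expand[OF g] adapted_expand by metis
  qed simp_all
  then show ?thesis using a by simp
qed

text \<open>Both codes are expanded to the words of one length, and \<open>g\<close> stays adapted
  along the way.\<close>

lemma chi_indep:
  assumes "g \<in> V" and "code d Q" "adapted g Q" and "code d R" "adapted g R"
  shows "chi g Q = chi g R"
proof -
  define N where "N = Max (length ` (Q \<union> R))"
  have "length w \<le> N" if "w \<in> Q \<union> R" for w
    unfolding N_def using that codeD(2) assms by (intro Max_ge) auto
  then show ?thesis using chi_words[of g Q N] chi_words[of g R N] assms by auto
qed

lemma Chi_eq:
  assumes "g \<in> V" "code d Q" "adapted g Q"
  shows "Chi g = chi g Q"
proof -
  have *: "code d (SOME Q. code d Q \<and> adapted g Q) \<and> adapted g (SOME Q. code d Q \<and> adapted g Q)"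
    using someI[of "\<lambda>Q. code d Q \<and> adapted g Q" Q] assms by iprover
  show ?thesis
    unfolding Chi_def
    by (rule chi_indep[OF assms(1) conjunct1[OF *] conjunct2[OF *] assms(2,3)])
qed

lemma Chi_closed: "g \<in> V \<Longrightarrow> Chi g \<in> carrier B"
proof -
  assume g: "g \<in> V"
  obtain Q where Q: "code d Q" "adapted g Q" using exists_adapted[OF g] by blast
  have "chi g Q \<in> carrier B"
    unfolding chi_def using germ_closed[OF Q(2)] by (intro m_closed nat_pow_closed finprod_closed) auto
  then show ?thesis using Chi_eq[OF g Q] by simp
qed

text \<open>On a code \<open>Q\<close> adapted to \<open>g\<close> whose image is adapted to
  \<open>f\<close>, inversions add modulo 2, and reindexing along \<open>tgt g\<close> combines the
  two germs at each word.\<close>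

lemma Chi_comp:
  assumes g: "g \<in> V" and f: "f \<in> V"
  shows "Chi (f \<circ> g) = Chi f \<otimes> Chi g"
proof -
  obtain Q where Q: "code d Q" "adapted g Q" and U: "adapted f (tgt g ` Q)"
    using exists_adapted_comp[OF g f] by blast
  note img = adapted_code_image[OF g Q] and af = tgt_germ_comp[OF Q(2) U]
  have fg: "adapted (f \<circ> g) Q" using af unfolding adapted_def by blast
  have gH: "germ g w \<in> H" "germ f (tgt g w) \<in> H" if "w \<in> Q" for w
    using germ_closed[OF Q(2) that] germ_closed[OF U] that by auto
  have "invs (tgt (f \<circ> g)) Q = invs (tgt f \<circ> tgt g) Q"
    using tgt_eq[OF af] by (intro invs_cong) simp
  moreover have "even (invs (tgt f \<circ> tgt g) Q + invs (tgt g) Q + invs (tgt f) (tgt g ` Q))"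
    using codeD(2)[OF Q(1)] img(2) adapted_code_image(2)[OF f img(1) U] by (rule invs_comp_even)
  ultimately have "eps [^] invs (tgt (f \<circ> g)) Q = eps [^] (invs (tgt f) (tgt g ` Q) + invs (tgt g) Q)"
    by (intro eps_pow_cong) (simp add: ac_simps)
  then have e: "eps [^] invs (tgt (f \<circ> g)) Q = eps [^] invs (tgt f) (tgt g ` Q) \<otimes> eps [^] invs (tgt g) Q"
    by (simp add: nat_pow_mult)
  define P1 where "P1 = (\<Otimes>u\<in>tgt g ` Q. phi (germ f u))"
  define P2 where "P2 = (\<Otimes>w\<in>Q. phi (germ g w))"
  have P: "P1 \<in> carrier B" "P2 \<in> carrier B"
    unfolding P1_def P2_def using gH by (auto intro!: finprod_closed)
  have "P1 = (\<Otimes>w\<in>Q. phi (germ f (tgt g w)))"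
    unfolding P1_def using gH img(2) by (intro finprod_reindex) auto
  then have "P1 \<otimes> P2 = (\<Otimes>w\<in>Q. phi (germ f (tgt g w)) \<otimes> phi (germ g w))"
    unfolding P2_def using gH by (simp add: finprod_multf)
  also have "\<dots> = (\<Otimes>w\<in>Q. phi (germ (f \<circ> g) w))"
    using gH germ_eq[OF af] by (intro finprod_cong') (auto simp: phi_comp)
  finally have p: "(\<Otimes>w\<in>Q. phi (germ (f \<circ> g) w)) = P1 \<otimes> P2" by simp
  have "Chi (f \<circ> g) = chi (f \<circ> g) Q" using Chi_eq[OF _ Q(1) fg] f g by simp
  also have "\<dots> = chi f (tgt g ` Q) \<otimes> chi g Q"
    unfolding chi_def e p P1_def[symmetric] P2_def[symmetric] using P by (simp add: m_ac)
  finally show ?thesis using Chi_eq[OF f img(1) U] Chi_eq[OF g Q] by simp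
qed

lemma Chi_hom: "Chi \<in> hom VG B"
  unfolding hom_def using Chi_closed Chi_comp by simp

end

context rn_group
begin

section \<open>Permutations of disjoint balls\<close>

text \<open>On an antichain \<open>U\<close> the chosen prefix \<open>w \<in> U\<close> is unique: \<open>el U p \<eta>\<close> is
  \<open>w y \<mapsto> p(w) \<eta>\<^sub>w(y)\<close>.\<close>

definition el :: "nat list set \<Rightarrow> (nat list \<Rightarrow> nat list) \<Rightarrow> (nat list \<Rightarrow> nat \<Rightarrow> nat) \<Rightarrow> (nat \<Rightarrow> nat) \<Rightarrow> (nat \<Rightarrow> nat)" where
  "el U p \<eta> x = (if x \<in> infwords d \<and> (\<exists>w\<in>U. pre (length w) x = w)
     then let w = (SOME w. w \<in> U \<and> pre (length w) x = w) in conc (p w) (\<eta> w \<circ> sdrop (length w) x)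
     else x)"

definition el_ok :: "nat list set \<Rightarrow> (nat list \<Rightarrow> nat list) \<Rightarrow> (nat list \<Rightarrow> nat \<Rightarrow> nat) \<Rightarrow> bool" where
  "el_ok U p \<eta> \<longleftrightarrow> antichain d U \<and> p permutes U \<and> (\<forall>w\<in>U. \<eta> w \<in> H)"

lemma el_okD:
  assumes "el_ok U p \<eta>"
  shows "antichain d U" "p permutes U" "\<And>w. w \<in> U \<Longrightarrow> \<eta> w \<in> H" "\<And>w. w \<in> U \<Longrightarrow> p w \<in> U"
    "\<And>w. w \<in> U \<Longrightarrow> finword d w"
  using assms by (auto simp: el_ok_def permutes_in_image antichain_def)

lemma el_conc:
  assumes "antichain d U" "w \<in> U" "y \<in> infwords d"
  shows "el U p \<eta> (conc w y) = conc (p w) (\<eta> w \<circ> y)"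
proof -
  have fw: "finword d w" using antichainD(2)[OF assms(1,2)] .
  have ex: "\<exists>v\<in>U. pre (length v) (conc w y) = v" using assms(2) by (intro bexI[of _ w]) auto
  have "(SOME v. v \<in> U \<and> pre (length v) (conc w y) = v) = w"
  proof (rule some_equality)
    show "v = w" if "v \<in> U \<and> pre (length v) (conc w y) = v" for v
      using antichain_eq[OF assms(1), of v w "conc w y"] that assms(2) by simp
  qed (use assms in simp)
  then show ?thesis using ex fw assms(3) by (simp add: el_def)
qed

lemma el_other: "x \<notin> infwords d \<or> (\<forall>w\<in>U. pre (length w) x \<noteq> w) \<Longrightarrow> el U p \<eta> x = x"
  by (auto simp: el_def)

lemma el_code:
  assumes "el_ok U p \<eta>" "code d Q" "U \<subseteq> Q" "w \<in> Q" "y \<in> infwords d"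
  shows "el U p \<eta> (conc w y) = conc (p w) ((if w \<in> U then \<eta> w else id) \<circ> y)"
proof (cases "w \<in> U")
  case True
  then show ?thesis using el_conc[OF el_okD(1)[OF assms(1)]] assms(5) by simp
next
  case False
  have "pre (length v) (conc w y) \<noteq> v" if "v \<in> U" for v
    using antichain_eq[OF codeD(1)[OF assms(2)], of v w "conc w y"] that assms False by auto
  then show ?thesis
    using el_other[of "conc w y" U p \<eta>] permutes_not_in[OF el_okD(2)[OF assms(1)] False] False by simp
qed

lemma el_aff:
  assumes "el_ok U p \<eta>" "code d Q" "U \<subseteq> Q" "w \<in> Q"
  shows "aff (el U p \<eta>) w (p w) (if w \<in> U then \<eta> w else id)"
proof -
  have "p w \<in> Q"
    using permutes_in_image[OF permutes_subset[OF el_okD(2)[OF assms(1)] assms(3)]] assms(4) by simp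
  then show ?thesis
    unfolding aff_def using el_code[OF assms] codeD(3)[OF assms(2)] el_okD(3)[OF assms(1)] by simp
qed

lemma ext_code:
  assumes "code d Q" "\<And>w y. w \<in> Q \<Longrightarrow> y \<in> infwords d \<Longrightarrow> f (conc w y) = g (conc w y)"
    and "\<And>x. x \<notin> infwords d \<Longrightarrow> f x = g x"
  shows "f = g"
proof
  fix x
  show "f x = g x"
  proof (cases "x \<in> infwords d")
    case True
    obtain w where w: "w \<in> Q" "pre (length w) x = w" using codeD(4)[OF assms(1) True] by blast
    then show ?thesis
      using assms(2)[OF w(1) sdrop_mem[OF True, of "length w"]] conc_pre_sdrop[of "length w" x] by simp
  qed (rule assms(3))
qed

lemma el_comp:
  assumes "el_ok U p \<eta>" "el_ok U q \<theta>"
  shows "el U p \<eta> \<circ> el U q \<theta> = el U (p \<circ> q) (\<lambda>w. \<eta> (q w) \<circ> \<theta> w)"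
    and "el_ok U (p \<circ> q) (\<lambda>w. \<eta> (q w) \<circ> \<theta> w)"
proof -
  note E = el_okD[OF assms(1)] and F = el_okD[OF assms(2)]
  show ok: "el_ok U (p \<circ> q) (\<lambda>w. \<eta> (q w) \<circ> \<theta> w)"
    using E F by (simp add: el_ok_def permutes_compose)
  obtain Q where Q: "code d Q" "U \<subseteq> Q" using antichain_extend[OF E(1)] by blast
  show "el U p \<eta> \<circ> el U q \<theta> = el U (p \<circ> q) (\<lambda>w. \<eta> (q w) \<circ> \<theta> w)"
  proof (rule ext_code[OF Q(1)])
    fix w y assume w: "w \<in> Q" and y: "y \<in> infwords d"
    have qw: "q w \<in> Q" "q w \<in> U \<longleftrightarrow> w \<in> U"
      using permutes_in_image[OF permutes_subset[OF F(2) Q(2)]] permutes_in_image[OF F(2)] w by auto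
    have "(if w \<in> U then \<theta> w else id) \<circ> y \<in> infwords d" using y F(3) by simp
    from el_code[OF assms(1) Q qw(1) this] el_code[OF assms(2) Q w y] el_code[OF ok Q w y]
    show "(el U p \<eta> \<circ> el U q \<theta>) (conc w y) = el U (p \<circ> q) (\<lambda>w. \<eta> (q w) \<circ> \<theta> w) (conc w y)"
      using qw(2) by (simp add: comp_assoc)
  qed (simp add: el_other)
qed

text \<open>Words added with identity germ are left in place, so maps supported on different
  antichains can be multiplied on a common one.\<close>

lemma el_extend:
  assumes "el_ok U p \<eta>" "antichain d W" "U \<subseteq> W" "\<And>w. w \<in> W - U \<Longrightarrow> \<eta> w = id"
  shows "el W p \<eta> = el U p \<eta>" "el_ok W p \<eta>"
proof -
  note E = el_okD[OF assms(1)]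
  show ok: "el_ok W p \<eta>"
    using E assms permutes_subset[OF E(2) assms(3)] unfolding el_ok_def by (metis DiffI H_id)
  obtain Q where Q: "code d Q" "W \<subseteq> Q" using antichain_extend[OF assms(2)] by blast
  show "el W p \<eta> = el U p \<eta>"
  proof (rule ext_code[OF Q(1)])
    fix w y assume w: "w \<in> Q" and y: "y \<in> infwords d"
    show "el W p \<eta> (conc w y) = el U p \<eta> (conc w y)"
      using el_code[OF ok Q w y] el_code[OF assms(1) Q(1) _ w y] assms(3,4) Q(2) by auto
  qed (simp add: el_other)
qed

lemma el_id: "antichain d U \<Longrightarrow> el U id (\<lambda>_. id) = id"
proof -
  assume U: "antichain d U"
  obtain Q where Q: "code d Q" "U \<subseteq> Q" using antichain_extend[OF U] by blast
  have ok: "el_ok U id (\<lambda>_. id)" using U by (simp add: el_ok_def)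
  show ?thesis
    by (rule ext_code[OF Q(1)]) (simp_all add: el_code[OF ok Q] el_other)
qed

lemma el_cong: "antichain d U \<Longrightarrow> (\<And>w. w \<in> U \<Longrightarrow> p w = q w) \<Longrightarrow> (\<And>w. w \<in> U \<Longrightarrow> \<eta> w = \<theta> w) \<Longrightarrow> el U p \<eta> = el U q \<theta>"
proof (rule ext)
  fix x
  assume U: "antichain d U" and *: "\<And>w. w \<in> U \<Longrightarrow> p w = q w" "\<And>w. w \<in> U \<Longrightarrow> \<eta> w = \<theta> w"
  show "el U p \<eta> x = el U q \<theta> x"
  proof (cases "x \<in> infwords d \<and> (\<exists>w\<in>U. pre (length w) x = w)")
    case True
    then obtain w where w: "w \<in> U" "x = conc w (sdrop (length w) x)" "x \<in> infwords d"
      by (metis conc_pre_sdrop)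
    then show ?thesis using el_conc[OF U w(1) sdrop_mem[OF w(3)]] * by metis
  qed (auto simp: el_def)
qed

lemma el_left_inverse:
  assumes "el_ok U p \<eta>"
  defines "\<theta> \<equiv> \<lambda>w. inv' (\<eta> (inv' p w))"
  shows "el_ok U (inv' p) \<theta>" "el U (inv' p) \<theta> \<circ> el U p \<eta> = id" "el U p \<eta> \<circ> el U (inv' p) \<theta> = id"
proof -
  note E = el_okD[OF assms(1)]
  show ok: "el_ok U (inv' p) \<theta>"
    unfolding el_ok_def \<theta>_def using E permutes_inv[OF E(2)] permutes_in_image[OF permutes_inv[OF E(2)]] by simp
  have "el U (inv' p \<circ> p) (\<lambda>w. \<theta> (p w) \<circ> \<eta> w) = el U id (\<lambda>_. id)"
    unfolding \<theta>_def using E permutes_inverses[OF E(2)] H_inv_comp by (intro el_cong) auto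
  then show "el U (inv' p) \<theta> \<circ> el U p \<eta> = id" using el_comp(1)[OF ok assms(1)] el_id[OF E(1)] by simp
  have "el U (p \<circ> inv' p) (\<lambda>w. \<eta> (inv' p w) \<circ> \<theta> w) = el U id (\<lambda>_. id)"
    unfolding \<theta>_def using E permutes_inverses[OF E(2)] H_inv_comp permutes_in_image[OF permutes_inv[OF E(2)]]
    by (intro el_cong) auto
  then show "el U p \<eta> \<circ> el U (inv' p) \<theta> = id" using el_comp(1)[OF assms(1) ok] el_id[OF E(1)] by simp
qed

lemma local_affI:
  assumes "code d Q" "adapted g Q"
  shows "local_aff g"
  unfolding local_aff_def
proof
  fix x assume "x \<in> infwords d"
  then obtain w where "w \<in> Q" "pre (length w) x = w" using codeD(4)[OF assms(1)] by blast
  then show "\<exists>n u h. aff g (pre n x) u h" using assms(2) unfolding adapted_def by metis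
qed

lemma el_adapted:
  assumes "el_ok U p \<eta>" "code d Q" "U \<subseteq> Q"
  shows "adapted (el U p \<eta>) Q"
  unfolding adapted_def using el_aff[OF assms] by blast

lemma el_mem: "el_ok U p \<eta> \<Longrightarrow> x \<in> infwords d \<Longrightarrow> el U p \<eta> x \<in> infwords d"
proof -
  assume ok: "el_ok U p \<eta>" and x: "x \<in> infwords d"
  obtain Q where Q: "code d Q" "U \<subseteq> Q" using antichain_extend[OF el_okD(1)[OF ok]] by blast
  obtain w where w: "w \<in> Q" "pre (length w) x = w" using codeD(4)[OF Q(1) x] by blast
  note a = affD[OF el_aff[OF ok Q w(1)]]
  have "el U p \<eta> x = conc (p w) ((if w \<in> U then \<eta> w else id) \<circ> sdrop (length w) x)"
    using a(3)[OF sdrop_mem[OF x, of "length w"]] conc_pre_sdrop[of "length w" x] w by simp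
  then show ?thesis using H_comp_mem[OF a(2)] a(1) x by simp
qed

lemma el_V:
  assumes "el_ok U p \<eta>"
  shows "el U p \<eta> \<in> V"
  unfolding V_iff
proof (intro conjI allI impI)
  note I = el_left_inverse[OF assms]
  show "bij_betw (el U p \<eta>) (infwords d) (infwords d)"
    using el_mem[OF assms] el_mem[OF I(1)] fun_cong[OF I(2)] fun_cong[OF I(3)]
    by (intro bij_betw_byWitness[where f' = "el U (inv' p) (\<lambda>w. inv' (\<eta> (inv' p w)))"]) auto
  obtain Q where Q: "code d Q" "U \<subseteq> Q" using antichain_extend[OF el_okD(1)[OF assms]] by blast
  show "local_aff (el U p \<eta>)" using local_affI[OF Q(1) el_adapted[OF assms Q]] .
qed (simp add: el_other)

lemma el_invs:
  assumes "el_ok U p \<eta>" "code d Q" "U \<subseteq> Q"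
  shows "even (invs (tgt (el U p \<eta>)) Q) \<longleftrightarrow> evenperm p"
proof -
  have "invs (tgt (el U p \<eta>)) Q = invs p Q"
    using tgt_eq[OF el_aff[OF assms]] by (intro invs_cong) simp
  then show ?thesis
    using evenperm_iff_invs[OF codeD(2)[OF assms(2)] permutes_subset[OF el_okD(2)[OF assms(1)] assms(3)]] by simp
qed

section \<open>Even tables\<close>

text \<open>The indices list both codes in lexicographic order, so the inversions of
  \<open>\<tau>\<close> on indices are those of \<open>tgt g\<close> on words.\<close>

lemma is_table_code:
  assumes t: "is_table d H g vs us hs \<tau>"
  shows "code d (set vs)" "adapted g (set vs)" "even (invs (tgt g) (set vs)) \<longleftrightarrow> evenperm \<tau>"
proof -
  let ?m = "length vs"
  have sv: "vs ! i < vs ! j \<longleftrightarrow> i < j" if "i < ?m" "j < ?m" for i j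
  proof -
    have s: "sorted_wrt (<) vs" using t by (simp add: is_table_def lexlt_iff_less[abs_def])
    show ?thesis using sorted_wrt_nth_less[OF s, of i j] sorted_wrt_nth_less[OF s, of j i] that
      by (cases i j rule: linorder_cases) auto
  qed
  have su: "us ! i < us ! j \<longleftrightarrow> i < j" if "i < ?m" "j < ?m" for i j
  proof -
    have s: "sorted_wrt (<) us" "length us = ?m" using t by (simp_all add: is_table_def lexlt_iff_less[abs_def])
    show ?thesis using sorted_wrt_nth_less[OF s(1), of i j] sorted_wrt_nth_less[OF s(1), of j i] that s(2)
      by (cases i j rule: linorder_cases) auto
  qed
  have pv: "is_partition_words d vs" and pu: "is_partition_words d us" and len: "length us = ?m" "length hs = ?m"
    and tau: "\<tau> permutes {0..<?m}" and hs: "set hs \<subseteq> H"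
    and g: "\<And>i y. i < ?m \<Longrightarrow> y \<in> infwords d \<Longrightarrow> g (conc (vs ! i) y) = conc (us ! \<tau> i) ((hs ! i) \<circ> y)"
    using t by (auto simp: is_table_def)
  have fv: "finword d w" if "w \<in> set vs" for w using pv that by (simp add: is_partition_words_def)
  show "code d (set vs)"
    unfolding code_def antichain_def
  proof (intro conjI ballI impI)
    show "u \<parallel> v" if uv: "u \<in> set vs" "v \<in> set vs" "u \<noteq> v" for u v
    proof -
      obtain i j where ij: "i < ?m" "j < ?m" "u = vs ! i" "v = vs ! j" using uv by (metis in_set_conv_nth)
      then have "ball_w d u \<inter> ball_w d v = {}" using pv uv(3) unfolding is_partition_words_def by metis
      then show ?thesis using ball_w_disjoint_iff[OF d1 fv[OF uv(1)] fv[OF uv(2)]] by simp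
    qed
    show "\<exists>w\<in>set vs. pre (length w) x = w" if "x \<in> infwords d" for x
    proof -
      have "x \<in> (\<Union>w\<in>set vs. ball_w d w)" using pv that unfolding is_partition_words_def by blast
      then show ?thesis using mem_ball_w[OF fv] by blast
    qed
  qed (use fv in simp_all)
  have af: "aff g (vs ! i) (us ! \<tau> i) (hs ! i)" if "i < ?m" for i
  proof -
    have "\<tau> i < ?m" using permutes_in_image[OF tau, of i] that by simp
    then have "finword d (us ! \<tau> i)" using pu len by (simp add: is_partition_words_def)
    moreover have "hs ! i \<in> H" using hs len that by (simp add: subset_iff)
    ultimately show ?thesis using g[OF that] by (simp add: aff_def)
  qed
  show "adapted g (set vs)"
    unfolding adapted_def using af by (metis in_set_conv_nth)
  have "invs (tgt g) ((!) vs ` {0..<?m}) = invs \<tau> {0..<?m}"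
  proof (rule invs_reindex)
    show "inj_on ((!) vs) {0..<?m}"
      by (rule inj_onI) (metis atLeastLessThan_iff less_irrefl linorder_neqE_nat sv)
    fix i j assume "i \<in> {0..<?m}" "j \<in> {0..<?m}"
    then have ij: "i < ?m" "j < ?m" and "\<tau> i < ?m" "\<tau> j < ?m"
      using permutes_in_image[OF tau] by auto
    then show "vs ! i < vs ! j \<longleftrightarrow> i < j" "tgt g (vs ! i) < tgt g (vs ! j) \<longleftrightarrow> \<tau> i < \<tau> j"
      using sv su tgt_eq[OF af[OF ij(1)]] tgt_eq[OF af[OF ij(2)]] by auto
  qed
  moreover have "(!) vs ` {0..<?m} = set vs" by (metis map_nth set_map set_upt)
  ultimately show "even (invs (tgt g) (set vs)) \<longleftrightarrow> evenperm \<tau>"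
    using evenperm_iff_invs[OF _ tau] by simp
qed

lemma exists_table:
  assumes g: "g \<in> V" and Q: "code d Q" "adapted g Q"
  obtains vs us hs \<tau> where "is_table d H g vs us hs \<tau>" "set vs = Q"
proof -
  note img = adapted_code_image[OF g Q]
  let ?U = "tgt g ` Q"
  define vs us hs where "vs = sorted_list_of_set Q" and "us = sorted_list_of_set ?U"
    and "hs = map (germ g) vs"
  have fin: "finite Q" "finite ?U" using codeD(2)[OF Q(1)] by auto
  have sets: "set vs = Q" "set us = ?U" using fin by (simp_all add: vs_def us_def)
  have srt: "sorted_wrt (<) vs" "sorted_wrt (<) us" by (simp_all add: vs_def us_def strict_sorted_list_of_set)
  have dis: "distinct vs" "distinct us" by (simp_all add: vs_def us_def)
  have len: "length us = length vs" using card_image[OF img(2)] by (simp add: vs_def us_def)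
  let ?m = "length vs" and ?I = "{0..<length vs}"
  have bv: "bij_betw ((!) vs) ?I Q" using bij_betw_nth[OF dis(1), of ?I] sets by (simp add: atLeast0LessThan)
  have bu: "bij_betw ((!) us) ?I ?U" using bij_betw_nth[OF dis(2), of ?I] sets len by (simp add: atLeast0LessThan)
  have bt: "bij_betw (tgt g) Q ?U" using img(2) by (simp add: bij_betw_def)
  \<comment> \<open>The permutation of indices that \<open>tgt g\<close> induces between the two
    sorted lists.\<close>
  define \<tau>' where "\<tau>' = inv_into ?I ((!) us) \<circ> (tgt g \<circ> (!) vs)"
  have bij: "bij_betw \<tau>' ?I ?I"
    unfolding \<tau>'_def using bij_betw_trans[OF bij_betw_trans[OF bv bt] bij_betw_inv_into[OF bu]] .
  define \<tau> where "\<tau> i = (if i \<in> ?I then \<tau>' i else i)" for i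
  have "bij_betw \<tau> ?I ?I" using bij by (rule bij_betw_cong[THEN iffD1, rotated]) (simp add: \<tau>_def)
  then have tau: "\<tau> permutes ?I" by (rule bij_imp_permutes) (simp add: \<tau>_def)
  have us: "us ! \<tau> i = tgt g (vs ! i)" if "i < ?m" for i
  proof -
    have "tgt g (vs ! i) \<in> ?U" using that sets nth_mem by blast
    then show ?thesis using that bij_betw_inv_into_right[OF bu] by (simp add: \<tau>_def \<tau>'_def)
  qed
  have part: "is_partition_words d ws" if W: "code d (set ws)" "distinct ws" for ws
    unfolding is_partition_words_def
  proof (intro conjI ballI allI impI)
    show fw: "finword d w" if "w \<in> set ws" for w using codeD(3)[OF W(1) that] .
    show "ball_w d (ws ! i) \<inter> ball_w d (ws ! j) = {}" if "i < length ws" "j < length ws" "i \<noteq> j" for i j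
    proof -
      have "ws ! i \<parallel> ws ! j"
        using antichainD(3)[OF codeD(1)[OF W(1)]] that nth_eq_iff_index_eq[OF W(2)] by simp
      then show ?thesis using ball_w_disjoint_iff[OF d1] fw that by simp
    qed
    show "(\<Union>w\<in>set ws. ball_w d w) = infwords d"
      using codeD(4)[OF W(1)] fw by (auto simp: mem_ball_w)
  qed
  have "is_table d H g vs us hs \<tau>"
    unfolding is_table_def
  proof (intro conjI allI impI ballI)
    show "sorted_wrt lexlt vs" "sorted_wrt lexlt us" using srt by (simp_all add: lexlt_iff_less[abs_def])
    show "is_partition_words d vs" "is_partition_words d us"
      using part dis sets Q(1) img(1) by auto
    show "set hs \<subseteq> H" using affD(2)[OF adaptedD[OF Q(2)]] sets by (auto simp: hs_def)
    fix i y assume i: "i < ?m" and y: "y \<in> infwords d"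
    have "vs ! i \<in> Q" using i sets by auto
    from affD(3)[OF adaptedD[OF Q(2) this] y]
    show "g (conc (vs ! i) y) = conc (us ! \<tau> i) (hs ! i \<circ> y)" using us[OF i] i by (simp add: hs_def)
  qed (use len tau in \<open>simp_all add: hs_def\<close>)
  then show thesis using that sets by blast
qed

lemma has_even_table_iff:
  assumes "g \<in> V"
  shows "has_even_table d H g \<longleftrightarrow> (\<exists>Q. code d Q \<and> adapted g Q \<and> even (invs (tgt g) Q))"
proof
  assume "has_even_table d H g"
  then obtain vs us hs \<tau> where t: "is_table d H g vs us hs \<tau>" "evenperm \<tau>"
    unfolding has_even_table_def by iprover
  then show "\<exists>Q. code d Q \<and> adapted g Q \<and> even (invs (tgt g) Q)"
    using is_table_code[OF t(1)] by iprover
next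
  assume "\<exists>Q. code d Q \<and> adapted g Q \<and> even (invs (tgt g) Q)"
  then obtain Q where Q: "code d Q" "adapted g Q" "even (invs (tgt g) Q)" by iprover
  obtain vs us hs \<tau> where t: "is_table d H g vs us hs \<tau>" "set vs = Q"
    by (rule exists_table[OF assms Q(1,2)])
  then have "evenperm \<tau>" using is_table_code(3)[OF t(1)] Q(3) by simp
  with t(1) show "has_even_table d H g" unfolding has_even_table_def by (intro exI conjI)
qed

section \<open>The parity of tables as a homomorphism\<close>

definition exceptional :: bool where
  "exceptional \<longleftrightarrow> odd d \<and> H \<subseteq> carrier (alt_group d)"

lemma sign_exists:
  assumes exceptional
  shows "\<exists>s \<in> hom VG sign_img. \<forall>g Q. g \<in> V \<longrightarrow> code d Q \<longrightarrow> adapted g Q \<longrightarrow>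
    s g = (if even (invs (tgt g) Q) then 1 else -1)"
proof -
  interpret B: group sign_img by (rule sign_img_is_group)
  have cg: "comm_group sign_img"
    by (rule group.group_comm_groupI[OF sign_img_is_group]) (simp add: sign_img_def mult.commute)
  have pow: "(-1) [^]\<^bsub>sign_img\<^esub> (n :: nat) = (if even n then 1 else -1)" for n
    by (induction n) (auto simp: sign_img_def)
  have ev: "even (invs h {1..d})" if "h \<in> H" for h
    using that assms evenperm_iff_invs[of "{1..d}" h] H_permutes
    by (auto simp: exceptional_def alt_group_carrier)
  \<comment> \<open>The character with trivial \<open>phi\<close> and \<open>eps = -1\<close>:
    \<open>phi_pow\<close> holds because all of \<open>H\<close> is even, \<open>eps_even\<close>
    because \<open>d\<close> is odd. Its value is the parity of the inversions, which is thereby the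
    same for every adapted code.\<close>
  interpret C: rn_char d H sign_img "\<lambda>_. 1" "- 1"
  proof (intro rn_char.intro rn_group_axioms rn_char_axioms.intro cg)
    show "1 [^]\<^bsub>sign_img\<^esub> d = 1 \<otimes>\<^bsub>sign_img\<^esub> (- 1) [^]\<^bsub>sign_img\<^esub> invs h {1..d}" if "h \<in> H" for h
      unfolding pow using ev[OF that] B.nat_pow_one[of d] by (simp add: sign_img_def)
    show "odd d \<or> - 1 = \<one>\<^bsub>sign_img\<^esub>" using assms by (simp add: exceptional_def)
  qed (simp_all add: sign_img_def)
  have "C.Chi g = (if even (invs (tgt g) Q) then 1 else -1)" if "g \<in> V" "code d Q" "adapted g Q" for g Q
  proof -
    have "(\<Otimes>\<^bsub>sign_img\<^esub>w\<in>Q. 1) = (1 :: int)"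
      using C.finprod_one_eqI[of Q "\<lambda>_. 1"] by (simp add: sign_img_def)
    then show ?thesis
      using C.Chi_eq[OF that] by (simp add: C.chi_def pow) (simp add: sign_img_def)
  qed
  then show ?thesis using C.Chi_hom by (intro bexI[of _ C.Chi]) auto
qed


section \<open>The commutator subgroup\<close>

abbreviation V' :: "((nat \<Rightarrow> nat) \<Rightarrow> (nat \<Rightarrow> nat)) set" where
  "V' \<equiv> Vd' d H"

lemma V'_nonexceptional: "\<not> exceptional \<Longrightarrow> V' = V"
  by (auto simp: Vd'_def exceptional_def)

text \<open>The second part computes the sign of a permutation of balls: it is that of
  \<open>p\<close>, whatever the germs.\<close>

lemma sign_V':
  assumes exceptional
  shows "\<exists>s \<in> hom VG sign_img. V' = {g \<in> V. s g = 1} \<and>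
    (\<forall>U p \<eta>. el_ok U p \<eta> \<longrightarrow> s (el U p \<eta>) = (if evenperm p then 1 else -1))"
proof -
  obtain s where s: "s \<in> hom VG sign_img"
    "\<And>g Q. g \<in> V \<Longrightarrow> code d Q \<Longrightarrow> adapted g Q \<Longrightarrow> s g = (if even (invs (tgt g) Q) then 1 else -1)"
    using sign_exists[OF assms] by blast
  have "has_even_table d H g \<longleftrightarrow> s g = 1" if g: "g \<in> V" for g
  proof
    assume "has_even_table d H g"
    then obtain Q where "code d Q" "adapted g Q" "even (invs (tgt g) Q)"
      unfolding has_even_table_iff[OF g] by iprover
    then show "s g = 1" using s(2)[OF g] by simp
  next
    assume *: "s g = 1"
    obtain Q where Q: "code d Q" "adapted g Q" by (rule exists_adapted[OF g])
    then have "even (invs (tgt g) Q)" using s(2)[OF g Q] * by (simp split: if_splits)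
    with Q show "has_even_table d H g" unfolding has_even_table_iff[OF g] by iprover
  qed
  then have "V' = {g \<in> V. s g = 1}"
    using assms unfolding Vd'_def exceptional_def by (simp cong: conj_cong)
  moreover have "s (el U p \<eta>) = (if evenperm p then 1 else -1)" if ok: "el_ok U p \<eta>" for U p \<eta>
  proof -
    obtain Q where Q: "code d Q" "U \<subseteq> Q" by (rule antichain_extend[OF el_okD(1)[OF ok]])
    show ?thesis using s(2)[OF el_V[OF ok] Q(1) el_adapted[OF ok Q]] el_invs[OF ok Q] by simp
  qed
  ultimately show ?thesis using s(1) by (intro bexI[of _ s]) auto
qed

lemma el_V':
  assumes "el_ok U p \<eta>" "evenperm p"
  shows "el U p \<eta> \<in> V'"
proof (cases exceptional)
  case True
  obtain s :: "_ \<Rightarrow> int" where "V' = {g \<in> V. s g = 1}"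
    "\<And>U p \<eta>. el_ok U p \<eta> \<Longrightarrow> s (el U p \<eta>) = (if evenperm p then 1 else -1)"
    using sign_V'[OF True] by blast
  then show ?thesis using assms el_V by simp
qed (use V'_nonexceptional el_V[OF assms(1)] in simp)

lemma V'_normal: "V' \<lhd> VG"
proof (cases exceptional)
  case True
  obtain s where s: "s \<in> hom VG sign_img" "V' = {g \<in> V. s g = 1}"
    using sign_V'[OF True] by blast
  interpret s: group_hom VG sign_img s
    using s(1) VG_group sign_img_is_group by (simp add: group_hom_def group_hom_axioms_def)
  have "V' = kernel VG sign_img s" using s(2) by (simp add: kernel_def sign_img_def)
  then show ?thesis using s.normal_kernel by simp
next
  case False
  then show ?thesis using group.normal_self[OF VG_group] V'_nonexceptional by simp
qed

lemma V'_subgroup: "subgroup V' VG"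
  using V'_normal by (rule normal_imp_subgroup)

section \<open>The quotient of V by the commutator subgroup of V'\<close>

definition D where "D = derived VG V'"

lemma D_normal: "D \<lhd> VG"
  unfolding D_def by (rule group.derived_is_normal[OF VG_group V'_normal])

lemma D_subset: "D \<subseteq> V'"
  unfolding D_def by (rule group.derived_incl[OF VG_group subset_refl V'_subgroup])

definition QG where "QG = VG Mod D"

definition cl where "cl g = D #>\<^bsub>VG\<^esub> g"

sublocale Q: group QG
  unfolding QG_def using D_normal by (rule normal.factorgroup_is_group)

lemma cl_closed [simp]: "g \<in> V \<Longrightarrow> cl g \<in> carrier QG"
  unfolding cl_def QG_def FactGroup_def RCOSETS_def by auto

lemma cl_comp: "g \<in> V \<Longrightarrow> f \<in> V \<Longrightarrow> cl (g \<circ> f) = cl g \<otimes>\<^bsub>QG\<^esub> cl f"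
  using normal.rcos_sum[OF D_normal, of g f] by (simp add: cl_def QG_def FactGroup_def)

lemma cl_eq_one_iff: "g \<in> V \<Longrightarrow> cl g = \<one>\<^bsub>QG\<^esub> \<longleftrightarrow> g \<in> D"
  using group.coset_join1[OF VG_group, of D g] group.coset_join2[OF VG_group, of g D]
    normal_imp_subgroup[OF D_normal] subgroup.subset[OF normal_imp_subgroup[OF D_normal]]
  by (auto simp: cl_def QG_def FactGroup_def)

lemma cl_id: "cl id = \<one>\<^bsub>QG\<^esub>"
  using cl_eq_one_iff[OF V_id] subgroup.one_closed[OF normal_imp_subgroup[OF D_normal]] by simp

lemma cl_commute:
  assumes "g \<in> V'" "f \<in> V'"
  shows "cl g \<otimes>\<^bsub>QG\<^esub> cl f = cl f \<otimes>\<^bsub>QG\<^esub> cl g"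
proof -
  have V: "g \<in> V" "f \<in> V" using subgroup.mem_carrier[OF V'_subgroup] assms by auto
  let ?c = "(g \<circ> f) \<circ> inv' g \<circ> inv' f"
  have cV: "?c \<in> V" by (intro V_comp V_inv V)
  have "g \<otimes>\<^bsub>VG\<^esub> f \<otimes>\<^bsub>VG\<^esub> inv\<^bsub>VG\<^esub> g \<otimes>\<^bsub>VG\<^esub> inv\<^bsub>VG\<^esub> f \<in> D"
    unfolding D_def derived_def using assms by (intro generate.incl) blast
  then have "?c \<in> D" using V by (simp only: VG_simps VG_inv)
  then have 1: "cl ?c = \<one>\<^bsub>QG\<^esub>" using cl_eq_one_iff[OF cV] by simp
  have "?c \<circ> (f \<circ> g) = g \<circ> f"
    using bij_is_inj[OF V_bij[OF V(1)]] bij_is_inj[OF V_bij[OF V(2)]] by (simp add: fun_eq_iff)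
  then have "cl (g \<circ> f) = cl ?c \<otimes>\<^bsub>QG\<^esub> cl (f \<circ> g)" using cl_comp[OF cV, of "f \<circ> g"] V by simp
  then show ?thesis using 1 V by (simp add: cl_comp)
qed

subsection \<open>Swaps of two balls\<close>

definition swp where "swp u v = el {u, v} (transpose u v) (\<lambda>_. id)"

definition Lam where "Lam w h = el {w} id (\<lambda>_. h)"

lemma antichain_insert:
  "antichain d (insert u U) \<longleftrightarrow> antichain d U \<and> finword d u \<and> (\<forall>v\<in>U. v \<noteq> u \<longrightarrow> u \<parallel> v)"
  unfolding antichain_def by (auto simp: parallel_commute)

lemma antichain_empty [simp]: "antichain d {}"
  by (simp add: antichain_def)

lemma perm_ok: "antichain d U \<Longrightarrow> p permutes U \<Longrightarrow> el_ok U p (\<lambda>_. id)"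
  by (simp add: el_ok_def)

lemma transpose_ok: "antichain d U \<Longrightarrow> u \<in> U \<Longrightarrow> v \<in> U \<Longrightarrow> el_ok U (transpose u v) (\<lambda>_. id)"
  by (intro perm_ok permutes_swap_id)

lemma swp_eq:
  assumes "antichain d U" "u \<in> U" "v \<in> U"
  shows "el U (transpose u v) (\<lambda>_. id) = swp u v"
proof -
  have "{u, v} \<subseteq> U" using assms by simp
  then show ?thesis
    unfolding swp_def
    using el_extend(1)[OF transpose_ok[of "{u, v}"] assms(1)] antichain_subset[OF assms(1)] by simp
qed

lemma swp_V: "antichain d {u, v} \<Longrightarrow> swp u v \<in> V"
  unfolding swp_def by (intro el_V transpose_ok) auto

lemma perm_el_comp:
  assumes "antichain d U" "p permutes U" "q permutes U"
  shows "el U p (\<lambda>_. id) \<circ> el U q (\<lambda>_. id) = el U (p \<circ> q) (\<lambda>_. id)"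
  using el_comp(1)[OF perm_ok perm_ok, of U p q] assms by simp

lemma cl_perm_comp:
  assumes "antichain d U" "p permutes U" "q permutes U"
  shows "cl (el U (p \<circ> q) (\<lambda>_. id)) = cl (el U p (\<lambda>_. id)) \<otimes>\<^bsub>QG\<^esub> cl (el U q (\<lambda>_. id))"
  unfolding perm_el_comp[OF assms, symmetric] by (intro cl_comp el_V perm_ok assms)

lemma cl_swp_sq:
  assumes "antichain d {u, v}"
  shows "cl (swp u v) \<otimes>\<^bsub>QG\<^esub> cl (swp u v) = \<one>\<^bsub>QG\<^esub>"
proof -
  have t: "transpose u v permutes {u, v}" by (intro permutes_swap_id) auto
  show ?thesis
    unfolding swp_def cl_perm_comp[OF assms t t, symmetric] using el_id[OF assms] cl_id by simp
qed

text \<open>In the alternating group on four letters, \<open>(1 2)(3 4)\<close> is the commutator of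
  \<open>(1 2 3)\<close> and \<open>(1 2 4)\<close>.\<close>

lemma cl_swp_disjoint:
  assumes U: "antichain d {u, v, u', v'}" and dist: "distinct [u, v, u', v']"
  shows "cl (swp u v) = cl (swp u' v')"
proof -
  let ?U = "{u, v, u', v'}"
  let ?a = "transpose u v \<circ> transpose v u'" and ?b = "transpose u v \<circ> transpose v v'"
  let ?t = "transpose u v \<circ> transpose u' v'"
  have t: "transpose x y permutes ?U" if "x \<in> ?U" "y \<in> ?U" for x y
    using that by (rule permutes_swap_id)
  have p: "?a permutes ?U" "?b permutes ?U" "?t permutes ?U"
    by (intro permutes_compose t; simp)+
  have ev: "evenperm ?a" "evenperm ?b"
    using dist by (auto simp: evenperm_comp permutation_swap_id evenperm_swap)
  have eq: "?a \<circ> ?b = ?t \<circ> (?b \<circ> ?a)"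
  proof
    fix x
    show "(?a \<circ> ?b) x = (?t \<circ> (?b \<circ> ?a)) x"
      using dist unfolding comp_def transpose_def
      by (cases "x = u"; cases "x = v"; cases "x = u'"; cases "x = v'") auto
  qed
  have V: "el ?U p (\<lambda>_. id) \<in> V" if "p permutes ?U" for p using el_V[OF perm_ok[OF U that]] .
  note c = cl_perm_comp[OF U]
  have "cl (el ?U ?a (\<lambda>_. id)) \<otimes>\<^bsub>QG\<^esub> cl (el ?U ?b (\<lambda>_. id))
      = cl (el ?U ?b (\<lambda>_. id)) \<otimes>\<^bsub>QG\<^esub> cl (el ?U ?a (\<lambda>_. id))"
    using ev by (intro cl_commute el_V' perm_ok U p)
  then have *: "cl (el ?U (?a \<circ> ?b) (\<lambda>_. id)) = cl (el ?U (?b \<circ> ?a) (\<lambda>_. id))"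
    unfolding c[OF p(1,2)] c[OF p(2,1)] .
  have "cl (el ?U ?t (\<lambda>_. id)) \<otimes>\<^bsub>QG\<^esub> cl (el ?U (?b \<circ> ?a) (\<lambda>_. id)) = cl (el ?U (?b \<circ> ?a) (\<lambda>_. id))"
    unfolding c[OF p(3) permutes_compose[OF p(1,2)], symmetric] eq[symmetric] by (rule *)
  then have "cl (el ?U ?t (\<lambda>_. id)) = \<one>\<^bsub>QG\<^esub>"
    using V[OF p(3)] V[OF permutes_compose[OF p(1,2)]] by (simp only: Q.l_cancel_one' Q.r_cancel_one cl_closed)
  \<comment> \<open>The trivial class of \<open>?t\<close> is the product of the classes of the two
    swaps. Both have square one, so they coincide.\<close>
  then have 1: "cl (swp u v) \<otimes>\<^bsub>QG\<^esub> cl (swp u' v') = \<one>\<^bsub>QG\<^esub>"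
    using c[OF t t, of u v u' v'] swp_eq[OF U] by simp
  have a: "antichain d {u, v}" "antichain d {u', v'}" using antichain_subset[OF U] by auto
  then have "cl (swp u v) = cl (swp u v) \<otimes>\<^bsub>QG\<^esub> (cl (swp u' v') \<otimes>\<^bsub>QG\<^esub> cl (swp u' v'))"
    using cl_swp_sq[OF a(2)] swp_V by simp
  also have "\<dots> = cl (swp u' v')"
    using 1 swp_V a by (simp add: Q.m_assoc[symmetric])
  finally show ?thesis .
qed

text \<open>A complete code with just two words would contain the \<open>d\<close> children of some
  word, at least three.\<close>

lemma antichain_third:
  assumes "3 \<le> d" "antichain d {u, v}" "u \<noteq> v"
  obtains c where "antichain d {u, v, c}" "c \<noteq> u" "c \<noteq> v"
proof -
  obtain Q where Q: "code d Q" "{u, v} \<subseteq> Q" by (rule antichain_extend[OF assms(2)])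
  have "Q \<noteq> {u, v}"
  proof
    assume Quv: "Q = {u, v}"
    then have "Q \<noteq> {[]}" using assms(3) by auto
    then obtain w where "kids d w \<subseteq> Q" by (rule code_caret[OF d1 Q(1)])
    then have "d \<le> card {u, v}" using card_mono[of "{u, v}" "kids d w"] Quv by simp
    then show False using assms(1,3) by simp
  qed
  then obtain c where c: "c \<in> Q" "c \<noteq> u" "c \<noteq> v" using Q(2) by blast
  then have "antichain d {u, v, c}" using antichain_subset[OF codeD(1)[OF Q(1)]] Q(2) by simp
  then show thesis using that c by simp
qed


text \<open>The ball of \<open>[1]\<close> stays free, also for \<open>d = 2\<close>, so this pair
  always has a disjoint third ball.\<close>

definition s0 where "s0 = swp [2, 1] [2, 2]"

lemma parallel_Cons: "a \<noteq> b \<Longrightarrow> a # u \<parallel> b # v"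
  by (auto simp: parallel_def)

lemma letters: "finword d [2, 1]" "finword d [2, 2]" "finword d [1, 1]" "finword d [1, 2]" "finword d [1]" "finword d [2]"
  using d2 by (auto simp: finword_def)

lemma parallel_append_right: "u \<parallel> c \<Longrightarrow> u \<parallel> c @ z"
  by (auto simp: parallel_def dest: append_prefixD)
     (meson append_prefixD prefix_def prefix_same_cases)

text \<open>Two balls below \<open>c\<close> are disjoint from \<open>u\<close> and
  \<open>v\<close>, so \<open>cl_swp_disjoint\<close> applies. The word \<open>z\<close> is left
  free so that the new pair can be put anywhere below \<open>c\<close>.\<close>

lemma cl_swp_below:
  assumes U: "antichain d {u, v, c}" and ne: "u \<noteq> v" "c \<noteq> u" "c \<noteq> v" and z: "finword d z"
  shows "cl (swp u v) = cl (swp (c @ z @ [1]) (c @ z @ [2]))"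
proof (rule cl_swp_disjoint)
  have c: "u \<parallel> c" "v \<parallel> c" "u \<parallel> v" "finword d u" "finword d v" "finword d c"
    using U ne by (auto simp: antichain_def)
  have z12: "finword d [1]" "finword d [2]" using letters by auto
  have p: "u \<parallel> c @ y" "v \<parallel> c @ y" for y using c parallel_append_right by auto
  have q: "c @ z @ [1] \<parallel> c @ z @ [2]" using parallel_snoc_same[of "1 :: nat" 2 "c @ z"] by simp
  show "antichain d {u, v, c @ z @ [1], c @ z @ [2]}"
    using c z z12 p q by (simp add: antichain_insert)
  show "distinct [u, v, c @ z @ [1], c @ z @ [2]]"
    using p[of "z @ [1]"] p[of "z @ [2]"] ne by auto
qed

text \<open>The two pairs may overlap, so they are compared through the free balls. If
  \<open>c\<close> and \<open>c'\<close> are disjoint, so are the swaps below them; if one lies in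
  the other, both swaps can be pushed to the same two balls.\<close>

lemma cl_swp_eq:
  assumes "antichain d {u, v, c}" "u \<noteq> v" "c \<noteq> u" "c \<noteq> v"
    and "antichain d {u', v', c'}" "u' \<noteq> v'" "c' \<noteq> u'" "c' \<noteq> v'"
  shows "cl (swp u v) = cl (swp u' v')"
proof -
  have fc: "finword d c" "finword d c'" using assms by (auto simp: antichain_def)
  note below = cl_swp_below[OF assms(1-4)] and below' = cl_swp_below[OF assms(5-8)]
  consider "c \<parallel> c'" | z where "c' = c @ z" | z where "c = c' @ z"
    by (auto simp: parallel_def prefix_def)
  then show ?thesis
  proof cases
    case 1
    have 12: "finword d [1]" "finword d [2]" using letters by auto
    have p: "c @ y \<parallel> c' @ y'" for y y'
      using 1 parallel_append_right parallel_commute by blast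
    have "cl (swp (c @ [1]) (c @ [2])) = cl (swp (c' @ [1]) (c' @ [2]))"
    proof (rule cl_swp_disjoint)
      show "antichain d {c @ [1], c @ [2], c' @ [1], c' @ [2]}"
        using fc 12 p parallel_snoc_same[of "1 :: nat" 2] by (simp add: antichain_insert)
      show "distinct [c @ [1], c @ [2], c' @ [1], c' @ [2]]"
        using p[of "[1]" "[1]"] p[of "[1]" "[2]"] p[of "[2]" "[1]"] p[of "[2]" "[2]"] by auto
    qed
    then show ?thesis using below[of "[]"] below'[of "[]"] by simp
  next
    case 2
    then have "finword d z" using fc by simp
    then show ?thesis using below[of z] below'[of "[]"] 2 by simp
  next
    case 3
    then have "finword d z" using fc by simp
    then show ?thesis using below[of "[]"] below'[of z] 3 by simp
  qed
qed

lemma s0_antichain: "antichain d {[2, 1], [2, 2], [1]}"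
  using letters by (simp add: antichain_insert parallel_Cons parallel_same_length)

lemma cl_swp_odd:
  assumes "odd d" "antichain d {u, v}" "u \<noteq> v"
  shows "cl (swp u v) = cl s0"
proof -
  have d3: "3 \<le> d" using d2 assms(1) by (cases "d = 2") auto
  obtain c where "antichain d {u, v, c}" "c \<noteq> u" "c \<noteq> v" by (rule antichain_third[OF d3 assms(2,3)])
  then show ?thesis
    unfolding s0_def using assms(3) s0_antichain by (intro cl_swp_eq) auto
qed

text \<open>The swap is the product of the \<open>d\<close> swaps of \<open>u @ [a]\<close> with
  \<open>v @ [a]\<close>. These act on pairwise disjoint pairs, so they share one class
  \<open>e\<close> of square one, and \<open>d\<close> is even. The argument stays inside the balls
  of \<open>u\<close> and \<open>v\<close>, which covers pairs that fill the whole space.\<close>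

lemma cl_swp_even:
  assumes "even d" "antichain d {u, v}" "u \<noteq> v"
  shows "cl (swp u v) = \<one>\<^bsub>QG\<^esub>"
proof -
  have uv: "u \<parallel> v" "v \<parallel> u" "finword d u" "finword d v" using assms by (auto simp: antichain_def)
  have par: "u @ x \<parallel> v @ y" "v @ x \<parallel> u @ y" for x y
    using uv parallel_append_right parallel_commute by blast+
  then have neq: "u @ x \<noteq> v @ y" "v @ x \<noteq> u @ y" for x y by (metis not_parallel_append(3))+
  define W where "W = kids d u \<union> kids d v"
  have W: "antichain d W"
    unfolding antichain_def W_def kids_def using uv par parallel_snoc_same by auto
  have Wm: "u @ [a] \<in> W" "v @ [a] \<in> W" if "a \<in> {1..d}" for a
    using that by (auto simp: W_def kids_def)
  \<comment> \<open>\<open>T k\<close> carries out the first \<open>k\<close> of the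
    \<open>d\<close> swaps, so \<open>T d\<close> exchanges all children of \<open>u\<close> with
    those of \<open>v\<close>.\<close>
  define T where "T k = rec_nat id (\<lambda>k p. transpose (u @ [Suc k]) (v @ [Suc k]) \<circ> p) k" for k
  have T0: "T 0 = id" and TS: "T (Suc k) = transpose (u @ [Suc k]) (v @ [Suc k]) \<circ> T k" for k
    by (simp_all add: T_def)
  have Tu: "T k (u @ [a]) = (if a \<in> {1..k} then v @ [a] else u @ [a])"
    and Tv: "T k (v @ [a]) = (if a \<in> {1..k} then u @ [a] else v @ [a])" for k a
    by (induction k) (auto simp: T0 TS transpose_def neq)
  define e where "e = cl (swp (u @ [1]) (v @ [1]))"
  have W1: "antichain d {u @ [a], v @ [a]}" if "a \<in> {1..d}" for a
    using antichain_subset[OF W] Wm[OF that] by simp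
  have eV: "e \<in> carrier QG" unfolding e_def using W1[of 1] d1 by (intro cl_closed swp_V) auto
  have e: "cl (swp (u @ [a]) (v @ [a])) = e" if "a \<in> {1..d}" for a
  proof (cases "a = 1")
    case False
    have "1 \<in> {1..d}" using d1 by simp
    then have "antichain d {u @ [a], v @ [a], u @ [1], v @ [1]}"
      using antichain_subset[OF W] Wm that by simp
    then show ?thesis unfolding e_def by (rule cl_swp_disjoint) (use False neq assms(3) in simp)
  qed (simp add: e_def)
  have Tk: "T k permutes W \<and> cl (el W (T k) (\<lambda>_. id)) = e [^]\<^bsub>QG\<^esub> k" if "k \<le> d" for k
    using that
  proof (induction k)
    case 0
    show ?case unfolding T0 el_id[OF W] cl_id by (intro conjI permutes_id) simp
  next
    case (Suc k)
    have k: "Suc k \<in> {1..d}" using Suc.prems by simp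
    have t: "transpose (u @ [Suc k]) (v @ [Suc k]) permutes W" by (intro permutes_swap_id Wm k)
    have IH: "T k permutes W" "cl (el W (T k) (\<lambda>_. id)) = e [^]\<^bsub>QG\<^esub> k"
      using Suc.IH[OF Suc_leD[OF Suc.prems]] by iprover+
    have "cl (el W (T (Suc k)) (\<lambda>_. id)) = e \<otimes>\<^bsub>QG\<^esub> e [^]\<^bsub>QG\<^esub> k"
      unfolding TS cl_perm_comp[OF W t IH(1)] IH(2) swp_eq[OF W Wm[OF k]] e[OF k] ..
    also have "\<dots> = e [^]\<^bsub>QG\<^esub> Suc k" using Q.nat_pow_Suc2[OF eV] by simp
    finally show ?case using permutes_compose[OF IH(1) t, folded TS] by iprover
  qed
  have "swp u v = el W (T d) (\<lambda>_. id)"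
  proof -
    obtain Q where Q: "code d Q" "W \<subseteq> Q" by (rule antichain_extend[OF W])
    have t: "el_ok {u, v} (transpose u v) (\<lambda>_. id)" by (rule transpose_ok[OF assms(2)]) auto
    have TW: "el_ok W (T d) (\<lambda>_. id)" using Tk[OF order_refl] by (intro perm_ok W) iprover
    show ?thesis
    proof (rule ext_code[OF Q(1)])
      fix w y assume w: "w \<in> Q" and y: "y \<in> infwords d"
      show "swp u v (conc w y) = el W (T d) (\<lambda>_. id) (conc w y)"
      proof (cases "w \<in> W")
        case True
        then obtain a where a: "a \<in> {1..d}" "w = u @ [a] \<or> w = v @ [a]" by (auto simp: W_def kids_def)
        have ay: "conc [a] y \<in> infwords d" using a y by simp
        have "swp u v (conc (u @ [a]) y) = conc (v @ [a]) y" "swp u v (conc (v @ [a]) y) = conc (u @ [a]) y"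
          unfolding swp_def conc_append using el_conc[OF assms(2) _ ay] by simp_all
        then show ?thesis using el_conc[OF W True y] a Tu Tv by auto
      next
        case False
        \<comment> \<open>A point in the ball of \<open>u\<close> or \<open>v\<close> has a prefix
          in \<open>W\<close>, one letter longer; uniqueness in the code would make this prefix
          equal to \<open>w\<close>.\<close>
        have "pre (length x) (conc w y) \<noteq> x" if x: "x \<in> {u, v}" for x
        proof
          assume xp: "pre (length x) (conc w y) = x"
          have yy: "conc w y \<in> infwords d" using y codeD(3)[OF Q(1) w] by simp
          define k where "k = pre (Suc (length x)) (conc w y)"
          have "k \<in> W" using xp x yy unfolding k_def pre_Suc W_def kids_def by (auto simp: infwords_def)
          then have "k = w"
            using antichain_eq[OF codeD(1)[OF Q(1)], of k w "conc w y"] w Q(2) by (auto simp: k_def)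
          then show False using False \<open>k \<in> W\<close> by simp
        qed
        then have "swp u v (conc w y) = conc w y" unfolding swp_def by (intro el_other) auto
        moreover have "el W (T d) (\<lambda>_. id) (conc w y) = conc w y"
          using el_code[OF TW Q w y] permutes_not_in[OF el_okD(2)[OF TW] False] by simp
        ultimately show ?thesis by simp
      qed
    qed (simp add: swp_def el_other)
  qed
  then have "cl (swp u v) = e [^]\<^bsub>QG\<^esub> d" using Tk[OF order_refl] by simp
  also have "\<dots> = \<one>\<^bsub>QG\<^esub>"
  proof -
    obtain k where k: "d = 2 * k" using assms(1) by (rule evenE)
    have "e [^]\<^bsub>QG\<^esub> (2 :: nat) = \<one>\<^bsub>QG\<^esub>"
      using eV cl_swp_sq[OF W1[of 1]] d1 by (simp add: numeral_2_eq_2 e_def)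
    then show ?thesis using Q.nat_pow_pow[OF eV, of 2 k] Q.nat_pow_one[of k] k by metis
  qed
  finally show ?thesis .
qed

lemma cl_swp:
  assumes "antichain d {u, v}" "u \<noteq> v"
  shows "cl (swp u v) = cl s0"
proof (cases "odd d")
  case False
  have "antichain d {[2, 1], [2, 2]}" using antichain_subset[OF s0_antichain] by simp
  then show ?thesis using cl_swp_even[of u v] cl_swp_even[of "[2, 1]" "[2, 2]"] False assms by (simp add: s0_def)
qed (use cl_swp_odd assms in simp)

lemma s0_V [simp]: "s0 \<in> V"
  unfolding s0_def using antichain_subset[OF s0_antichain] by (intro swp_V) simp

lemma cl_s0_sq: "cl s0 \<otimes>\<^bsub>QG\<^esub> cl s0 = \<one>\<^bsub>QG\<^esub>"
  unfolding s0_def using antichain_subset[OF s0_antichain] by (intro cl_swp_sq) simp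

lemma cl_s0_even: "even d \<Longrightarrow> cl s0 = \<one>\<^bsub>QG\<^esub>"
  unfolding s0_def using antichain_subset[OF s0_antichain] by (intro cl_swp_even) auto

lemma cl_perm:
  assumes U: "antichain d U" and p: "p permutes U"
  shows "cl (el U p (\<lambda>_. id)) = (if evenperm p then \<one>\<^bsub>QG\<^esub> else cl s0)"
  using p antichainD(1)[OF U]
proof (induction rule: permutes_induct)
  case id
  show ?case by (simp only: el_id[OF U] cl_id evenperm_id if_True)
next
  case (swap a b p)
  have t: "transpose a b permutes U" using swap by (intro permutes_swap_id)
  have "antichain d {a, b}" using antichain_subset[OF U] swap by simp
  then have eq: "cl (el U (transpose a b \<circ> p) (\<lambda>_. id)) = cl s0 \<otimes>\<^bsub>QG\<^esub> (if evenperm p then \<one>\<^bsub>QG\<^esub> else cl s0)"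
    using cl_perm_comp[OF U t swap(4)] swp_eq[OF U swap(1,2)] cl_swp swap by simp
  have ev: "evenperm (transpose a b \<circ> p) \<longleftrightarrow> \<not> evenperm p"
    using swap permutes_imp_permutation[OF antichainD(1)[OF U]]
    by (simp add: evenperm_comp permutation_swap_id evenperm_swap)
  show ?case unfolding eq ev using cl_s0_sq by simp
qed

subsection \<open>Letter permutations below a ball\<close>

lemma Lam_ok: "finword d w \<Longrightarrow> h \<in> H \<Longrightarrow> el_ok {w} id (\<lambda>_. h)"
  by (simp add: el_ok_def antichain_insert)

lemma Lam_V: "finword d w \<Longrightarrow> h \<in> H \<Longrightarrow> Lam w h \<in> V"
  and Lam_V': "finword d w \<Longrightarrow> h \<in> H \<Longrightarrow> Lam w h \<in> V'"
  unfolding Lam_def by (auto intro: el_V el_V' Lam_ok)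

lemma Lam_comp: "finword d w \<Longrightarrow> h \<in> H \<Longrightarrow> k \<in> H \<Longrightarrow> Lam w h \<circ> Lam w k = Lam w (h \<circ> k)"
  unfolding Lam_def using el_comp(1)[OF Lam_ok Lam_ok] by simp

lemma Lam_eq:
  assumes "antichain d U" "w \<in> U" "h \<in> H"
  shows "el U id (\<lambda>x. if x = w then h else id) = Lam w h" "el_ok U id (\<lambda>x. if x = w then h else id)"
proof -
  have w: "antichain d {w}" "el_ok {w} id (\<lambda>x. if x = w then h else id)"
    using assms antichain_subset[OF assms(1)] by (auto simp: el_ok_def)
  have "el {w} id (\<lambda>x. if x = w then h else id) = Lam w h"
    unfolding Lam_def by (rule el_cong[OF w(1)]) auto
  then show "el U id (\<lambda>x. if x = w then h else id) = Lam w h" "el_ok U id (\<lambda>x. if x = w then h else id)"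
    using el_extend[OF w(2) assms(1)] assms(2) by auto
qed

text \<open>A three-cycle taking \<open>w\<close> to \<open>w'\<close> conjugates one map into the
  other. Being even, it lies in \<open>V'\<close>, where classes commute. The swap of
  \<open>w\<close> and \<open>w'\<close> alone may lie outside \<open>V'\<close>, hence the third
  ball \<open>c\<close>.\<close>

lemma cl_Lam_eq:
  assumes U: "antichain d {w, w', c}" and ne: "w \<noteq> w'" "w \<noteq> c" "w' \<noteq> c" and h: "h \<in> H"
  shows "cl (Lam w h) = cl (Lam w' h)"
proof -
  let ?U = "{w, w', c}" and ?p = "transpose w w' \<circ> transpose w' c"
  have p: "?p permutes ?U" by (intro permutes_compose permutes_swap_id) auto
  have "evenperm ?p" using ne by (simp add: evenperm_comp permutation_swap_id evenperm_swap)
  note ok = perm_ok[OF U p]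
  have f: "el ?U ?p (\<lambda>_. id) \<in> V'" "el ?U ?p (\<lambda>_. id) \<in> V"
    using el_V'[OF ok \<open>evenperm ?p\<close>] el_V[OF ok] by auto
  let ?e = "\<lambda>w x. if x = w then h else id"
  have L: "el ?U id (?e w) = Lam w h" "el ?U id (?e w') = Lam w' h"
    and Lok: "el_ok ?U id (?e w)" "el_ok ?U id (?e w')"
    using Lam_eq[OF U _ h] by auto
  have "el ?U ?p (\<lambda>_. id) \<circ> Lam w h = el ?U ?p (?e w)"
    using el_comp(1)[OF ok Lok(1)] L(1) by simp
  also have "\<dots> = el ?U ?p (\<lambda>x. ?e w' (?p x))"
    using ne by (intro el_cong[OF U]) (auto simp: transpose_def)
  also have "\<dots> = Lam w' h \<circ> el ?U ?p (\<lambda>_. id)"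
    using el_comp(1)[OF Lok(2) ok] L(2) by simp
  finally have eq: "el ?U ?p (\<lambda>_. id) \<circ> Lam w h = Lam w' h \<circ> el ?U ?p (\<lambda>_. id)" .
  have fw: "finword d w" "finword d w'" using antichainD(2)[OF U] by auto
  note LV = Lam_V[OF fw(1) h] Lam_V[OF fw(2) h]
  have "cl (Lam w h) \<otimes>\<^bsub>QG\<^esub> cl (el ?U ?p (\<lambda>_. id)) = cl (Lam w' h) \<otimes>\<^bsub>QG\<^esub> cl (el ?U ?p (\<lambda>_. id))"
    using cl_commute[OF f(1) Lam_V'[OF fw(1) h]] arg_cong[OF eq, of cl] cl_comp[OF f(2) LV(1)] cl_comp[OF LV(2) f(2)]
    by simp
  then show ?thesis using LV f(2) by (simp add: Q.r_cancel)
qed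

text \<open>A word beginning with \<open>1\<close> is disjoint from \<open>[2, 1]\<close> and
  \<open>[2, 2]\<close>, any other nonempty word from \<open>[1, 1]\<close> and
  \<open>[1, 2]\<close>. Of these two balls one receives the germ and the other serves as third
  ball. The empty word has no disjoint ball.\<close>

lemma cl_Lam_nonempty:
  assumes w: "finword d w" "w \<noteq> []" and h: "h \<in> H"
  shows "cl (Lam w h) = cl (Lam [1] h)"
proof -
  have tri: "antichain d {u, v, c}" if "u \<parallel> v" "u \<parallel> c" "v \<parallel> c" "finword d u" "finword d v" "finword d c" for u v c
    using that by (simp add: antichain_insert)
  have par: "[2 :: nat, 1] \<parallel> [2, 2]" "[1 :: nat, 1] \<parallel> [1, 2]" by (simp_all add: parallel_same_length)
  obtain a r where ar: "w = a # r" using w(2) by (cases w) auto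
  have 21: "cl (Lam [2, 1] h) = cl (Lam [1] h)"
    using letters par by (intro cl_Lam_eq[of _ _ "[2, 2]"] tri h) (auto simp: parallel_Cons)
  have 11: "cl (Lam [1, 1] h) = cl (Lam [2, 1] h)"
    using letters par by (intro cl_Lam_eq[of _ _ "[2, 2]"] tri h) (auto simp: parallel_Cons)
  show ?thesis
  proof (cases "a = 1")
    case True
    then have "cl (Lam w h) = cl (Lam [2, 1] h)"
      using letters par w ar by (intro cl_Lam_eq[of _ _ "[2, 2]"] tri h) (auto simp: parallel_Cons)
    then show ?thesis using 21 by simp
  next
    case False
    then have "cl (Lam w h) = cl (Lam [1, 1] h)"
      using letters par w ar by (intro cl_Lam_eq[of _ _ "[1, 2]"] tri h) (auto simp: parallel_Cons)
    then show ?thesis using 11 21 by simp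
  qed
qed

abbreviation lam where "lam h \<equiv> cl (Lam [1] h)"

lemma lam_closed [simp]: "h \<in> H \<Longrightarrow> lam h \<in> carrier QG"
  by (intro cl_closed Lam_V letters)

lemma lam_comp: "h \<in> H \<Longrightarrow> k \<in> H \<Longrightarrow> lam (h \<circ> k) = lam h \<otimes>\<^bsub>QG\<^esub> lam k"
  unfolding Lam_comp[OF letters(5), symmetric] by (intro cl_comp Lam_V letters)

lemma lam_id: "lam id = \<one>\<^bsub>QG\<^esub>"
  using el_id[of "{[1]}"] letters cl_id by (simp add: Lam_def antichain_insert)

lemma el_insert:
  assumes "antichain d (insert w S)" "w \<notin> S" "\<And>v. v \<in> insert w S \<Longrightarrow> \<eta> v \<in> H"
  shows "el (insert w S) id \<eta> = Lam w (\<eta> w) \<circ> el S id \<eta>"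
proof -
  let ?U = "insert w S" and ?e = "\<lambda>x. if x = w then \<eta> w else id" and ?r = "\<lambda>x. if x = w then id else \<eta> x"
  have S: "antichain d S" using antichain_subset[OF assms(1)] by auto
  have okS: "el_ok S id ?r" using S assms(2,3) by (simp add: el_ok_def)
  have r: "el ?U id ?r = el S id ?r" "el_ok ?U id ?r"
    by (rule el_extend[OF okS assms(1) subset_insertI]; auto)+
  have "el S id ?r = el S id \<eta>" by (rule el_cong[OF S]) (use assms(2) in auto)
  then have "Lam w (\<eta> w) \<circ> el S id \<eta> = el ?U id ?e \<circ> el ?U id ?r"
    using Lam_eq(1)[OF assms(1) insertI1 assms(3)[OF insertI1]] r(1) by simp
  also have "\<dots> = el ?U (id \<circ> id) (\<lambda>x. ?e (id x) \<circ> ?r x)"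
    using el_comp(1)[OF Lam_eq(2)[OF assms(1) insertI1 assms(3)[OF insertI1]] r(2)] .
  also have "\<dots> = el ?U id \<eta>" by (rule el_cong[OF assms(1)]) auto
  finally show ?thesis by simp
qed

lemma cl_el_id:
  assumes "antichain d U" "[] \<notin> U" "\<And>w. w \<in> U \<Longrightarrow> \<eta> w \<in> H"
  shows "\<exists>k\<in>H. cl (el U id \<eta>) = lam k"
  using antichainD(1)[OF assms(1)] assms
proof (induction U rule: finite_induct)
  case empty
  have "el {} id \<eta> = id" by (auto simp: el_def)
  then have "cl (el {} id \<eta>) = lam id" by (simp only: lam_id cl_id)
  then show ?case using H_id by (rule bexI)
next
  case (insert w S)
  have S: "antichain d S" using antichain_subset[OF insert.prems(1)] by auto
  have "\<exists>k\<in>H. cl (el S id \<eta>) = lam k"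
    by (rule insert.IH[OF S]) (use insert.prems in auto)
  then obtain k where k: "k \<in> H" "cl (el S id \<eta>) = lam k" by blast
  have w: "finword d w" "w \<noteq> []" "\<eta> w \<in> H" using insert.prems antichainD(2)[OF insert.prems(1)] by auto
  have "cl (el (insert w S) id \<eta>) = cl (Lam w (\<eta> w)) \<otimes>\<^bsub>QG\<^esub> cl (el S id \<eta>)"
    using el_insert[OF insert.prems(1) insert.hyps(2) insert.prems(3)] Lam_V[OF w(1,3)] el_V[of S id \<eta>]
      S insert.prems(3) by (simp add: cl_comp el_ok_def)
  also have "\<dots> = lam (\<eta> w \<circ> k)" using k w cl_Lam_nonempty lam_comp by simp
  finally show ?case using H_comp[OF w(3) k(1)] by (rule bexI)
qed

lemma cl_el_const:
  assumes "antichain d U" "[] \<notin> U" "h \<in> H"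
  shows "cl (el U id (\<lambda>_. h)) = lam h [^]\<^bsub>QG\<^esub> card U"
  using antichainD(1)[OF assms(1)] assms
proof (induction U rule: finite_induct)
  case empty
  have "el {} id (\<lambda>_. h) = id" by (auto simp: el_def)
  then have "cl (el {} id (\<lambda>_. h)) = lam h [^]\<^bsub>QG\<^esub> card {}"
    by (simp only: cl_id card.empty Q.nat_pow_0)
  then show ?case .
next
  case (insert w S)
  have S: "antichain d S" using antichain_subset[OF insert.prems(1)] by auto
  have IH: "cl (el S id (\<lambda>_. h)) = lam h [^]\<^bsub>QG\<^esub> card S"
    by (rule insert.IH[OF S]) (use insert.prems in auto)
  have w: "finword d w" "w \<noteq> []" using insert.prems antichainD(2)[OF insert.prems(1)] by auto
  have "cl (el (insert w S) id (\<lambda>_. h)) = cl (Lam w h) \<otimes>\<^bsub>QG\<^esub> cl (el S id (\<lambda>_. h))"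
    using el_insert[OF insert.prems(1) insert.hyps(2), of "\<lambda>_. h"] Lam_V[OF w(1) insert.prems(3)]
      el_V[of S id "\<lambda>_. h"] S insert.prems(3) by (simp add: cl_comp el_ok_def)
  also have "\<dots> = lam h [^]\<^bsub>QG\<^esub> card (insert w S)"
    using IH w insert.prems(3) cl_Lam_nonempty Q.nat_pow_Suc2[OF lam_closed] insert.hyps by simp
  finally show ?case .
qed

lemma antichain_kids: "finword d w \<Longrightarrow> antichain d (kids d w)"
  unfolding antichain_def kids_def using parallel_snoc_same by auto

text \<open>Reading \<open>1 y \<mapsto> 1 h(y)\<close> one letter deeper, it permutes the balls below \<open>1\<close> by \<open>h\<close>
  and acts by \<open>h\<close> inside each of them.\<close>

lemma lam_split:
  assumes h: "h \<in> H"
  shows "lam h = (if evenperm h then \<one>\<^bsub>QG\<^esub> else cl s0) \<otimes>\<^bsub>QG\<^esub> lam h [^]\<^bsub>QG\<^esub> d"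
proof -
  let ?K = "kids d [1]" and ?f = "\<lambda>a. [1 :: nat] @ [a]"
  have K: "antichain d ?K" "[] \<notin> ?K" using antichain_kids[OF letters(5)] by (auto simp: kids_def)
  have inj: "inj_on ?f {1..d}" by (auto simp: inj_on_def)
  \<comment> \<open>The letter permutation \<open>h\<close> transported to the children of
    \<open>[1]\<close>, with the same parity.\<close>
  define p where "p = map_permutation {1..d} ?f h"
  have p: "p permutes ?K" unfolding p_def kids_def
    by (rule map_permutation_permutes[OF _ H_permutes[OF h]]) (rule inj_on_imp_bij_betw[OF inj])
  have pa: "p (?f a) = ?f (h a)" if "a \<in> {1..d}" for a
    unfolding p_def using map_permutation_apply[OF inj that] .
  have ev: "evenperm p \<longleftrightarrow> evenperm h"
    unfolding p_def using evenperm_map_permutation[OF inj H_permutes[OF h]] by simp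
  have ok: "el_ok ?K p (\<lambda>_. id)" "el_ok ?K id (\<lambda>_. h)"
    using K p h by (auto simp: el_ok_def)
  have okp: "el_ok ?K p (\<lambda>_. h)" using K p h by (auto simp: el_ok_def)
  obtain Q where Q: "code d Q" "?K \<subseteq> Q" by (rule antichain_extend[OF K(1)])
  have "Lam [1] h = el ?K p (\<lambda>_. h)"
  proof (rule ext_code[OF Q(1)])
    fix w y assume w: "w \<in> Q" and y: "y \<in> infwords d"
    show "Lam [1] h (conc w y) = el ?K p (\<lambda>_. h) (conc w y)"
    proof (cases "w \<in> ?K")
      case True
      then obtain a where a: "a \<in> {1..d}" "w = ?f a" by (auto simp: kids_def)
      have ay: "conc [a] y \<in> infwords d" using a y by simp
      have "Lam [1] h (conc w y) = conc [1] (h \<circ> conc [a] y)"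
        unfolding Lam_def a(2) conc_append using el_conc[of "{[1]}" "[1]" "conc [a] y"] ay letters
        by (simp add: antichain_insert)
      also have "\<dots> = conc (?f (h a)) (h \<circ> y)" unfolding conc_append comp_conc by simp
      finally show ?thesis using el_conc[OF K(1) True y] pa[OF a(1)] a(2) by simp
    next
      case False
      have yy: "conc w y \<in> infwords d" using y codeD(3)[OF Q(1) w] by simp
      have "pre (length [1 :: nat]) (conc w y) \<noteq> [1]"
      proof
        assume xp: "pre (length [1 :: nat]) (conc w y) = [1]"
        define k where "k = pre (Suc (length [1 :: nat])) (conc w y)"
        have "k \<in> ?K" using xp yy unfolding k_def pre_Suc[of "length [1 :: nat]"] kids_def
          by (auto simp: infwords_def)
        then have "k = w"
          using antichain_eq[OF codeD(1)[OF Q(1)], of k w "conc w y"] w Q(2) by (auto simp: k_def)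
        then show False using False \<open>k \<in> ?K\<close> by simp
      qed
      then have "Lam [1] h (conc w y) = conc w y" unfolding Lam_def by (intro el_other) auto
      moreover have "el ?K p (\<lambda>_. h) (conc w y) = conc w y"
        using el_code[OF okp Q w y] permutes_not_in[OF p False] False by simp
      ultimately show ?thesis by simp
    qed
  qed (simp add: Lam_def el_other)
  also have "\<dots> = el ?K p (\<lambda>_. id) \<circ> el ?K id (\<lambda>_. h)" using el_comp(1)[OF ok] by simp
  finally have "lam h = cl (el ?K p (\<lambda>_. id)) \<otimes>\<^bsub>QG\<^esub> cl (el ?K id (\<lambda>_. h))"
    using cl_comp[OF el_V[OF ok(1)] el_V[OF ok(2)]] by simp
  then show ?thesis using cl_perm[OF K(1) p] cl_el_const[OF K h] ev by simp
qed

text \<open>Cancel \<open>lam h\<close> in \<open>lam_split\<close>; the sign factor is its own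
  inverse.\<close>

lemma lam_pow:
  assumes h: "h \<in> H"
  shows "lam h [^]\<^bsub>QG\<^esub> (d - 1) = (if evenperm h then \<one>\<^bsub>QG\<^esub> else cl s0)"
proof -
  define s where "s = (if evenperm h then \<one>\<^bsub>QG\<^esub> else cl s0)"
  have s: "s \<in> carrier QG" "s \<otimes>\<^bsub>QG\<^esub> s = \<one>\<^bsub>QG\<^esub>" using cl_s0_sq by (auto simp: s_def)
  define x where "x = lam h [^]\<^bsub>QG\<^esub> (d - 1)"
  have x: "x \<in> carrier QG" unfolding x_def by (rule Q.nat_pow_closed[OF lam_closed[OF h]])
  have "lam h [^]\<^bsub>QG\<^esub> d = x \<otimes>\<^bsub>QG\<^esub> lam h"
    using d1 by (cases d) (auto simp: x_def)
  then have "(s \<otimes>\<^bsub>QG\<^esub> x) \<otimes>\<^bsub>QG\<^esub> lam h = lam h"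
    using lam_split[OF h] s(1) x lam_closed[OF h] by (simp add: s_def[symmetric] Q.m_assoc)
  then have "s \<otimes>\<^bsub>QG\<^esub> x = \<one>\<^bsub>QG\<^esub>"
    using s(1) x lam_closed[OF h] by (simp add: Q.r_cancel_one)
  then have "s \<otimes>\<^bsub>QG\<^esub> x = s \<otimes>\<^bsub>QG\<^esub> s" using s(2) by simp
  then have "x = s" using s(1) x by simp
  then show ?thesis by (simp add: x_def s_def)
qed

end

text \<open>The prescribed part is completed by any bijection between the complements, which have
  the same size.\<close>

lemma permutation_extending:
  assumes "finite U" "inj_on e S" "inj_on f S" "e ` S \<subseteq> U" "f ` S \<subseteq> U"
  obtains p where "p permutes U" "\<And>a. a \<in> S \<Longrightarrow> p (e a) = f a"
proof -
  have "card (e ` S) = card (f ` S)" using assms(2,3) by (simp add: card_image)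
  then have "card (U - e ` S) = card (U - f ` S)"
    using assms(1,4,5) by (simp add: card_Diff_subset finite_subset)
  from finite_same_card_bij[OF finite_Diff[OF assms(1)] finite_Diff[OF assms(1)] this]
  obtain b where b: "bij_betw b (U - e ` S) (U - f ` S)" by blast
  have a: "bij_betw (f \<circ> inv_into S e) (e ` S) (f ` S)"
    using bij_betw_trans[OF bij_betw_inv_into[OF inj_on_imp_bij_betw[OF assms(2)]] inj_on_imp_bij_betw[OF assms(3)]] .
  define p where "p x = (if x \<in> e ` S then (f \<circ> inv_into S e) x else if x \<in> U then b x else x)" for x
  have "bij_betw p (e ` S) (f ` S)"
    using a by (rule bij_betw_cong[THEN iffD1, rotated]) (simp add: p_def)
  moreover have "bij_betw p (U - e ` S) (U - f ` S)"
    using b by (rule bij_betw_cong[THEN iffD1, rotated]) (simp add: p_def)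
  ultimately have "bij_betw p (e ` S \<union> (U - e ` S)) (f ` S \<union> (U - f ` S))"
    by (rule bij_betw_combine) blast
  then have "bij_betw p U U" using assms(4,5) by (simp add: Un_absorb1)
  then have "p permutes U"
    by (rule bij_imp_permutes) (use assms(4) in \<open>auto simp: p_def\<close>)
  moreover have "p (e a) = f a" if "a \<in> S" for a
    using that assms(2) by (simp add: p_def)
  ultimately show thesis by (rule that)
qed

context rn_group
begin

section \<open>Generation\<close>

text \<open>Induction on the number of words. A permutation of the target code matches the images of
  a source caret, letter by letter, with a caret of the target. The composite then has a form on the
  parent, so the caret can be cancelled, and the permutation contributes only \<open>cl s0\<close>
  or nothing.\<close>

lemma cl_germ_free:
  assumes "f \<in> V" "code d Q" "\<And>w. w \<in> Q \<Longrightarrow> \<exists>u. aff f w u id"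
  shows "cl f \<in> {\<one>\<^bsub>QG\<^esub>, cl s0}"
  using assms
proof (induction "card Q" arbitrary: f Q rule: less_induct)
  case less
  note f = less.prems(1) and Q = less.prems(2)
  have ad: "adapted f Q" unfolding adapted_def using less.prems(3) by blast
  have af: "aff f w (tgt f w) id" if "w \<in> Q" for w
    using less.prems(3)[OF that] tgt_eq by metis
  note img = adapted_code_image[OF f Q ad]
  let ?U = "tgt f ` Q"
  show ?case
  proof (cases "Q = {[]}")
    case True
    \<comment> \<open>A larger image code would contain a caret, hence at least \<open>d\<close>
      words, but it has only one word.\<close>
    have "?U = {[]}"
    proof (rule ccontr)
      assume "?U \<noteq> {[]}"
      then obtain w where "kids d w \<subseteq> ?U" by (rule code_caret[OF d1 img(1)])
      then have "d \<le> card ?U" using card_mono[of ?U "kids d w"] True by simp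
      then show False using d2 True by simp
    qed
    then have "aff f [] [] id" using af[of "[]"] True by simp
    from affD(3)[OF this] VD(3)[OF f] have "f = id"
      by (intro ext) (metis comp_id conc_Nil id_apply id_comp)
    then show ?thesis using cl_id by simp
  next
    case False
    then obtain w where w: "kids d w \<subseteq> Q" by (rule code_caret[OF d1 Q])
    have "d \<le> card Q" using card_mono[OF codeD(2)[OF Q] w] by simp
    then have "card ?U \<noteq> card {[] :: nat list}" using d2 card_image[OF img(2)] by simp
    then have "?U \<noteq> {[]}" by metis
    then obtain u where u: "kids d u \<subseteq> ?U" by (rule code_caret[OF d1 img(1)])
    have wa: "w @ [a] \<in> Q" "u @ [a] \<in> ?U" if "a \<in> {1..d}" for a
      using w u that by (auto simp: kids_def)
    have i1: "inj_on (\<lambda>a. tgt f (w @ [a])) {1..d}"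
    proof (rule inj_onI)
      fix a b assume ab: "a \<in> {1..d}" "b \<in> {1..d}" "tgt f (w @ [a]) = tgt f (w @ [b])"
      show "a = b" using inj_onD[OF img(2) ab(3) wa(1)[OF ab(1)] wa(1)[OF ab(2)]] by simp
    qed
    have i2: "inj_on (\<lambda>a. u @ [a]) {1..d}" by (auto simp: inj_on_def)
    obtain p where p: "p permutes ?U" "\<And>a. a \<in> {1..d} \<Longrightarrow> p (tgt f (w @ [a])) = u @ [a]"
    proof (rule permutation_extending[OF codeD(2)[OF img(1)] i1 i2])
      show "(\<lambda>a. tgt f (w @ [a])) ` {1..d} \<subseteq> ?U" using wa(1) by blast
      show "(\<lambda>a. u @ [a]) ` {1..d} \<subseteq> ?U" using wa(2) by blast
    qed (rule that)
    note U = codeD(1)[OF img(1)] and ok = perm_ok[OF codeD(1)[OF img(1)] p(1)]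
    let ?P = "el ?U p (\<lambda>_. id)"
    define g where "g = ?P \<circ> f"
    have PV: "?P \<in> V" by (rule el_V[OF ok])
    have gV: "g \<in> V" unfolding g_def using f PV by (rule V_comp)
    have ag: "aff g v (p (tgt f v)) id" if "v \<in> Q" for v
      using aff_comp[OF af[OF that] el_aff[OF ok img(1) subset_refl imageI[OF that]]]
      unfolding g_def by (simp add: that)
    have "finword d u" using codeD(3)[OF img(1) wa(2)[of 1]] d1 by simp
    \<comment> \<open>The \<open>d\<close> forms on the children of \<open>w\<close> glue because
      \<open>w @ [a]\<close> goes to \<open>u @ [a]\<close> with the same letter and trivial
      germ.\<close>
    have agw: "aff g w u id"
      unfolding aff_def
    proof (intro conjI ballI \<open>finword d u\<close> H_id)
      fix y assume y: "y \<in> infwords d"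
      define a y' where "a = y 0" and "y' = sdrop (Suc 0) y"
      have yy: "y = conc [a] y'"
        unfolding a_def y'_def by (auto simp: fun_eq_iff conc_def sdrop_def)
      have a: "a \<in> {1..d}" "y' \<in> infwords d" using y by (auto simp: a_def y'_def infwords_def sdrop_def)
      have "g (conc (w @ [a]) y') = conc (u @ [a]) (id \<circ> y')"
        using affD(3)[OF ag[OF wa(1)[OF a(1)]] a(2)] p(2)[OF a(1)] by simp
      then show "g (conc w y) = conc u (id \<circ> y)" unfolding yy conc_append by simp
    qed
    let ?Q1 = "insert w (Q - kids d w)"
    note con = code_contract[OF d1 Q w]
    have "card ?Q1 < card Q"
    proof -
      have "card ?Q1 = Suc (card Q - d)"
        using con(2) codeD(2)[OF Q] w by (simp add: card_Diff_subset)
      then show ?thesis using \<open>d \<le> card Q\<close> d2 by simp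
    qed
    then have cg: "cl g \<in> {\<one>\<^bsub>QG\<^esub>, cl s0}"
      using less.hyps[OF _ gV con(1)] ag agw by blast
    have cP: "cl ?P \<in> {\<one>\<^bsub>QG\<^esub>, cl s0}" using cl_perm[OF U p(1)] by simp
    have sq: "cl ?P \<otimes>\<^bsub>QG\<^esub> cl ?P = \<one>\<^bsub>QG\<^esub>" using cP cl_s0_sq by auto
    have "cl g = cl ?P \<otimes>\<^bsub>QG\<^esub> cl f" unfolding g_def by (rule cl_comp[OF PV f])
    then have "cl f = cl ?P \<otimes>\<^bsub>QG\<^esub> cl g"
      using sq PV f by (simp add: Q.m_assoc[symmetric])
    then show ?thesis using cP cg cl_s0_sq by auto
  qed
qed

text \<open>Precomposing with the inverse germs on every word of a uniform code leaves a map with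
  trivial germs, to which \<open>cl_germ_free\<close> applies; the correcting map itself has a class
  \<open>lam k\<close>.\<close>

lemma cl_decomposition:
  assumes g: "g \<in> V"
  obtains c k where "c \<in> {\<one>\<^bsub>QG\<^esub>, cl s0}" "k \<in> H" "cl g = c \<otimes>\<^bsub>QG\<^esub> lam k"
proof -
  obtain n where n: "\<And>m. n \<le> m \<Longrightarrow> adapted g (words d m)"
    using exists_uniform[OF VD(2)[OF g]] by blast
  \<comment> \<open>Length \<open>Suc n\<close> rather than \<open>n\<close> keeps the empty word
    out of the code, as \<open>cl_el_id\<close> requires.\<close>
  let ?Q = "words d (Suc n)"
  note Q = code_words[of d "Suc n"]
  have ad: "adapted g ?Q" by (rule n) simp
  define \<eta> where "\<eta> w = inv' (germ g w)" for w
  have \<eta>: "\<eta> w \<in> H" "germ g w \<circ> \<eta> w = id" if "w \<in> ?Q" for w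
    using affD(2)[OF adaptedD[OF ad that]] H_inv_comp(2) by (simp_all add: \<eta>_def)
  have ok: "el_ok ?Q id \<eta>" using \<eta>(1) codeD(1)[OF Q] by (simp add: el_ok_def)
  let ?E = "el ?Q id \<eta>"
  have EV: "?E \<in> V" by (rule el_V[OF ok])
  have af: "aff (g \<circ> ?E) w (tgt g w) id" if w: "w \<in> ?Q" for w
    using aff_comp[OF el_aff[OF ok Q subset_refl w], of g "tgt g w" "germ g w"] adaptedD[OF ad w] \<eta>(2)[OF w] w
    by simp
  have c: "cl (g \<circ> ?E) \<in> {\<one>\<^bsub>QG\<^esub>, cl s0}"
    by (rule cl_germ_free[OF V_comp[OF EV g] Q]) (use af in blast)
  have "[] \<notin> ?Q" by (simp add: words_def)
  then have "\<exists>k\<in>H. cl ?E = lam k"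
    by (rule cl_el_id[OF codeD(1)[OF Q]]) (rule \<eta>(1))
  then obtain k where k: "k \<in> H" "cl ?E = lam k" by blast
  have "lam k \<otimes>\<^bsub>QG\<^esub> lam (inv' k) = \<one>\<^bsub>QG\<^esub>"
    using lam_comp[OF k(1) H_inv[OF k(1)]] H_inv_comp(2)[OF k(1)] lam_id by simp
  moreover have "cl (g \<circ> ?E) = cl g \<otimes>\<^bsub>QG\<^esub> lam k" using cl_comp[OF g EV] k(2) by simp
  ultimately have "cl g = cl (g \<circ> ?E) \<otimes>\<^bsub>QG\<^esub> lam (inv' k)"
    using cl_closed[OF g] lam_closed[OF k(1)] lam_closed[OF H_inv[OF k(1)]] by (simp add: Q.m_assoc)
  then show thesis using that c H_inv[OF k(1)] by blast
qed

section \<open>The kernel\<close>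

definition HG where "HG = (sym_group d)\<lparr>carrier := H\<rparr>"

lemma HG_simps [simp]: "carrier HG = H" "x \<otimes>\<^bsub>HG\<^esub> y = x \<circ> y" "\<one>\<^bsub>HG\<^esub> = id"
  by (simp_all add: HG_def sym_group_mult sym_group_one)

sublocale HG: group HG
  unfolding HG_def by (rule group.subgroup_imp_group[OF sym_group_is_group subH])

lemma HG_inv [simp]: "h \<in> H \<Longrightarrow> inv\<^bsub>HG\<^esub> h = inv' h"
  by (rule HG.inv_equality) (simp_all add: H_inv_comp)

lemma HG_pow: "h [^]\<^bsub>sym_group d\<^esub> (n :: nat) = h [^]\<^bsub>HG\<^esub> n"
  by (induction n) (simp_all add: nat_pow_def HG_def)

lemma HG_pow_mem: "h \<in> H \<Longrightarrow> h [^]\<^bsub>HG\<^esub> (n :: nat) \<in> H"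
  using HG.nat_pow_closed[of h n] by simp

lemma lam_hom: "group_hom HG QG lam"
  using lam_comp lam_closed by unfold_locales (auto simp: hom_def simp del: One_nat_def)

lemma lam_nat_pow: "h \<in> H \<Longrightarrow> lam (h [^]\<^bsub>HG\<^esub> n) = lam h [^]\<^bsub>QG\<^esub> (n :: nat)"
  using group_hom.hom_nat_pow[OF lam_hom, of h n] by simp

text \<open>A factor \<open>cl s0\<close> has to be absorbed or excluded, and only for odd
  \<open>d\<close>. If \<open>H\<close> has an odd \<open>h\<close>, then \<open>cl s0\<close> is
  \<open>lam\<close> of the power \<open>d - 1\<close> of \<open>h\<close>; otherwise
  \<open>s0\<close> has sign -1 and \<open>g\<close> would not be in \<open>V'\<close>.\<close>

lemma V'_lam:
  assumes g: "g \<in> V'"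
  shows "\<exists>k\<in>H. cl g = lam k"
proof -
  have gV: "g \<in> V" using subgroup.mem_carrier[OF V'_subgroup g] by simp
  obtain c k where c: "c \<in> {\<one>\<^bsub>QG\<^esub>, cl s0}" and k: "k \<in> H" "cl g = c \<otimes>\<^bsub>QG\<^esub> lam k" by (rule cl_decomposition[OF gV])
  show ?thesis
  proof (cases "c = \<one>\<^bsub>QG\<^esub>")
    case True
    then show ?thesis using k lam_closed[OF k(1)] by (intro bexI[OF _ k(1)]) simp
  next
    case False
    then have cs: "c = cl s0" "cl s0 \<noteq> \<one>\<^bsub>QG\<^esub>" using c by auto
    then have "odd d" using cl_s0_even by auto
    show ?thesis
    proof (cases exceptional)
      case True
      obtain s where s: "s \<in> hom VG sign_img" "V' = {g \<in> V. s g = 1}"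
        "\<And>U p \<eta>. el_ok U p \<eta> \<Longrightarrow> s (el U p \<eta>) = (if evenperm p then 1 else -1)"
        using sign_V'[OF True] by blast
      have LV: "Lam [1] k \<in> V" by (rule Lam_V[OF letters(5) k(1)])
      have "cl g = cl (s0 \<circ> Lam [1] k)" using k(2) cs(1) cl_comp[OF s0_V LV] by simp
      moreover have "g \<in> cl g"
        unfolding cl_def using group.rcos_self[OF VG_group _ normal_imp_subgroup[OF D_normal]] gV by simp
      \<comment> \<open>Equality of classes becomes an equation in \<open>V\<close> with a factor
        \<open>x\<close> from \<open>D\<close>, which has sign 1 because
        \<open>D \<subseteq> V'\<close>.\<close>
      ultimately obtain x where x: "x \<in> D" "g = x \<circ> (s0 \<circ> Lam [1] k)"
        unfolding cl_def r_coset_def by auto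
      have xV: "x \<in> V" "s x = 1" using x(1) D_subset s(2) by auto
      have a: "antichain d {[2, 1], [2, 2]}" using antichain_subset[OF s0_antichain] by simp
      have "s s0 = -1"
        unfolding s0_def swp_def using s(3)[OF transpose_ok[OF a]] by (simp add: evenperm_swap)
      moreover have "s (Lam [1] k) = 1"
        unfolding Lam_def using s(3)[OF Lam_ok[OF letters(5) k(1)]] by simp
      moreover have "s g = s x \<otimes>\<^bsub>sign_img\<^esub> (s s0 \<otimes>\<^bsub>sign_img\<^esub> s (Lam [1] k))"
        using hom_mult[OF s(1), of x "s0 \<circ> Lam [1] k"] hom_mult[OF s(1), of s0 "Lam [1] k"] x(2) xV(1) LV
        by simp
      ultimately have "s g = -1" using xV(2) by (simp add: sign_img_def)
      then show ?thesis using g s(2) by simp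
    next
      case False
      then have "\<exists>h\<in>H. \<not> evenperm h"
        using \<open>odd d\<close> H_permutes by (auto simp: exceptional_def alt_group_carrier)
      then obtain h where h: "h \<in> H" "\<not> evenperm h" by blast
      let ?h = "h [^]\<^bsub>HG\<^esub> (d - 1)"
      have hH: "?h \<in> H" by (rule HG_pow_mem[OF h(1)])
      have "c = lam ?h" using lam_nat_pow[OF h(1)] lam_pow[OF h(1)] h(2) cs(1) by simp
      then have "cl g = lam (?h \<circ> k)" using lam_comp[OF hH k(1)] k(2) by simp
      then show ?thesis using H_comp[OF hH k(1)] by (rule bexI)
    qed
  qed
qed

section \<open>The subgroup N and the abelian quotient H/N\<close>

abbreviation N where "N \<equiv> Nsub d H"

definition gens where
  "gens = derived_set (sym_group d) H \<union>
    (if even d then powers_set (sym_group d) H (d - 1)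
     else powers_set (sym_group d) (H \<inter> carrier (alt_group d)) (d - 1))"

lemma N_gens: "N = generate (sym_group d) gens"
  by (simp add: Nsub_def gens_def)

lemma H_carrier: "H \<subseteq> carrier (sym_group d)"
  using subgroup.subset[OF subH] .

lemma sym_inv: "h \<in> H \<Longrightarrow> inv\<^bsub>sym_group d\<^esub> h = inv' h"
  using H_carrier by (intro sym_group_inv_equality) auto

lemma gens_cases:
  assumes "x \<in> gens"
  obtains h k where "h \<in> H" "k \<in> H" "x = h \<circ> k \<circ> inv' h \<circ> inv' k"
  | h where "h \<in> H" "even d \<or> evenperm h" "x = h [^]\<^bsub>HG\<^esub> (d - 1)"
proof -
  consider "x \<in> derived_set (sym_group d) H"
    | "x \<in> (if even d then powers_set (sym_group d) H (d - 1)
     else powers_set (sym_group d) (H \<inter> carrier (alt_group d)) (d - 1))"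
    using assms unfolding gens_def by blast
  then show thesis
  proof cases
    case 1
    then obtain h k where hk: "h \<in> H" "k \<in> H"
      "x = h \<otimes>\<^bsub>sym_group d\<^esub> k \<otimes>\<^bsub>sym_group d\<^esub> inv\<^bsub>sym_group d\<^esub> h \<otimes>\<^bsub>sym_group d\<^esub> inv\<^bsub>sym_group d\<^esub> k" by auto
    then show thesis using that(1)[OF hk(1,2)] by (simp only: sym_group_mult sym_inv)
  next
    case 2
    then obtain h where "h \<in> H" "even d \<or> evenperm h" "x = h [^]\<^bsub>sym_group d\<^esub> (d - 1)"
      by (auto simp: powers_set_def alt_group_carrier split: if_splits)
    then show thesis using that(2) by (simp only: HG_pow)
  qed
qed

lemma gens_commutator: "h \<in> H \<Longrightarrow> k \<in> H \<Longrightarrow> h \<circ> k \<circ> inv' h \<circ> inv' k \<in> gens"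
proof -
  assume hk: "h \<in> H" "k \<in> H"
  have "h \<otimes>\<^bsub>sym_group d\<^esub> k \<otimes>\<^bsub>sym_group d\<^esub> inv\<^bsub>sym_group d\<^esub> h \<otimes>\<^bsub>sym_group d\<^esub> inv\<^bsub>sym_group d\<^esub> k \<in> gens"
    unfolding gens_def using hk by blast
  then show ?thesis using hk by (simp only: sym_group_mult sym_inv)
qed

lemma gens_power: "h \<in> H \<Longrightarrow> even d \<or> evenperm h \<Longrightarrow> h [^]\<^bsub>HG\<^esub> (d - 1) \<in> gens"
  using H_permutes by (auto simp: gens_def powers_set_def alt_group_carrier HG_pow)

lemma gens_subset: "gens \<subseteq> H"
proof
  fix x assume "x \<in> gens"
  then show "x \<in> H" by (cases rule: gens_cases) (use HG_pow_mem in simp_all)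
qed

lemma N_subgroup: "subgroup N HG"
proof -
  have "subgroup N (sym_group d)"
    unfolding N_gens using gens_subset H_carrier
    by (intro group.generate_is_subgroup[OF sym_group_is_group]) blast
  moreover have "N \<subseteq> H"
    unfolding N_gens by (rule group.generate_subgroup_incl[OF sym_group_is_group gens_subset subH])
  ultimately show ?thesis
    unfolding HG_def using group.subgroup_incl[OF sym_group_is_group _ subH] by blast
qed

lemma gens_N: "x \<in> gens \<Longrightarrow> x \<in> N"
  unfolding N_gens by (rule generate.incl)

lemma N_normal: "N \<lhd> HG"
  unfolding HG.normal_inv_iff
proof (intro conjI ballI N_subgroup)
  fix x n assume x: "x \<in> carrier HG" and n: "n \<in> N"
  have nH: "n \<in> H" using subgroup.mem_carrier[OF N_subgroup n] by simp
  \<comment> \<open>A conjugate of \<open>n\<close> is the commutator of \<open>x\<close> and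
    \<open>n\<close> times \<open>n\<close>.\<close>
  have "(x \<circ> n \<circ> inv' x \<circ> inv' n) \<circ> n \<in> N"
    using subgroup.m_closed[OF N_subgroup gens_N[OF gens_commutator] n] x nH by simp
  moreover have "(x \<circ> n \<circ> inv' x \<circ> inv' n) \<circ> n = x \<circ> n \<circ> inv' x"
    using H_inv_comp(1)[OF nH] by (simp add: comp_assoc)
  ultimately show "x \<otimes>\<^bsub>HG\<^esub> n \<otimes>\<^bsub>HG\<^esub> inv\<^bsub>HG\<^esub> x \<in> N" using x by simp
qed

definition BG where "BG = HG Mod N"

definition phi where "phi h = N #>\<^bsub>HG\<^esub> h"

lemma BG_group: "group BG"
  unfolding BG_def by (rule normal.factorgroup_is_group[OF N_normal])

lemma phi_hom: "group_hom HG BG phi"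
  using normal.r_coset_hom_Mod[OF N_normal] BG_group HG.is_group
  by (simp add: group_hom_def group_hom_axioms_def BG_def phi_def[abs_def])

lemma phi_one_iff: "h \<in> H \<Longrightarrow> phi h = \<one>\<^bsub>BG\<^esub> \<longleftrightarrow> h \<in> N"
  using HG.coset_join1[of N h] HG.coset_join2[of h N] N_subgroup subgroup.subset[OF N_subgroup]
  by (auto simp: phi_def BG_def FactGroup_def)

lemma BG_comm: "comm_group BG"
proof (rule group.group_comm_groupI[OF BG_group])
  interpret B: group BG by (rule BG_group)
  note hom_mult = group_hom.hom_mult[OF phi_hom] and hom_closed = group_hom.hom_closed[OF phi_hom]
  fix u v assume "u \<in> carrier BG" "v \<in> carrier BG"
  then obtain x y where xy: "x \<in> H" "y \<in> H" "u = phi x" "v = phi y"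
    by (auto simp: BG_def phi_def FactGroup_def RCOSETS_def)
  let ?c = "x \<circ> y \<circ> inv' x \<circ> inv' y"
  have c: "?c \<in> H" "phi ?c = \<one>\<^bsub>BG\<^esub>"
    using xy gens_N[OF gens_commutator[OF xy(1,2)]] phi_one_iff[of ?c] by auto
  have "?c \<circ> (y \<circ> x) = x \<circ> y"
    using H_inv_comp(1)[OF xy(1)] H_inv_comp(1)[OF xy(2)] by (metis comp_assoc comp_id)
  then have "phi (x \<circ> y) = phi ?c \<otimes>\<^bsub>BG\<^esub> phi (y \<circ> x)"
    using hom_mult[of ?c "y \<circ> x"] c(1) xy by simp
  then show "u \<otimes>\<^bsub>BG\<^esub> v = v \<otimes>\<^bsub>BG\<^esub> u"
    using c(2) xy hom_mult[of x y] hom_mult[of y x] hom_closed[of x] hom_closed[of y] by simp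
qed

lemma phi_pow_one: "h \<in> H \<Longrightarrow> even d \<or> evenperm h \<Longrightarrow> phi h [^]\<^bsub>BG\<^esub> (d - 1) = \<one>\<^bsub>BG\<^esub>"
  using group_hom.hom_nat_pow[OF phi_hom, of h "d - 1"] phi_one_iff[OF HG_pow_mem[of h "d - 1"]]
    gens_N[OF gens_power] by simp

text \<open>For odd \<open>d\<close> and an odd \<open>k \<in> H\<close>, \<open>eps\<close> is
  \<open>phi k\<close> to the power \<open>d - 1\<close>. The choice of \<open>k\<close> does not
  matter: for odd \<open>h\<close> the product \<open>h \<circ> k\<close> is even, so the powers of
  \<open>phi h\<close> and \<open>phi k\<close> are mutually inverse, and the case
  \<open>h = k\<close> shows that \<open>eps\<close> has square one. In all other cases
  \<open>eps\<close> is trivial.\<close>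

lemma exists_eps:
  "\<exists>eps. rn_char_axioms d H BG phi eps"
proof -
  note hom_mult = group_hom.hom_mult[OF phi_hom] and hom_closed = group_hom.hom_closed[OF phi_hom]
  interpret B: comm_group BG by (rule BG_comm)
  have pc: "phi h \<in> carrier BG" if "h \<in> H" for h using hom_closed that by simp
  have pm: "phi (h \<circ> k) = phi h \<otimes>\<^bsub>BG\<^esub> phi k" if "h \<in> H" "k \<in> H" for h k
    using hom_mult[of h k] that by simp
  have dd: "x [^]\<^bsub>BG\<^esub> d = x \<otimes>\<^bsub>BG\<^esub> x [^]\<^bsub>BG\<^esub> (d - 1)" if "x \<in> carrier BG" for x
    using B.nat_pow_Suc2[OF that, of "d - 1"] d1 by simp
  have ev: "even (invs h {1..d}) \<longleftrightarrow> evenperm h" if "h \<in> H" for h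
    using evenperm_iff_invs[OF _ H_permutes[OF that]] by simp
  show ?thesis
  proof (cases "even d \<or> (\<forall>h\<in>H. evenperm h)")
    case True
    have "rn_char_axioms d H BG phi \<one>\<^bsub>BG\<^esub>"
    proof
      show "phi h [^]\<^bsub>BG\<^esub> d = phi h \<otimes>\<^bsub>BG\<^esub> \<one>\<^bsub>BG\<^esub> [^]\<^bsub>BG\<^esub> invs h {1..d}" if "h \<in> H" for h
        unfolding dd[OF pc[OF that]] using phi_pow_one[OF that] True that pc by auto
    qed (simp_all add: pc pm)
    then show ?thesis by blast
  next
    case False
    then obtain k where k: "k \<in> H" "\<not> evenperm k" and d: "odd d" by blast
    define eps where "eps = phi k [^]\<^bsub>BG\<^esub> (d - 1)"
    have perm: "permutation h" if "h \<in> H" for h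
      using permutes_imp_permutation[OF _ H_permutes[OF that]] by simp
    have eC: "eps \<in> carrier BG" unfolding eps_def using pc[OF k(1)] by simp
    have odd: "phi h [^]\<^bsub>BG\<^esub> (d - 1) \<otimes>\<^bsub>BG\<^esub> eps = \<one>\<^bsub>BG\<^esub>" if h: "h \<in> H" "\<not> evenperm h" for h
    proof -
      have "evenperm (h \<circ> k)" using evenperm_comp[OF perm[OF h(1)] perm[OF k(1)]] h(2) k(2) by simp
      then have "phi (h \<circ> k) [^]\<^bsub>BG\<^esub> (d - 1) = \<one>\<^bsub>BG\<^esub>" using phi_pow_one[OF H_comp[OF h(1) k(1)]] by simp
      then show ?thesis
        unfolding eps_def pm[OF h(1) k(1)] using B.nat_pow_distrib[OF pc[OF h(1)] pc[OF k(1)]] by simp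
    qed
    have e2: "eps \<otimes>\<^bsub>BG\<^esub> eps = \<one>\<^bsub>BG\<^esub>" using odd[OF k] by (simp add: eps_def)
    have oddeq: "phi h [^]\<^bsub>BG\<^esub> (d - 1) = eps" if h: "h \<in> H" "\<not> evenperm h" for h
    proof -
      have "phi h [^]\<^bsub>BG\<^esub> (d - 1) \<in> carrier BG" using pc[OF h(1)] by simp
      moreover have "phi h [^]\<^bsub>BG\<^esub> (d - 1) \<otimes>\<^bsub>BG\<^esub> eps = eps \<otimes>\<^bsub>BG\<^esub> eps" using odd[OF h] e2 by simp
      ultimately show ?thesis using eC by simp
    qed
    have epow: "eps [^]\<^bsub>BG\<^esub> (n :: nat) = (if even n then \<one>\<^bsub>BG\<^esub> else eps)" for n
      by (induction n) (use e2 eC in auto)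
    have "rn_char_axioms d H BG phi eps"
    proof
      show "phi h [^]\<^bsub>BG\<^esub> d = phi h \<otimes>\<^bsub>BG\<^esub> eps [^]\<^bsub>BG\<^esub> invs h {1..d}" if "h \<in> H" for h
        unfolding dd[OF pc[OF that]] epow using ev[OF that] oddeq[OF that] phi_pow_one[OF that] by simp
    qed (simp_all add: pc pm eC e2 d)
    then show ?thesis by blast
  qed
qed

text \<open>The character with values in the abelian group \<open>BG\<close> is trivial on
  \<open>D\<close>, and on \<open>Lam [1] h\<close> it takes the value \<open>phi h\<close>: no word
  is moved, and only \<open>[1]\<close> can carry a nontrivial germ.\<close>

lemma Lam_D_imp_N:
  assumes h: "h \<in> H" and L: "Lam [1] h \<in> D"
  shows "h \<in> N"
proof -
  obtain eps where "rn_char_axioms d H BG phi eps" using exists_eps by blast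
  then interpret C: rn_char d H BG phi eps
    by (intro rn_char.intro rn_group_axioms BG_comm)
  interpret Chi: group_hom VG BG C.Chi
    using C.Chi_hom VG_group BG_group by (simp add: group_hom_def group_hom_axioms_def)
  have "D \<subseteq> kernel VG BG C.Chi"
    unfolding D_def derived_def
  proof (rule group.generate_subgroup_incl[OF VG_group _ Chi.subgroup_kernel])
    show "derived_set VG V' \<subseteq> kernel VG BG C.Chi"
    proof
      fix x assume "x \<in> derived_set VG V'"
      then obtain a b where ab: "a \<in> V'" "b \<in> V'"
        "x = a \<otimes>\<^bsub>VG\<^esub> b \<otimes>\<^bsub>VG\<^esub> inv\<^bsub>VG\<^esub> a \<otimes>\<^bsub>VG\<^esub> inv\<^bsub>VG\<^esub> b" by auto
      have V: "a \<in> carrier VG" "b \<in> carrier VG" using ab subgroup.mem_carrier[OF V'_subgroup] by auto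
      then have "x \<in> carrier VG" unfolding ab(3)
        by (intro Chi.G.m_closed Chi.G.inv_closed)
      moreover have "C.Chi x = \<one>\<^bsub>BG\<^esub>"
      proof -
        have c: "C.Chi a \<in> carrier BG" "C.Chi b \<in> carrier BG" using V by (auto intro: Chi.hom_closed)
        have "C.Chi x = C.Chi a \<otimes>\<^bsub>BG\<^esub> C.Chi b \<otimes>\<^bsub>BG\<^esub> inv\<^bsub>BG\<^esub> C.Chi a \<otimes>\<^bsub>BG\<^esub> inv\<^bsub>BG\<^esub> C.Chi b"
          unfolding ab(3) using V
          by (simp only: Chi.hom_mult Chi.hom_inv Chi.G.m_closed Chi.G.inv_closed)
        also have "\<dots> = \<one>\<^bsub>BG\<^esub>"
          using c by (simp add: C.m_comm[of "C.Chi a" "C.Chi b"] C.m_assoc C.r_inv)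
        finally show ?thesis .
      qed
      ultimately show "x \<in> kernel VG BG C.Chi" by (simp add: kernel_def)
    qed
  qed
  then have one: "C.Chi (Lam [1] h) = \<one>\<^bsub>BG\<^esub>" using L by (auto simp: kernel_def)
  note ok = Lam_ok[OF letters(5) h]
  obtain Q where Q: "code d Q" "{[1]} \<subseteq> Q" by (rule antichain_extend[OF el_okD(1)[OF ok]])
  have af: "aff (Lam [1] h) w w (if w \<in> {[1]} then h else id)" if "w \<in> Q" for w
    using el_aff[OF ok Q that] unfolding Lam_def by simp
  have "invs (tgt (Lam [1] h)) Q = invs (\<lambda>w. w) Q"
    using tgt_eq[OF af] by (intro invs_cong)
  then have i: "invs (tgt (Lam [1] h)) Q = 0" by simp
  let ?f = "\<lambda>w. phi (germ (Lam [1] h) w)"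
  have f1: "?f [1] = phi h" using germ_eq[OF af, of "[1]"] Q(2) by simp
  have f0: "?f w = \<one>\<^bsub>BG\<^esub>" if "w \<in> Q" "w \<noteq> [1]" for w
    using germ_eq[OF af[OF that(1)]] that(2) phi_one_iff[OF H_id] subgroup.one_closed[OF N_subgroup] by simp
  have "finprod BG ?f (insert [1] (Q - {[1]})) = ?f [1] \<otimes>\<^bsub>BG\<^esub> finprod BG ?f (Q - {[1]})"
    using codeD(2)[OF Q(1)] f0 f1 C.phi_closed[OF h] by (intro C.finprod_insert) auto
  also have "finprod BG ?f (Q - {[1]}) = \<one>\<^bsub>BG\<^esub>"
    using f0 by (intro C.finprod_one_eqI) auto
  finally have "finprod BG ?f Q = phi h"
    using Q(2) f1 C.phi_closed[OF h] by (simp add: insert_absorb)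
  moreover have "C.Chi (Lam [1] h) = C.chi (Lam [1] h) Q"
    using af by (intro C.Chi_eq Lam_V letters h Q(1)) (auto simp: adapted_def)
  ultimately have "C.Chi (Lam [1] h) = phi h"
    using C.phi_closed[OF h] unfolding C.chi_def i by simp
  then show ?thesis using one phi_one_iff[OF h] by simp
qed

lemma lam_commute: "h \<in> H \<Longrightarrow> k \<in> H \<Longrightarrow> lam h \<otimes>\<^bsub>QG\<^esub> lam k = lam k \<otimes>\<^bsub>QG\<^esub> lam h"
  by (intro cl_commute Lam_V' letters)

text \<open>Generators of \<open>N\<close> die because classes of \<open>V'\<close> commute and
  because \<open>lam_pow\<close> computes the powers, with trivial \<open>cl s0\<close> for even
  \<open>d\<close>. The opposite inclusion is \<open>Lam_D_imp_N\<close>.\<close>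

lemma lam_kernel: "kernel HG QG lam = N"
proof
  interpret lam: group_hom HG QG lam by (rule lam_hom)
  show "kernel HG QG lam \<subseteq> N"
    using Lam_D_imp_N cl_eq_one_iff[OF Lam_V[OF letters(5)]] by (auto simp: kernel_def)
  have "gens \<subseteq> kernel HG QG lam"
  proof
    fix x assume "x \<in> gens"
    then show "x \<in> kernel HG QG lam"
    proof (cases rule: gens_cases)
      case (1 h k)
      note hk = 1(1,2) H_inv[OF 1(1)] H_inv[OF 1(2)]
      have "lam x = (lam h \<otimes>\<^bsub>QG\<^esub> lam k) \<otimes>\<^bsub>QG\<^esub> lam (inv' h) \<otimes>\<^bsub>QG\<^esub> lam (inv' k)"
        unfolding 1(3) using hk by (simp only: lam_comp H_comp)
      also have "\<dots> = lam (k \<circ> h \<circ> inv' h \<circ> inv' k)"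
        unfolding lam_commute[OF hk(1,2)] using hk by (simp only: lam_comp H_comp)
      also have "k \<circ> h \<circ> inv' h \<circ> inv' k = id"
        using H_inv_comp(2)[OF hk(1)] H_inv_comp(2)[OF hk(2)] by (metis comp_assoc comp_id)
      finally have "lam x = \<one>\<^bsub>QG\<^esub>" by (simp only: lam_id)
      then show ?thesis using gens_subset \<open>x \<in> gens\<close> by (auto simp: kernel_def)
    next
      case (2 h)
      have "lam x = (if evenperm h then \<one>\<^bsub>QG\<^esub> else cl s0)"
        unfolding 2(3) lam_nat_pow[OF 2(1)] by (rule lam_pow[OF 2(1)])
      then have "lam x = \<one>\<^bsub>QG\<^esub>" using 2(2) cl_s0_even by auto
      then show ?thesis using gens_subset \<open>x \<in> gens\<close> by (auto simp: kernel_def)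
    qed
  qed
  \<comment> \<open>\<open>N\<close> is generated inside the symmetric group, so the kernel is
    regarded as a subgroup there.\<close>
  moreover have "subgroup (kernel HG QG lam) (sym_group d)"
    using group.incl_subgroup[OF sym_group_is_group subH] lam.subgroup_kernel unfolding HG_def by blast
  ultimately show "N \<subseteq> kernel HG QG lam"
    unfolding N_gens by (intro group.generate_subgroup_incl[OF sym_group_is_group])
qed

section \<open>The abelianization\<close>

definition VG' where "VG' = VG\<lparr>carrier := V'\<rparr>"

lemma VG'_eq: "Vgroup' d H = VG'"
  by (simp add: Vgroup'_def VG'_def VG_def)

lemma VG'_group: "group VG'"
  unfolding VG'_def by (rule group.subgroup_imp_group[OF VG_group V'_subgroup])

lemma derived_VG': "derived VG' (carrier VG') = D"
  unfolding VG'_def D_def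
  using group.derived_consistent[OF VG_group subset_refl V'_subgroup] by simp

lemma abelianization_eq: "abelianization (Vgroup' d H) = VG' Mod D"
  by (simp only: abelianization_def VG'_eq derived_VG')

lemma ab_proj_eq: "ab_proj (Vgroup' d H) g = cl g"
  unfolding ab_proj_def VG'_eq derived_VG' by (simp add: cl_def r_coset_def VG'_def)

lemma Lambda1_eq: "Lambda1 d h = Lam [1] h"
proof
  fix x
  have a: "antichain d {[1]}" using letters by (simp add: antichain_insert)
  show "Lambda1 d h x = Lam [1] h x"
  proof (cases "x \<in> infwords d \<and> x 0 = 1")
    case True
    then have x: "x = conc [1] (sdrop 1 x)" "sdrop 1 x \<in> infwords d"
      by (auto simp: fun_eq_iff conc_def sdrop_def infwords_def)
    have "Lam [1] h (conc [1] (sdrop 1 x)) = conc [1] (h \<circ> sdrop 1 x)"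
      unfolding Lam_def using el_conc[OF a _ x(2), of "[1]"] by simp
    then have "Lam [1] h x = conc [1] (h \<circ> sdrop 1 x)" using x(1) by metis
    then show ?thesis using True by (simp add: Lambda1_def sdrop_def)
  next
    case False
    then have "x \<notin> infwords d \<or> (\<forall>w\<in>{[1]}. pre (length w) x \<noteq> w)" by (simp add: pre_def)
    then show ?thesis using False unfolding Lam_def by (subst el_other) (auto simp: Lambda1_def)
  qed
qed

lemma abelianization_lam:
  defines "A \<equiv> VG' Mod D"
  shows "lam \<in> hom HG A" "lam ` H = carrier A" "kernel HG A lam = N" "A \<cong> HG Mod N" "finite (carrier A)"
proof -
  \<comment> \<open>Cosets of \<open>D\<close> are the same sets in \<open>VG'\<close> and in
    \<open>VG\<close>, so the abelianization is the image of \<open>V'\<close> in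
    \<open>QG\<close>.\<close>
  have cl': "D #>\<^bsub>VG'\<^esub> g = cl g" for g by (simp add: cl_def r_coset_def VG'_def)
  have carA: "carrier A = cl ` V'"
    unfolding A_def FactGroup_def RCOSETS_def by (auto simp: cl') (auto simp: VG'_def)
  have multA: "x \<otimes>\<^bsub>A\<^esub> y = x \<otimes>\<^bsub>QG\<^esub> y" for x y
    by (simp add: A_def QG_def FactGroup_def set_mult_def VG'_def)
  have oneA: "\<one>\<^bsub>A\<^esub> = \<one>\<^bsub>QG\<^esub>" by (simp add: A_def QG_def FactGroup_def)
  have A: "group A"
    unfolding A_def derived_VG'[symmetric]
    using group.derived_quot_is_comm_group[OF VG'_group] by (simp add: comm_group_def)
  show hom: "lam \<in> hom HG A"
    unfolding hom_def carA multA using lam_comp Lam_V'[OF letters(5)] by auto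
  show surj: "lam ` H = carrier A"
    unfolding carA using V'_lam Lam_V'[OF letters(5)] by (force simp del: One_nat_def)
  show ker: "kernel HG A lam = N"
    using lam_kernel unfolding kernel_def oneA .
  interpret lam: group_hom HG A lam
    using hom A HG.is_group by (simp add: group_hom_def group_hom_axioms_def)
  have "HG Mod N \<cong> A" using lam.FactGroup_iso surj unfolding ker by simp
  then show "A \<cong> HG Mod N"
    using group.iso_sym[OF normal.factorgroup_is_group[OF N_normal]] by blast
  show "finite (carrier A)" unfolding surj[symmetric] using finite_H by simp
qed

end

theorem theorem8p11:
  fixes d :: nat and H :: "(nat \<Rightarrow> nat) set"
  assumes "d \<ge> 2" and "subgroup H (sym_group d)"
  shows "(\<lambda>h. ab_proj (Vgroup' d H) (Lambda1 d h))
           \<in> hom ((sym_group d)\<lparr>carrier := H\<rparr>) (abelianization (Vgroup' d H))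
       \<and> (\<lambda>h. ab_proj (Vgroup' d H) (Lambda1 d h)) ` H = carrier (abelianization (Vgroup' d H))
       \<and> kernel ((sym_group d)\<lparr>carrier := H\<rparr>) (abelianization (Vgroup' d H))
            (\<lambda>h. ab_proj (Vgroup' d H) (Lambda1 d h)) = Nsub d H
       \<and> abelianization (Vgroup' d H) \<cong> ((sym_group d)\<lparr>carrier := H\<rparr>) Mod (Nsub d H)
       \<and> finite (carrier (abelianization (Vgroup' d H)))"
proof -
  interpret rn_group d H using assms by (rule rn_group.intro)
  show ?thesis
    unfolding ab_proj_eq Lambda1_eq abelianization_eq HG_def[symmetric]
    by (intro conjI abelianization_lam)
qed

end
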